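(* Let $L>0$, let $a\colon[0,L]\to\mathbb{R}$ be a Lebesgue integrable ($L^1$) function and let $g\colon[0,+\infty[\,\to\mathbb{R}$ be a continuous function. Set $$g_0^{inf}:=\liminf_{s\to0^+}\frac{g(s)}{s},\qquad g_0^{sup}:=\limsup_{s\to0^+}\frac{g(s)}{s},\qquad g_\infty:=\liminf_{s\to+\infty}\frac{g(s)}{s},$$ and assume $g_0^{inf}>-\infty$, $g_0^{sup}<+\infty$, $g_\infty>0$ (the value $g_\infty=+\infty$ is allowed). Assume moreover: (H1) there exist $m\ge1$ closed and pairwise disjoint intervals $I_1,\dots,I_m\subseteq[0,L]$ such that $a(x)\ge0$ for a.e. $x\in\bigcup_{i=1}^m I_i$ and $a(x)\le0$ for a.e. $x\in[0,L]\setminus\bigcup_{i=1}^m I_i$; (H2) $g(0)=0$ and $g\not\equiv0$; (H3) the following three implications hold: - if there exists $\delta>0$ such that $g(s)\ge0$ for all $s\in[0,\delta]$, then $a^+\not\equiv0$ on $[0,L]$ and $g_0^{sup}<\lambda_0^+$, where $\lambda_0^+>0$ is the first eigenvalue of $\varphi''+\lambda a^+(x)\varphi=0$, $\varphi(0)=\varphi(L)=0$; - if there exists $\delta>0$ such that $g(s)\le0$ for all $s\in[0,\delta]$, then $a^-\not\equiv0$ on $[0,L]$ and $g_0^{inf}>-\lambda_0^-$, where $\lambda_0^->0$ is the first eigenvalue of $\varphi''+\lambda a^-(x)\varphi=0$, $\varphi(0)=\varphi(L)=0$; - if $g(s)$ changes sign an infinite number of times in every neighborhood of zero, then $a\not\equiv0$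 on $[0,L]$ and $-\lambda_0<g_0^{inf}\le g_0^{sup}<\lambda_0$, where $\lambda_0>0$ is the first eigenvalue of $\varphi''+\lambda|a(x)|\varphi=0$, $\varphi(0)=\varphi(L)=0$; (H4) for every $i\in\{1,\dots,m\}$, $a\not\equiv0$ on $I_i$ and $g_\infty>\lambda_1^i$, where $\lambda_1^i>0$ is the first eigenvalue of $\varphi''+\lambda a^+(x)\varphi=0$ on $I_i$ with $\varphi|_{\partial I_i}=0$. Then there exists at least one positive solution of the two-point boundary value problem $$u''+a(x)g(u)=0,\qquad u(0)=u(L)=0.$$
   Context: Notation: $a^+(x):=\max\{a(x),0\}$ and $a^-(x):=\max\{-a(x),0\}$. For integrable weights, "$\not\equiv0$ on a set" means not equal to $0$ almost everywhere on that set. The first eigenvalue is the smallest positive $\lambda$ for which the stated linear Dirichlet problem has a nontrivial solution. A positive solution of the boundary value problem is an absolutely continuous function $u\colon[0,L]\to[0,+\infty[$ whose derivative $u'$ is absolutely continuous, which satisfies $u''(x)+a(x)g(u(x))=0$ for a.e. $x\in[0,L]$ and $u(0)=u(L)=0$, and such that $u(x)>0$ for every $x\in\,]0,L[$. *)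

theory Defs
  imports "HOL-Analysis.Analysis"
begin

(* The classical epsilon-delta notion for functions on {c..d}; HOL-Analysis uses the name
   absolutely_continuous for a relation between measures. *)
definition abs_continuous_on :: "real \<Rightarrow> real \<Rightarrow> (real \<Rightarrow> real) \<Rightarrow> bool" where
  "abs_continuous_on c d f \<longleftrightarrow>
     (\<forall>\<epsilon>>0. \<exists>\<delta>>0. \<forall>(n::nat) (s::nat \<Rightarrow> real) (t::nat \<Rightarrow> real).
        (\<forall>k<n. c \<le> s k \<and> s k \<le> t k \<and> t k \<le> d) \<and>
        disjoint_family_on (\<lambda>k. {s k<..<t k}) {..<n} \<and>
        (\<Sum>k<n. t k - s k) < \<delta>
        \<longrightarrow> (\<Sum>k<n. \<bar>f (t k) - f (s k)\<bar>) < \<epsilon>)"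

(* Solutions in the Caratheodory sense of u'' + f(x, u) = 0, u(c) = u(d) = 0. The function v is
   u', which is one-sided at the endpoints. *)
definition dirichlet_solution ::
  "(real \<Rightarrow> real \<Rightarrow> real) \<Rightarrow> real \<Rightarrow> real \<Rightarrow> (real \<Rightarrow> real) \<Rightarrow> bool" where
  "dirichlet_solution f c d u \<longleftrightarrow>
     abs_continuous_on c d u \<and>
     (\<exists>v. (\<forall>x\<in>{c..d}. (u has_real_derivative v x) (at x within {c..d})) \<and>
          abs_continuous_on c d v \<and>
          (AE x in lebesgue_on {c..d}.
             \<exists>w. (v has_real_derivative w) (at x within {c..d}) \<and> w + f x (u x) = 0)) \<and>
     u c = 0 \<and> u d = 0"

definition positive_solution ::
  "(real \<Rightarrow> real) \<Rightarrow> (real \<Rightarrow> real) \<Rightarrow> real \<Rightarrow> (real \<Rightarrow> real) \<Rightarrow> bool" where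
  "positive_solution a g L u \<longleftrightarrow>
     dirichlet_solution (\<lambda>x s. a x * g s) 0 L u \<and>
     (\<forall>x\<in>{0..L}. u x \<ge> 0) \<and> (\<forall>x\<in>{0<..<L}. u x > 0)"

definition dirichlet_eigenvalue :: "(real \<Rightarrow> real) \<Rightarrow> real \<Rightarrow> real \<Rightarrow> real \<Rightarrow> bool" where
  "dirichlet_eigenvalue w c d \<mu> \<longleftrightarrow>
     (\<exists>\<phi>. dirichlet_solution (\<lambda>x s. \<mu> * w x * s) c d \<phi> \<and> (\<exists>x\<in>{c..d}. \<phi> x \<noteq> 0))"

(* Only meaningful if a smallest positive eigenvalue exists, which is the case when c < d and w is
   integrable, nonnegative a.e. and not a.e. zero on {c..d}. *)
definition first_eigenvalue :: "(real \<Rightarrow> real) \<Rightarrow> real \<Rightarrow> real \<Rightarrow> real" where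
  "first_eigenvalue w c d = (LEAST \<mu>. \<mu> > 0 \<and> dirichlet_eigenvalue w c d \<mu>)"

definition pos_part :: "(real \<Rightarrow> real) \<Rightarrow> real \<Rightarrow> real" where
  "pos_part a x = max (a x) 0"

definition neg_part :: "(real \<Rightarrow> real) \<Rightarrow> real \<Rightarrow> real" where
  "neg_part a x = max (- a x) 0"

definition not_ae_zero_on :: "(real \<Rightarrow> real) \<Rightarrow> real set \<Rightarrow> bool" where
  "not_ae_zero_on w S \<longleftrightarrow> \<not> (AE x in lebesgue_on S. w x = 0)"

definition g_zero_inf :: "(real \<Rightarrow> real) \<Rightarrow> ereal" where
  "g_zero_inf g = Liminf (at_right 0) (\<lambda>s. ereal (g s / s))"

definition g_zero_sup :: "(real \<Rightarrow> real) \<Rightarrow> ereal" where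
  "g_zero_sup g = Limsup (at_right 0) (\<lambda>s. ereal (g s / s))"

definition g_infty :: "(real \<Rightarrow> real) \<Rightarrow> ereal" where
  "g_infty g = Liminf at_top (\<lambda>s. ereal (g s / s))"

(* Infinitely many sign changes in every right neighbourhood of 0: for every n there is an
   increasing chain of n + 1 points along which g alternates strictly in sign. *)
definition changes_sign_infinitely_at_zero :: "(real \<Rightarrow> real) \<Rightarrow> bool" where
  "changes_sign_infinitely_at_zero g \<longleftrightarrow>
     (\<forall>\<delta>>0. \<forall>n. \<exists>s::nat \<Rightarrow> real.
        strict_mono_on {..n} s \<and> s ` {..n} \<subseteq> {0<..<\<delta>} \<and>
        (\<forall>k<n. g (s k) * g (s (Suc k)) < 0))"

end

theory Submission
  imports Defs "HOL-Complex_Analysis.Great_Picard"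
begin

text \<open>
The solution is found by shooting from the left end point. Suppose first that the nonlinearity \<open>f\<close> is
Lipschitz, so that \<open>u'' + a f(u) = 0\<close>, \<open>u 0 = 0\<close>, \<open>u' 0 = s\<close> has exactly one solution, which depends
continuously on \<open>s\<close>.

For small \<open>s\<close> the solution stays in the range where the behaviour of \<open>g\<close> near 0 gives \<open>a f(u) \<le> \<kappa> w u\<close>, with
\<open>w\<close> the positive part, the negative part or the absolute value of \<open>a\<close>, according to the sign of \<open>g\<close> near 0, and \<open>\<kappa>\<close> below the first eigenvalue of \<open>w\<close>. The solution of
\<open>\<phi>'' + \<kappa> w \<phi> = 0\<close>, \<open>\<phi> 0 = 0\<close> is positive up to \<open>L\<close>, hence so is \<open>u\<close> by Sturm comparison
(\<open>small_solution_positive\<close>).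

For large \<open>s\<close> the solution cannot stay nonnegative. Indeed, a nonnegative solution is bounded on each of the
intervals where \<open>a \<ge> 0\<close>: tested against the first eigenfunction, the growth of \<open>g\<close> at infinity beyond the first
eigenvalue bounds a weighted mean of \<open>u\<close>, while \<open>u\<close> is almost
concave there and thus lies above a fixed fraction of its maximum (\<open>bound_on_positive_interval\<close>). Gronwall's
inequality then bounds \<open>u' 0\<close>.

Between the two regimes there is a first \<open>s\<close> whose solution acquires a zero. The zeros of nontrivial solutions
are simple, so this zero can only enter through \<open>L\<close> (\<open>shooting\<close>). The same theorem, with \<open>\<mu>\<close> in
\<open>\<phi>'' + \<mu> w \<phi> = 0\<close> as the parameter, shows that the least eigenvalue exists, has a positive
eigenfunction, and that smaller parameters give solutions without zeros (\<open>first_eigenvalue_properties\<close>).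

The function \<open>g\<close> is only continuous and may grow faster than linearly. The bound for solutions depends on \<open>g\<close>
only through a lower estimate \<open>q s - C\<close>, so \<open>g\<close> can be continued linearly beyond that bound without
affecting the solution. Continuity is dealt with by averaging \<open>g s / s\<close>, which produces Lipschitz functions
obeying the same linear estimates. Their solutions are bounded and equicontinuous together with their
derivatives, and they exceed a fixed height because smaller ones do not return to zero; the theorem of
Arzela and Ascoli yields a nontrivial limit (\<open>limit_of_solutions\<close>). An interior zero of the limit would be
double, and a solution with a double zero vanishes identically.
\<close>

section \<open>Calculus for indefinite integrals\<close>

lemma absolutely_integrable_mult_continuous:
  fixes m f :: "real \<Rightarrow> real"
  assumes "m absolutely_integrable_on {c..d}" "continuous_on {c..d} f"
  shows "(\<lambda>x. m x * f x) absolutely_integrable_on {c..d}"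
proof -
  have "f \<in> borel_measurable (lebesgue_on {c..d})"
    using continuous_imp_measurable_on_sets_lebesgue[OF assms(2)] by simp
  moreover have "bounded (f ` {c..d})"
    by (simp add: assms(2) compact_continuous_image compact_imp_bounded)
  ultimately show ?thesis
    using absolutely_integrable_bounded_measurable_product_real[of f "{c..d}" m] assms(1)
    by (simp add: mult.commute)
qed

lemma integral_difference:
  fixes m :: "real \<Rightarrow> real"
  assumes "m absolutely_integrable_on {c..d}" "c \<le> x" "x \<le> y" "y \<le> d"
  shows "integral {c..y} m - integral {c..x} m = integral {x..y} m"
proof -
  have "m integrable_on {c..y}"
    using assms absolutely_integrable_on_def integrable_on_subinterval[of m "{c..d}" c y] by auto
  then show ?thesis
    using Henstock_Kurzweil_Integration.integral_combine[of c x y m] assms by auto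
qed

lemma integral_abs_mono_subinterval:
  fixes m :: "real \<Rightarrow> real"
  assumes "m absolutely_integrable_on {c..d}" "c \<le> x" "x \<le> y" "y \<le> d"
  shows "integral {x..y} (\<lambda>t. \<bar>m t\<bar>) \<le> integral {c..d} (\<lambda>t. \<bar>m t\<bar>)"
proof -
  have s: "{x..y} \<subseteq> {c..d}" using assms by auto
  show ?thesis
    using assms(1) absolutely_integrable_on_subinterval[OF assms(1) s] s
    by (intro integral_subset_le) (auto simp: absolutely_integrable_on_def)
qed

text \<open>
Over a fine partition both sides telescope, so \<open>\<bar>h d - h c\<bar> \<le> \<epsilon> (N d - N c)\<close> for every \<open>\<epsilon>\<close>. With \<open>N\<close> the
integral of \<open>\<bar>m\<bar>\<close>, this takes the place of "zero derivative implies constant" for functions that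
are differentiable only almost everywhere.
\<close>
lemma constant_if_increments_negligible:
  fixes h N :: "real \<Rightarrow> real"
  assumes "c \<le> d"
    and small: "\<And>\<epsilon>. \<epsilon> > 0 \<Longrightarrow> \<exists>\<delta>>0. \<forall>x y. c \<le> x \<and> x \<le> y \<and> y \<le> d \<and> y - x < \<delta> \<longrightarrow>
              \<bar>h y - h x\<bar> \<le> \<epsilon> * (N y - N x)"
  shows "h d = h c"
proof -
  have bnd: "\<bar>h d - h c\<bar> \<le> \<epsilon> * (N d - N c)" if e0: "\<epsilon> > 0" for \<epsilon> :: real
  proof -
    obtain \<delta> where \<delta>: "\<delta> > 0"
      "\<And>x y. c \<le> x \<Longrightarrow> x \<le> y \<Longrightarrow> y \<le> d \<Longrightarrow> y - x < \<delta> \<Longrightarrow> \<bar>h y - h x\<bar> \<le> \<epsilon> * (N y - N x)"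
      using small[OF e0] by blast
    obtain n :: nat where n: "(d - c) / \<delta> < real n" using reals_Archimedean2 by blast
    with \<delta> assms have n0: "n > 0" by (metis divide_nonneg_pos diff_ge_0_iff_ge gr0I leD of_nat_0)
    define p where "p i = c + real i * ((d - c) / n)" for i
    have step: "p (Suc i) - p i = (d - c) / n" for i by (simp add: p_def algebra_simps add_divide_distrib[symmetric])
    have lt: "(d - c) / n < \<delta>" using n n0 \<delta> by (simp add: field_simps)
    have pl: "p i \<le> d" if "i \<le> n" for i
    proof -
      have "real i * ((d - c) / n) \<le> real n * ((d - c) / n)"
        using that assms by (intro mult_right_mono) auto
      then show ?thesis using n0 by (simp add: p_def)
    qed
    have pc: "c \<le> p i" for i using assms by (simp add: p_def)
    have pp: "p i \<le> p (Suc i)" for i using step[of i] assms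
      by (metis diff_ge_0_iff_ge divide_nonneg_nonneg of_nat_0_le_iff)
    have "h (p n) - h (p 0) = (\<Sum>i<n. h (p (Suc i)) - h (p i))"
      by (simp add: sum_lessThan_telescope[of "\<lambda>i. h (p i)"])
    then have "\<bar>h (p n) - h (p 0)\<bar> \<le> (\<Sum>i<n. \<bar>h (p (Suc i)) - h (p i)\<bar>)" by simp
    also have "\<dots> \<le> (\<Sum>i<n. \<epsilon> * (N (p (Suc i)) - N (p i)))"
    proof (rule sum_mono)
      fix i assume "i \<in> {..<n}"
      then show "\<bar>h (p (Suc i)) - h (p i)\<bar> \<le> \<epsilon> * (N (p (Suc i)) - N (p i))"
        using \<delta>(2)[OF pc pp pl, of i] step lt by auto
    qed
    also have "\<dots> = \<epsilon> * (N (p n) - N (p 0))"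
      by (simp add: sum_distrib_left[symmetric] sum_lessThan_telescope[of "\<lambda>i. N (p i)"])
    finally show ?thesis using n0 by (simp add: p_def)
  qed
  have "\<bar>h d - h c\<bar> \<le> e" if "e > 0" for e :: real
  proof -
    \<comment> \<open>positive, so that the previous bound may be used with \<open>e / K\<close>\<close>
    define K where "K = \<bar>N d - N c\<bar> + 1"
    have K: "K > 0" "N d - N c \<le> K" by (auto simp: K_def)
    have "\<bar>h d - h c\<bar> \<le> e / K * (N d - N c)" using bnd[of "e/K"] K that by auto
    also have "\<dots> \<le> e / K * K" using K that by (intro mult_left_mono) auto
    finally show ?thesis using K by simp
  qed
  then show ?thesis using field_le_epsilon[of "\<bar>h d - h c\<bar>" 0] by simp
qed

lemma continuous_indefinite_integral:
  fixes m F :: "real \<Rightarrow> real"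
  assumes "m absolutely_integrable_on {c..d}" "\<And>x. x \<in> {c..d} \<Longrightarrow> F x = F c + integral {c..x} m"
  shows "continuous_on {c..d} F"
proof -
  have "continuous_on {c..d} (\<lambda>x. F c + integral {c..x} m)"
    using assms(1) indefinite_integral_continuous_1 absolutely_integrable_on_def
    by (intro continuous_intros) blast
  then show ?thesis by (rule continuous_on_eq) (metis assms(2))
qed

text \<open>
By the mean value theorem an increment of \<open>f \<circ> F\<close> over a short interval is \<open>f'\<close>, at a value that \<open>F\<close> takes
there, times the integral of \<open>m\<close>. Moving \<open>f'\<close> under the integral as \<open>f' (F t)\<close> costs at most \<open>\<epsilon>\<close> times the
integral of \<open>\<bar>m\<bar>\<close>, by uniform continuity.
\<close>
lemma integral_chain_rule:
  fixes m F f f' :: "real \<Rightarrow> real"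
  assumes "c \<le> d" and m: "m absolutely_integrable_on {c..d}"
    and F: "\<And>x. x \<in> {c..d} \<Longrightarrow> F x = F c + integral {c..x} m"
    and f: "\<And>x. (f has_real_derivative f' x) (at x)" and f': "continuous_on UNIV f'"
  shows "f (F d) - f (F c) = integral {c..d} (\<lambda>t. f' (F t) * m t)"
proof -
  have Fc: "continuous_on {c..d} F" using continuous_indefinite_integral[OF m F] .
  have f'F: "continuous_on {c..d} (\<lambda>t. f' (F t))"
    using continuous_on_compose2[OF f' Fc] by simp
  define k where "k t = f' (F t) * m t" for t
  have k: "k absolutely_integrable_on {c..d}"
    unfolding k_def using absolutely_integrable_mult_continuous[OF m f'F] by (simp add: mult.commute)
  have am: "(\<lambda>t. \<bar>m t\<bar>) absolutely_integrable_on {c..d}"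
    using m by (rule set_integrable_abs)
  define h where "h x = f (F x) - integral {c..x} k" for x
  have "h d = h c"
  proof (rule constant_if_increments_negligible[of c d h "\<lambda>x. integral {c..x} (\<lambda>t. \<bar>m t\<bar>)"])
    show "c \<le> d" by fact
    fix \<epsilon> :: real assume e: "\<epsilon> > 0"
    have "uniformly_continuous_on {c..d} (\<lambda>t. f' (F t))"
      using compact_uniformly_continuous[OF f'F] by simp
    then obtain \<delta> where \<delta>: "\<delta> > 0"
      "\<And>x y. x \<in> {c..d} \<Longrightarrow> y \<in> {c..d} \<Longrightarrow> \<bar>y - x\<bar> < \<delta> \<Longrightarrow> \<bar>f' (F y) - f' (F x)\<bar> < \<epsilon>"
      using e unfolding uniformly_continuous_on_def dist_real_def by blast
    have "\<bar>h y - h x\<bar> \<le> \<epsilon> * (integral {c..y} (\<lambda>t. \<bar>m t\<bar>) - integral {c..x} (\<lambda>t. \<bar>m t\<bar>))"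
      if xy: "c \<le> x" "x \<le> y" "y \<le> d" "y - x < \<delta>" for x y
    proof -
      have Fd: "F y - F x = integral {x..y} m"
        using F[of x] F[of y] integral_difference[OF m xy(1-3)] xy by auto
      have "\<exists>z. (F x \<le> z \<and> z \<le> F y \<or> F y \<le> z \<and> z \<le> F x) \<and> f (F y) - f (F x) = f' z * (F y - F x)"
      proof (cases "F x" "F y" rule: linorder_cases)
        case less
        obtain z where "z > F x" "z < F y" "f (F y) - f (F x) = (F y - F x) * f' z"
          using MVT2[OF less, of f f'] f by blast
        then show ?thesis by (intro exI[of _ z]) auto
      next
        case greater
        obtain z where "z > F y" "z < F x" "f (F x) - f (F y) = (F x - F y) * f' z"
          using MVT2[OF greater, of f f'] f by blast
        then show ?thesis by (intro exI[of _ z]) (auto simp: algebra_simps)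
      qed (auto)
      then obtain z where z: "F x \<le> z \<and> z \<le> F y \<or> F y \<le> z \<and> z \<le> F x"
        "f (F y) - f (F x) = f' z * (F y - F x)" by blast
      have cxy: "continuous_on {x..y} F" using continuous_on_subset[OF Fc] xy by auto
      obtain s where s: "x \<le> s" "s \<le> y" "F s = z"
        using z(1) IVT'[of F x z y] IVT2'[of F y z x] cxy xy by blast
      have ixy: "m absolutely_integrable_on {x..y}" "k absolutely_integrable_on {x..y}"
        "(\<lambda>t. \<bar>m t\<bar>) absolutely_integrable_on {x..y}"
        using absolutely_integrable_on_subinterval[OF m] absolutely_integrable_on_subinterval[OF k]
          absolutely_integrable_on_subinterval[OF am] xy by auto
      then have i2: "m integrable_on {x..y}" "k integrable_on {x..y}" "(\<lambda>t. \<bar>m t\<bar>) integrable_on {x..y}"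
        by (auto simp: absolutely_integrable_on_def)
      have "h y - h x = f' z * integral {x..y} m - integral {x..y} k"
        using z(2) Fd integral_difference[OF k xy(1-3)] by (simp add: h_def)
      also have "\<dots> = integral {x..y} (\<lambda>t. f' z * m t - k t)"
        using i2 by (subst Henstock_Kurzweil_Integration.integral_diff) (auto intro: integrable_on_mult_right)
      also have "norm \<dots> \<le> integral {x..y} (\<lambda>t. \<epsilon> * \<bar>m t\<bar>)"
      proof (rule integral_norm_bound_integral)
        show "(\<lambda>t. f' z * m t - k t) integrable_on {x..y}" using i2
          by (intro integrable_diff) (auto intro: integrable_on_mult_right)
        show "(\<lambda>t. \<epsilon> * \<bar>m t\<bar>) integrable_on {x..y}" using i2 by (intro integrable_on_mult_right)
        fix t assume t: "t \<in> {x..y}"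
        have "\<bar>f' (F s) - f' (F t)\<bar> \<le> \<epsilon>"
          using \<delta>(2)[of t s] s t xy by fastforce
        then have "\<bar>f' z - f' (F t)\<bar> * \<bar>m t\<bar> \<le> \<epsilon> * \<bar>m t\<bar>"
          using s by (intro mult_right_mono) auto
        then show "norm (f' z * m t - k t) \<le> \<epsilon> * \<bar>m t\<bar>"
          by (simp add: k_def left_diff_distrib[symmetric] abs_mult)
      qed
      finally show ?thesis using integral_difference[OF am xy(1-3)] by simp
    qed
    then show "\<exists>\<delta>>0. \<forall>x y. c \<le> x \<and> x \<le> y \<and> y \<le> d \<and> y - x < \<delta> \<longrightarrow> \<bar>h y - h x\<bar> \<le>
       \<epsilon> * (integral {c..y} (\<lambda>t. \<bar>m t\<bar>) - integral {c..x} (\<lambda>t. \<bar>m t\<bar>))"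
      using \<delta>(1) by blast
  qed
  then show ?thesis by (simp add: h_def k_def[abs_def])
qed

text \<open>
Polarization: the chain rule for the square, applied to \<open>F + G\<close>, \<open>F\<close> and \<open>G\<close>.
\<close>
lemma integral_product_rule:
  fixes m n F G :: "real \<Rightarrow> real"
  assumes "c \<le> d" and m: "m absolutely_integrable_on {c..d}" and n: "n absolutely_integrable_on {c..d}"
    and F: "\<And>x. x \<in> {c..d} \<Longrightarrow> F x = F c + integral {c..x} m"
    and G: "\<And>x. x \<in> {c..d} \<Longrightarrow> G x = G c + integral {c..x} n"
  shows "F d * G d - F c * G c = integral {c..d} (\<lambda>t. m t * G t + F t * n t)"
proof -
  have mn: "(\<lambda>t. m t + n t) absolutely_integrable_on {c..d}" using m n by auto
  have sub: "k integrable_on {c..x}" if "x \<in> {c..d}" "k absolutely_integrable_on {c..d}" for x and k :: "real \<Rightarrow> real"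
    using that integrable_on_subinterval[of k "{c..d}" c x] by (auto simp: absolutely_integrable_on_def)
  have FG: "F x + G x = F c + G c + integral {c..x} (\<lambda>t. m t + n t)" if "x \<in> {c..d}" for x
    using F[OF that] G[OF that] sub[OF that m] sub[OF that n] by (simp add: Henstock_Kurzweil_Integration.integral_add)
  have sq: "((\<lambda>x. x\<^sup>2) has_real_derivative 2 * x) (at x)" for x :: real
    by (auto intro!: derivative_eq_intros)
  have c2: "continuous_on UNIV (\<lambda>x::real. 2 * x)" by (intro continuous_intros)
  note chain = integral_chain_rule[OF \<open>c \<le> d\<close> _ _ sq c2]
  have Fc: "continuous_on {c..d} F" "continuous_on {c..d} G"
    using continuous_indefinite_integral[OF m, of F] continuous_indefinite_integral[OF n, of G] F G by blast+
  have I: "(\<lambda>t. m t * F t) integrable_on {c..d}" "(\<lambda>t. m t * G t) integrable_on {c..d}"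
     "(\<lambda>t. n t * F t) integrable_on {c..d}" "(\<lambda>t. n t * G t) integrable_on {c..d}"
    using absolutely_integrable_mult_continuous m n Fc unfolding absolutely_integrable_on_def by blast+
  have 1: "(F d + G d)\<^sup>2 - (F c + G c)\<^sup>2 = integral {c..d} (\<lambda>t. 2 * (F t + G t) * (m t + n t))"
    using chain[OF mn, of "\<lambda>x. F x + G x"] FG by blast
  have 2: "(F d)\<^sup>2 - (F c)\<^sup>2 = integral {c..d} (\<lambda>t. 2 * F t * m t)"
    using chain[OF m, of F] F by blast
  have 3: "(G d)\<^sup>2 - (G c)\<^sup>2 = integral {c..d} (\<lambda>t. 2 * G t * n t)"
    using chain[OF n, of G] G by blast
  have "integral {c..d} (\<lambda>t. 2 * (F t + G t) * (m t + n t)) =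
     integral {c..d} (\<lambda>t. 2 * F t * m t + 2 * G t * n t + 2 * (m t * G t + F t * n t))"
    by (rule Henstock_Kurzweil_Integration.integral_cong) (simp add: algebra_simps)
  also have "\<dots> = integral {c..d} (\<lambda>t. 2 * F t * m t) + integral {c..d} (\<lambda>t. 2 * G t * n t)
      + 2 * integral {c..d} (\<lambda>t. m t * G t + F t * n t)"
  proof -
    have J: "(\<lambda>t. 2 * F t * m t) integrable_on {c..d}" "(\<lambda>t. 2 * G t * n t) integrable_on {c..d}"
      "(\<lambda>t. m t * G t + F t * n t) integrable_on {c..d}"
      using I integrable_on_mult_right[OF I(1), where c=2] integrable_on_mult_right[OF I(4), where c=2]
        integrable_add[OF I(2,3)]
      by (simp_all add: mult.commute mult.left_commute)
    show ?thesis
      using Henstock_Kurzweil_Integration.integral_add[OF integrable_add[OF J(1,2)] integrable_on_mult_right[OF J(3), where c=2]]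
        Henstock_Kurzweil_Integration.integral_add[OF J(1,2)]
      by (simp only: Henstock_Kurzweil_Integration.integral_mult_right)
  qed
  finally show ?thesis using 1 2 3 by (simp add: power2_eq_square algebra_simps)
qed

section \<open>Absolutely continuous functions\<close>

lemma sum_integral_disjoint_le:
  fixes r :: "real \<Rightarrow> real" and s t :: "nat \<Rightarrow> real"
  assumes "r integrable_on {c..d}" "\<And>x. x \<in> {c..d} \<Longrightarrow> r x \<ge> 0"
    and st: "\<And>k. k < n \<Longrightarrow> c \<le> s k \<and> s k \<le> t k \<and> t k \<le> d"
    and disj: "disjoint_family_on (\<lambda>k. {s k<..<t k}) {..<n}"
  shows "(\<Sum>k<n. integral {s k..t k} r) \<le> integral {c..d} r"
proof -
  have i: "r integrable_on {s k..t k}" if "k < n" for k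
    using integrable_on_subinterval[OF assms(1)] st[OF that] by auto
  have "(r has_integral (\<Sum>k\<in>{..<n}. integral {s k..t k} r)) (\<Union>k\<in>{..<n}. {s k<..<t k})"
  proof (rule has_integral_UN)
    fix k assume "k \<in> {..<n}"
    then show "(r has_integral integral {s k..t k} r) {s k<..<t k}"
      using i[of k] has_integral_Icc_iff_Ioo[of r _ "s k" "t k"] by (metis integrable_integral lessThan_iff)
  next
    show "pairwise (\<lambda>i i'. negligible ({s i<..<t i} \<inter> {s i'<..<t i'})) {..<n}"
      using disj unfolding pairwise_def disjoint_family_on_def by auto
  qed auto
  moreover have "(r has_integral integral {c..d} r) {c..d}" using assms(1) by blast
  moreover have "(\<Union>k\<in>{..<n}. {s k<..<t k}) \<subseteq> {c..d}" using st by fastforce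
  ultimately show ?thesis using has_integral_subset_le assms(2) by blast
qed

text \<open>
Truncating \<open>\<bar>m\<bar>\<close> at a height \<open>K\<close> leaves a remainder of small integral, whatever the intervals; the truncated
part contributes at most \<open>K\<close> times their total length.
\<close>
lemma abs_continuous_on_indefinite_integral:
  fixes m F :: "real \<Rightarrow> real"
  assumes m: "m absolutely_integrable_on {c..d}"
    and F: "\<And>x. x \<in> {c..d} \<Longrightarrow> F x = F c + integral {c..x} m"
  shows "abs_continuous_on c d F"
  unfolding abs_continuous_on_def
proof (intro allI impI)
  fix \<epsilon> :: real assume e: "\<epsilon> > 0"
  define am where "am x = \<bar>m x\<bar>" for x
  have am: "am absolutely_integrable_on {c..d}" unfolding am_def using m by (rule set_integrable_abs)
  then have ami: "am integrable_on {c..d}" by (simp add: absolutely_integrable_on_def)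
  have mini: "(\<lambda>x. min (am x) (real k)) absolutely_integrable_on {c..d}" for k
    by (rule absolutely_integrable_min_1[OF am]) auto
  have "(\<lambda>k. integral {c..d} (\<lambda>x. min (am x) (real k))) \<longlonglongrightarrow> integral {c..d} am"
  proof (rule dominated_convergence(2)[where h=am])
    show "(\<lambda>x. min (am x) (real k)) integrable_on {c..d}" for k
      using mini by (simp add: absolutely_integrable_on_def)
    show "(\<lambda>k. min (am x) (real k)) \<longlonglongrightarrow> am x" for x
    proof (rule tendsto_eventually)
      obtain N where "am x \<le> real N" using real_arch_simple by blast
      then show "\<forall>\<^sub>F k in sequentially. min (am x) (real k) = am x"
        by (auto simp: eventually_sequentially intro!: exI[of _ N])
    qed
  qed (auto simp: ami am_def)
  then obtain K where K: "\<bar>integral {c..d} (\<lambda>x. min (am x) (real K)) - integral {c..d} am\<bar> < \<epsilon>/2"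
    using e LIMSEQ_D[of _ _ "\<epsilon>/2"] by (metis half_gt_zero le_refl real_norm_def)
  define r where "r x = am x - min (am x) (real K)" for x
  have ri: "r integrable_on {c..d}" unfolding r_def using ami mini
    by (intro integrable_diff) (auto simp: absolutely_integrable_on_def)
  have rI: "integral {c..d} r < \<epsilon>/2"
  proof -
    have "integral {c..d} r = integral {c..d} am - integral {c..d} (\<lambda>x. min (am x) (real K))"
      using mini[of K] ami unfolding r_def
      by (intro Henstock_Kurzweil_Integration.integral_diff) (auto simp: absolutely_integrable_on_def)
    then show ?thesis using K by linarith
  qed
  define \<delta> where "\<delta> = \<epsilon> / (2 * (real K + 1))"
  have d: "\<delta> > 0" using e by (simp add: \<delta>_def)
  show "\<exists>\<delta>>0. \<forall>(n::nat) s t. (\<forall>k<n. c \<le> s k \<and> s k \<le> t k \<and> t k \<le> d) \<and>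
      disjoint_family_on (\<lambda>k. {s k<..<t k}) {..<n} \<and> (\<Sum>k<n. t k - s k) < \<delta>
        \<longrightarrow> (\<Sum>k<n. \<bar>F (t k) - F (s k)\<bar>) < \<epsilon>"
  proof (intro exI[of _ \<delta>] conjI d allI impI)
    fix n :: nat and s t :: "nat \<Rightarrow> real"
    assume A: "(\<forall>k<n. c \<le> s k \<and> s k \<le> t k \<and> t k \<le> d) \<and>
      disjoint_family_on (\<lambda>k. {s k<..<t k}) {..<n} \<and> (\<Sum>k<n. t k - s k) < \<delta>"
    have b: "\<bar>F (t k) - F (s k)\<bar> \<le> integral {s k..t k} r + K * (t k - s k)" if "k < n" for k
    proof -
      have k: "c \<le> s k" "s k \<le> t k" "t k \<le> d" using A that by auto
      have rk: "r integrable_on {s k..t k}" using integrable_on_subinterval[OF ri] k by auto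
      have mk: "m integrable_on {s k..t k}"
        using m integrable_on_subinterval[of m] k by (auto simp: absolutely_integrable_on_def)
      have "F (t k) - F (s k) = integral {s k..t k} m"
        using F[of "t k"] F[of "s k"] k integral_difference[OF m k] by auto
      also have "norm \<dots> \<le> integral {s k..t k} (\<lambda>x. r x + K)"
      proof (rule integral_norm_bound_integral[OF mk])
        show "(\<lambda>x. r x + K) integrable_on {s k..t k}" using rk by (intro integrable_add) auto
      qed (auto simp: r_def am_def)
      also have "\<dots> = integral {s k..t k} r + K * (t k - s k)"
        using rk k by (subst Henstock_Kurzweil_Integration.integral_add) auto
      finally show ?thesis by simp
    qed
    have "(\<Sum>k<n. \<bar>F (t k) - F (s k)\<bar>) \<le> (\<Sum>k<n. integral {s k..t k} r + K * (t k - s k))"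
      using b by (intro sum_mono) auto
    also have "\<dots> = (\<Sum>k<n. integral {s k..t k} r) + K * (\<Sum>k<n. t k - s k)"
      by (simp add: sum.distrib sum_distrib_left)
    also have "(\<Sum>k<n. integral {s k..t k} r) \<le> integral {c..d} r"
      using A by (intro sum_integral_disjoint_le[OF ri]) (auto simp: r_def)
    also have "K * (\<Sum>k<n. t k - s k) \<le> K * \<delta>" using A by (intro mult_left_mono) auto
    also have "K * \<delta> \<le> \<epsilon>/2" using e by (simp add: \<delta>_def field_simps)
    finally show "(\<Sum>k<n. \<bar>F (t k) - F (s k)\<bar>) < \<epsilon>" using rI by simp
  qed
qed

text \<open>
Lebesgue's differentiation theorem in one variable. Averages over intervals to the right of \<open>x\<close> converge to
\<open>m x\<close> for almost every \<open>x\<close>; the reflected function gives the averages to the left.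
\<close>
lemma indefinite_integral_has_derivative_almost_everywhere:
  fixes m F :: "real \<Rightarrow> real"
  assumes m: "m absolutely_integrable_on {c..d}"
    and F: "\<And>x. x \<in> {c..d} \<Longrightarrow> F x = F c + integral {c..x} m"
  obtains E where "negligible E"
    "\<And>x. x \<in> {c..d} - E \<Longrightarrow> (F has_real_derivative m x) (at x within {c..d})"
proof -
  define f where "f x = (if x \<in> {c..d} then m x else 0)" for x
  have "f integrable_on UNIV"
    using m integrable_restrict_UNIV[of "{c..d}" m] unfolding f_def absolutely_integrable_on_def by blast
  then have fi: "f integrable_on cbox a b" for a b by (rule integrable_on_subcbox) auto
  have fr: "(\<lambda>x. f (-x)) integrable_on cbox a b" for a b
    using integrable_reflect[of f "-a" "-b"] fi by (simp del: integrable_reflect integrable_reflect_real)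
  obtain N1 where N1: "negligible N1"
    "\<And>x e. \<lbrakk>x \<notin> N1; 0 < e\<rbrakk> \<Longrightarrow> \<exists>d>0. \<forall>h. 0 < h \<and> h < d \<longrightarrow>
        norm (integral (cbox x (x + h *\<^sub>R One)) f /\<^sub>R h ^ DIM(real) - f x) < e"
    by (rule integrable_ccontinuous_explicit[OF fi], rule that, assumption, assumption)
  obtain N2 where N2: "negligible N2"
    "\<And>x e. \<lbrakk>x \<notin> N2; 0 < e\<rbrakk> \<Longrightarrow> \<exists>d>0. \<forall>h. 0 < h \<and> h < d \<longrightarrow>
        norm (integral (cbox x (x + h *\<^sub>R One)) (\<lambda>x. f (-x)) /\<^sub>R h ^ DIM(real) - f (-x)) < e"
    by (rule integrable_ccontinuous_explicit[OF fr], rule that, assumption, assumption)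
  define E where "E = N1 \<union> uminus ` N2 \<union> {c, d}"
  have "negligible (uminus ` N2)"
    using N2(1) by (intro negligible_differentiable_image_negligible)
      (auto simp: differentiable_on_def intro: differentiable_minus)
  then have nE: "negligible E" using N1 by (simp add: E_def)
  have dF: "(F has_real_derivative m x) (at x within {c..d})" if x: "x \<in> {c..d} - E" for x
  proof -
    have xcd: "c < x" "x < d" and xN: "x \<notin> N1" "-x \<notin> N2" using x by (auto simp: E_def image_iff)
    have fx: "f x = m x" using xcd by (simp add: f_def)
    have Fxy: "F z - F y = integral {y..z} f" if "c \<le> y" "y \<le> z" "z \<le> d" for y z
    proof -
      have "integral {y..z} f = integral {y..z} m"
        using that by (intro Henstock_Kurzweil_Integration.integral_cong) (auto simp: f_def)
      then show ?thesis using that F[of y] F[of z] integral_difference[OF m that] by auto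
    qed
    have "((\<lambda>y. (F y - F x) / (y - x)) \<longlongrightarrow> m x) (at x within {c..d})"
      unfolding Lim_within
    proof (intro allI impI)
      fix e :: real assume e: "e > 0"
      obtain d1 where d1: "d1 > 0" "\<And>h. 0 < h \<Longrightarrow> h < d1 \<Longrightarrow>  \<bar>integral {x..x + h} f / h - f x\<bar> < e"
        using N1(2)[OF xN(1) e] by (auto simp: divide_inverse mult.commute)
      obtain d2 where d2: "d2 > 0" "\<And>h. 0 < h \<Longrightarrow> h < d2 \<Longrightarrow>
          \<bar>integral {-x..-x + h} (\<lambda>x. f (-x)) / h - f x\<bar> < e"
        using N2(2)[OF xN(2) e] by (auto simp: divide_inverse mult.commute)
      have "dist ((F y - F x) / (y - x)) (m x) < e"
        if y: "y \<in> {c..d}" "0 < dist y x" "dist y x < min d1 d2" for y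
      proof (cases "y > x")
        case True
        then show ?thesis using d1(2)[of "y - x"] y Fxy[of x y] xcd fx by (auto simp: dist_real_def)
      next
        case False
        then have yx: "y < x" using y by auto
        have "integral {-x..-x + (x - y)} (\<lambda>x. f (-x)) = integral {y..x} f"
          using Henstock_Kurzweil_Integration.integral_reflect_real[of x y f] by simp
        moreover have "(F y - F x) / (y - x) = (F x - F y) / (x - y)"
          by (metis minus_diff_eq minus_divide_divide)
        ultimately show ?thesis
          using d2(2)[of "x - y"] y Fxy[of y x] xcd fx yx by (auto simp: dist_real_def)
      qed
      then show "\<exists>d'>0. \<forall>xa\<in>{c..d}. 0 < dist xa x \<and> dist xa x < d' \<longrightarrow>
           dist ((F xa - F x) / (xa - x)) (m x) < e"
        using d1(1) d2(1) by (intro exI[of _ "min d1 d2"]) auto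
    qed
    then show ?thesis by (simp add: has_field_derivative_iff)
  qed
  show thesis using that[OF nE dF] .
qed

text \<open>
A gauge argument. At the exceptional points the gauge confines the tagged intervals to an open set of small
measure, where absolute continuity makes the sum of the increments of \<open>F\<close> small; at all other points the
derivative approximates the increments.
\<close>
lemma abs_continuous_fundamental_theorem:
  fixes F f :: "real \<Rightarrow> real"
  assumes "c \<le> d" and AC: "abs_continuous_on c d F" and E: "negligible E"
    and der: "\<And>x. x \<in> {c..d} - E \<Longrightarrow> (F has_real_derivative f x) (at x within {c..d})"
  shows "(f has_integral F d - F c) {c..d}"
proof (cases "c = d")
  case True then show ?thesis using has_integral_refl(2)[of f c] by simp
next
  case False
  with assms have cd: "c < d" by simp
  \<comment> \<open>tags in \<open>E\<close> then contribute only increments of \<open>F\<close> to the Riemann sums\<close>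
  define f0 where "f0 x = (if x \<in> E then 0 else f x)" for x
  have "(f0 has_integral F d - F c) {c..d}"
    unfolding has_integral_factor_content_real
  proof (intro allI impI)
    fix e :: real assume e: "e > 0"
    define \<epsilon> where "\<epsilon> = e / 2 * (d - c)"
    have e': "\<epsilon> > 0" using e cd by (simp add: \<epsilon>_def)
    obtain \<delta> where \<delta>: "\<delta> > 0" "\<And>(n::nat) (s::nat \<Rightarrow> real) t.
        (\<forall>k<n. c \<le> s k \<and> s k \<le> t k \<and> t k \<le> d) \<Longrightarrow>
        disjoint_family_on (\<lambda>k. {s k<..<t k}) {..<n} \<Longrightarrow>
        (\<Sum>k<n. t k - s k) < \<delta> \<Longrightarrow> (\<Sum>k<n. \<bar>F (t k) - F (s k)\<bar>) < \<epsilon>"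
    proof -
      from AC[unfolded abs_continuous_on_def, rule_format, OF e'] obtain \<delta> where "\<delta> > 0"
        and \<delta>: "\<forall>(n::nat) s t. (\<forall>k<n. c \<le> s k \<and> s k \<le> t k \<and> t k \<le> d) \<and>
          disjoint_family_on (\<lambda>k. {s k<..<t k}) {..<n} \<and> (\<Sum>k<n. t k - s k) < \<delta>
          \<longrightarrow> (\<Sum>k<n. \<bar>F (t k) - F (s k)\<bar>) < \<epsilon>" by blast
      show thesis
        using that[OF \<open>\<delta> > 0\<close>] \<delta> by simp
    qed
    obtain U where U: "open U" "E \<subseteq> U" "U \<in> lmeasurable" "measure lebesgue U < \<delta>"
    proof -
      have Es: "E \<in> sets lebesgue" using E negligible_imp_sets by blast
      obtain T where T: "open T" "E \<subseteq> T" "T - E \<in> lmeasurable" "emeasure lebesgue (T - E) < ennreal \<delta>"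
        using sets_lebesgue_outer_open[OF Es \<delta>(1)] by metis
      have "T = (T - E) \<union> E" using T(2) by blast
      then have Tl: "T \<in> lmeasurable"
        using T(3) negligible_imp_measurable[OF E] fmeasurable.Un by metis
      have "measure lebesgue (T - E) < \<delta>"
        using T(3,4) \<delta>(1) by (simp add: emeasure_eq_measure2 ennreal_less_iff)
      moreover have "measure lebesgue (T - E) = measure lebesgue T"
        using E Tl by (intro measure_Diff_null_set) (auto simp: negligible_iff_null_sets)
      ultimately show thesis using that T Tl by metis
    qed
    have "\<exists>\<eta>>0. \<forall>y\<in>{c..d}. \<bar>y - x\<bar> < \<eta> \<longrightarrow> \<bar>F y - F x - f x * (y - x)\<bar> \<le> e/2 * \<bar>y - x\<bar>"
      if "x \<in> {c..d} - E" for x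
      using der[OF that] e unfolding has_field_derivative_def has_derivative_within_alt
      by (auto simp: mult.commute dest!: spec[of _ "e/2"])
    then obtain \<eta> where \<eta>: "\<And>x. x \<in> {c..d} - E \<Longrightarrow> \<eta> x > 0"
      "\<And>x y. x \<in> {c..d} - E \<Longrightarrow> y \<in> {c..d} \<Longrightarrow> \<bar>y - x\<bar> < \<eta> x \<Longrightarrow>
         \<bar>F y - F x - f x * (y - x)\<bar> \<le> e/2 * \<bar>y - x\<bar>"
      by metis
    define \<gamma> where "\<gamma> x = (if x \<in> E then U else if x \<in> {c..d} then ball x (\<eta> x) else UNIV)" for x
    have gau: "gauge \<gamma>" using U \<eta>(1) by (auto simp: gauge_def \<gamma>_def)
    have fine_bound: "norm ((\<Sum>(x, k)\<in>p. measure lborel k *\<^sub>R f0 x) - (F d - F c)) \<le> e * measure lborel {c..d}"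
      if p: "p tagged_division_of {c..d}" and fine: "\<gamma> fine p" for p
    proof -
      have fin: "finite p" using p by blast
      define D where "D = (\<lambda>(x::real, K::real set). F (Sup K) - F (Inf K))"
      have sumD: "sum D p = F d - F c"
        unfolding D_def using additive_tagged_division_1[OF assms(1) p] .
      define A where "A = {z \<in> p. fst z \<in> E}"
      have box: "\<exists>u v. K = {u..v} \<and> c \<le> u \<and> u \<le> v \<and> v \<le> d \<and> x \<in> {u..v} \<and> x \<in> {c..d}" if xK: "(x, K) \<in> p" for x K
      proof -
        obtain u v where "K = cbox u v" using tagged_division_ofD(4)[OF p xK] by blast
        moreover have "x \<in> K" "K \<subseteq> {c..d}" using tagged_division_ofD(2,3)[OF p xK] by auto
        ultimately show ?thesis by (intro exI[of _ u] exI[of _ v]) auto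
      qed
      have good: "\<bar>measure lborel (snd z) * f0 (fst z) - D z\<bar> \<le> e/2 * measure lborel (snd z)" if z: "z \<in> p - A" for z
      proof -
        obtain x K where zK: "z = (x, K)" by force
        obtain u v where uv: "K = {u..v}" "c \<le> u" "u \<le> v" "v \<le> d" "u \<le> x" "x \<le> v" "x \<in> {c..d}"
          using box[of x K] z zK by auto
        have xE: "x \<notin> E" using z zK by (auto simp: A_def)
        have "K \<subseteq> \<gamma> x" using fine z zK by (auto simp: fine_def)
        then have "u \<in> ball x (\<eta> x)" "v \<in> ball x (\<eta> x)" using uv xE subsetD[of K "ball x (\<eta> x)" u] subsetD[of K "ball x (\<eta> x)" v]
          by (auto simp: \<gamma>_def)
        then have "\<bar>F u - F x - f x * (u - x)\<bar> \<le> e/2 * \<bar>u - x\<bar>" "\<bar>F v - F x - f x * (v - x)\<bar> \<le> e/2 * \<bar>v - x\<bar>"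
          using \<eta>(2)[of x u] \<eta>(2)[of x v] uv xE by (auto simp: dist_real_def abs_minus_commute)
        then have "\<bar>(F v - F x - f x * (v - x)) - (F u - F x - f x * (u - x))\<bar> \<le> e/2 * (x - u) + e/2 * (v - x)"
        proof -
          have tri: "\<bar>B - A\<bar> \<le> p + q" if "\<bar>A\<bar> \<le> p" "\<bar>B\<bar> \<le> q" for A B p q :: real
            using that by linarith
          have "\<bar>u - x\<bar> = x - u" "\<bar>v - x\<bar> = v - x" using uv by auto
          then show ?thesis using tri
            \<open>\<bar>F u - F x - f x * (u - x)\<bar> \<le> e/2 * \<bar>u - x\<bar>\<close> \<open>\<bar>F v - F x - f x * (v - x)\<bar> \<le> e/2 * \<bar>v - x\<bar>\<close>
            by metis
        qed
        also have "\<dots> = e/2 * (v - u)" by (simp add: field_simps)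
        finally show ?thesis using uv xE by (simp add: zK D_def f0_def algebra_simps abs_minus_commute)
      qed
      have "\<bar>\<Sum>z\<in>p - A. measure lborel (snd z) * f0 (fst z) - D z\<bar> \<le> (\<Sum>z\<in>p - A. e/2 * measure lborel (snd z))"
        using good by (intro order_trans[OF sum_abs] sum_mono)
      also have "\<dots> \<le> (\<Sum>z\<in>p. e/2 * measure lborel (snd z))"
        using fin e by (intro sum_mono2) auto
      also have "\<dots> = e/2 * (d - c)"
      proof -
        have "(\<Sum>z\<in>p. measure lborel (snd z)) = d - c"
          using additive_content_tagged_division[of p c d] p cd by (simp add: case_prod_unfold)
        then show ?thesis by (metis sum_distrib_left)
      qed
      finally have part1: "\<bar>\<Sum>z\<in>p - A. measure lborel (snd z) * f0 (fst z) - D z\<bar> \<le> e/2 * (d - c)" .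
      have finA: "finite A" using fin by (simp add: A_def)
      obtain h where h: "bij_betw h {0..<card A} A" using ex_bij_betw_nat_finite[OF finA] by blast
      define s t where "s k = Inf (snd (h k))" and "t k = Sup (snd (h k))" for k
      have hk: "h k \<in> A" if "k < card A" for k using h that by (auto simp: bij_betw_def)
      have st: "snd (h k) = {s k..t k} \<and> c \<le> s k \<and> s k \<le> t k \<and> t k \<le> d" if "k < card A" for k
      proof -
        have "(fst (h k), snd (h k)) \<in> p" using hk[OF that] by (simp add: A_def)
        then obtain u v where uv: "snd (h k) = {u..v}" "c \<le> u" "u \<le> v" "v \<le> d" using box by blast
        then have "s k = u" "t k = v" by (simp_all add: s_def t_def)
        with uv show ?thesis by simp
      qed
      have disj: "disjoint_family_on (\<lambda>k. {s k<..<t k}) {..<card A}"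
        unfolding disjoint_family_on_def
      proof (intro ballI impI)
        fix i j assume ij: "i \<in> {..<card A}" "j \<in> {..<card A}" "i \<noteq> j"
        then have "h i \<noteq> h j" using h by (auto simp: bij_betw_def inj_on_def)
        then have "interior (snd (h i)) \<inter> interior (snd (h j)) = {}"
          using tagged_division_ofD(5)[OF p, of "fst (h i)" "snd (h i)" "fst (h j)" "snd (h j)"]
            hk[of i] hk[of j] ij by (auto simp: A_def prod_eq_iff)
        then show "{s i<..<t i} \<inter> {s j<..<t j} = {}" using st[of i] st[of j] ij by simp
      qed
      have sub: "{s k<..<t k} \<subseteq> U" if "k < card A" for k
      proof -
        have "snd (h k) \<subseteq> \<gamma> (fst (h k))" "fst (h k) \<in> E"
          using fine hk[OF that] by (auto simp: fine_def A_def case_prod_unfold)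
        then show ?thesis using st[OF that] by (auto simp: \<gamma>_def)
      qed
      have "(\<Sum>k<card A. t k - s k) = (\<Sum>k<card A. measure lebesgue {s k<..<t k})"
        using st by (intro sum.cong) auto
      also have "\<dots> = measure lebesgue (\<Union>k\<in>{..<card A}. {s k<..<t k})"
      proof (rule measure_finite_Union[symmetric])
        show "emeasure lebesgue {s k<..<t k} \<noteq> \<infinity>" if "k \<in> {..<card A}" for k
          using st that by simp
      qed (use disj in auto)
      also have "\<dots> \<le> measure lebesgue U"
        using U(3) sub by (intro measure_mono_fmeasurable) auto
      finally have len: "(\<Sum>k<card A. t k - s k) < \<delta>" using U(4) by simp
      have "(\<Sum>k<card A. \<bar>F (t k) - F (s k)\<bar>) < \<epsilon>"
        using \<delta>(2)[OF _ disj len] st by blast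
      moreover have "(\<Sum>k<card A. \<bar>F (t k) - F (s k)\<bar>) = (\<Sum>z\<in>A. \<bar>D z\<bar>)"
        using sum.reindex_bij_betw[OF h, of "\<lambda>z. \<bar>D z\<bar>"]
        by (simp add: D_def s_def t_def case_prod_unfold atLeast0LessThan)
      moreover have "\<bar>\<Sum>z\<in>A. measure lborel (snd z) * f0 (fst z) - D z\<bar> \<le> (\<Sum>z\<in>A. \<bar>D z\<bar>)"
        by (intro order_trans[OF sum_abs] sum_mono) (auto simp: A_def f0_def)
      ultimately have part2: "\<bar>\<Sum>z\<in>A. measure lborel (snd z) * f0 (fst z) - D z\<bar> \<le> \<epsilon>" by linarith
      have "(\<Sum>(x, k)\<in>p. measure lborel k *\<^sub>R f0 x) - (F d - F c) = (\<Sum>z\<in>p. measure lborel (snd z) * f0 (fst z) - D z)"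
        by (simp add: sum_subtractf sumD case_prod_unfold)
      also have "\<dots> = (\<Sum>z\<in>p - A. measure lborel (snd z) * f0 (fst z) - D z) + (\<Sum>z\<in>A. measure lborel (snd z) * f0 (fst z) - D z)"
        using fin by (intro sum.subset_diff) (auto simp: A_def)
      also have "\<bar>\<dots>\<bar> \<le> e/2 * (d - c) + \<epsilon>" using part1 part2 by linarith
      also have "\<dots> = e * measure lborel {c..d}" using cd by (simp add: \<epsilon>_def)
      finally show ?thesis by simp
    qed
    show "\<exists>\<gamma>. gauge \<gamma> \<and> (\<forall>p. p tagged_division_of {c..d} \<and> \<gamma> fine p \<longrightarrow>
      norm ((\<Sum>(x, k)\<in>p. measure lborel k *\<^sub>R f0 x) - (F d - F c)) \<le> e * measure lborel {c..d})"
      using gau fine_bound by (intro exI[of _ \<gamma>] conjI allI impI) auto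
  qed
  then show ?thesis by (rule has_integral_spike[OF E, rotated]) (auto simp: f0_def)
qed

section \<open>Second order equations in integrated form\<close>

lemma absolutely_integrable_uminus:
  fixes f :: "real \<Rightarrow> real"
  assumes "f absolutely_integrable_on S"
  shows "(\<lambda>x. - f x) absolutely_integrable_on S"
  using assms by (simp add: absolutely_integrable_on_def integrable_neg)

text \<open>
The equation \<open>u'' = - e\<close> in the sense of Caratheodory, with \<open>v = u'\<close>. It is kept in integrated form, so that
exceptional null sets appear only where solutions are compared with \<open>dirichlet_solution\<close>. The sign is that
of \<open>u'' + a f(u) = 0\<close> with \<open>e = a f(u)\<close>.
\<close>
definition second_order ::
  "real \<Rightarrow> real \<Rightarrow> (real \<Rightarrow> real) \<Rightarrow> (real \<Rightarrow> real) \<Rightarrow> (real \<Rightarrow> real) \<Rightarrow> bool" where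
  "second_order c d e u v \<longleftrightarrow> c \<le> d \<and> e absolutely_integrable_on {c..d} \<and>
     (\<forall>x\<in>{c..d}. (u has_real_derivative v x) (at x within {c..d})) \<and>
     (\<forall>x\<in>{c..d}. v x = v c - integral {c..x} e)"

lemma second_orderD:
  assumes "second_order c d e u v"
  shows "c \<le> d" "e absolutely_integrable_on {c..d}" "e integrable_on {c..d}"
    and "\<And>x. x \<in> {c..d} \<Longrightarrow> (u has_real_derivative v x) (at x within {c..d})"
    and "\<And>x. x \<in> {c..d} \<Longrightarrow> v x = v c - integral {c..x} e"
  using assms unfolding second_order_def absolutely_integrable_on_def by blast+

lemma second_orderI:
  assumes "c \<le> d" "e absolutely_integrable_on {c..d}"
    and "\<And>x. x \<in> {c..d} \<Longrightarrow> (u has_real_derivative v x) (at x within {c..d})"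
    and "\<And>x. x \<in> {c..d} \<Longrightarrow> v x = v c - integral {c..x} e"
  shows "second_order c d e u v"
  using assms unfolding second_order_def by blast

lemma second_order_subinterval:
  assumes "second_order c d e u v" "c \<le> x" "x \<le> y" "y \<le> d"
  shows "second_order x y e u v"
proof -
  note so = second_orderD[OF assms(1)]
  note e = so(2)
  have s: "{x..y} \<subseteq> {c..d}" using assms by auto
  have "v z = v x - integral {x..z} e" if "z \<in> {x..y}" for z
  proof -
    have "v z = v c - integral {c..z} e" "v x = v c - integral {c..x} e"
      using so(5)[of z] so(5)[of x] assms that by auto
    then show ?thesis using integral_difference[OF e, of x z] that assms by auto
  qed
  moreover have "(u has_real_derivative v z) (at z within {x..y})" if "z \<in> {x..y}" for z
  proof (rule has_field_derivative_subset[OF _ s])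
    show "(u has_real_derivative v z) (at z within {c..d})"
      using so(4) that s by auto
  qed
  ultimately show ?thesis
    using absolutely_integrable_on_subinterval[OF e s] assms(3) by (intro second_orderI)
qed

lemma second_order_increment:
  assumes "second_order c d e u v" "c \<le> x" "x \<le> y" "y \<le> d"
  shows "v y - v x = - integral {x..y} e"
  using second_orderD(5)[OF second_order_subinterval[OF assms], of y] assms(3) by auto

lemma second_order_continuous:
  assumes "second_order c d e u v"
  shows "continuous_on {c..d} u" "continuous_on {c..d} v"
proof -
  show "continuous_on {c..d} u"
    using second_orderD(4)[OF assms] DERIV_continuous_on by blast
  have e: "(\<lambda>t. - e t) absolutely_integrable_on {c..d}"
    using second_orderD(2)[OF assms] by (rule absolutely_integrable_uminus)
  show "continuous_on {c..d} v"
  proof (rule continuous_indefinite_integral[OF e])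
    show "v x = v c + integral {c..x} (\<lambda>t. - e t)" if "x \<in> {c..d}" for x
      using second_orderD(5)[OF assms that] by simp
  qed
qed

lemma second_order_integral_derivative:
  assumes "second_order c d e u v" "c \<le> x" "x \<le> y" "y \<le> d"
  shows "(v has_integral u y - u x) {x..y}"
proof (rule fundamental_theorem_of_calculus)
  show "x \<le> y" by fact
  show "(u has_vector_derivative v z) (at z within {x..y})" if "z \<in> {x..y}" for z
    using second_orderD(4)[OF second_order_subinterval[OF assms] that]
    by (simp add: has_real_derivative_iff_has_vector_derivative)
qed

lemma second_order_mean_value:
  assumes "second_order c d e u v" "c \<le> x" "x < y" "y \<le> d"
  obtains z where "x < z" "z < y" "u y - u x = v z * (y - x)"
proof -
  have so: "second_order x y e u v" using second_order_subinterval[OF assms(1,2) _ assms(4)] assms(3) by simp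
  have der: "(u has_derivative (\<lambda>h. v z * h)) (at z)" if z: "x < z" "z < y" for z
  proof -
    have "(u has_real_derivative v z) (at z within {x..y})" using second_orderD(4)[OF so, of z] z by auto
    then have "(u has_real_derivative v z) (at z)" using z at_within_Icc_at[of x z y] by simp
    then show ?thesis by (simp add: has_field_derivative_def)
  qed
  obtain z where "x < z" "z < y" "u y - u x = v z * (y - x)"
    using mvt[OF assms(3) second_order_continuous(1)[OF so] der] by blast
  then show thesis by (rule that)
qed

lemma second_order_diff:
  assumes "second_order c d e1 u1 v1" "second_order c d e2 u2 v2"
  shows "second_order c d (\<lambda>x. e1 x - e2 x) (\<lambda>x. u1 x - u2 x) (\<lambda>x. v1 x - v2 x)"
proof -
  note D1 = second_orderD[OF assms(1)] and D2 = second_orderD[OF assms(2)]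
  show ?thesis
  proof (rule second_orderI)
    fix x assume x: "x \<in> {c..d}"
    show "((\<lambda>x. u1 x - u2 x) has_real_derivative v1 x - v2 x) (at x within {c..d})"
      using D1(4)[OF x] D2(4)[OF x] by (rule DERIV_diff)
    have "integral {c..x} (\<lambda>x. e1 x - e2 x) = integral {c..x} e1 - integral {c..x} e2"
      using x integrable_on_subinterval[OF D1(3), of c x] integrable_on_subinterval[OF D2(3), of c x]
      by (intro Henstock_Kurzweil_Integration.integral_diff) auto
    then show "v1 x - v2 x = v1 c - v2 c - integral {c..x} (\<lambda>x. e1 x - e2 x)"
      using D1(5)[OF x] D2(5)[OF x] by simp
  qed (use D1(1,2) D2(2) in auto)
qed

text \<open>
Reversing the direction of \<open>x\<close> transfers statements about the left end point to the right one.
\<close>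
lemma second_order_reflect:
  assumes "second_order c d e u v"
  shows "second_order (-d) (-c) (\<lambda>x. e (-x)) (\<lambda>x. u (-x)) (\<lambda>x. - v (-x))"
proof (rule second_orderI)
  show "- d \<le> - c" using second_orderD(1)[OF assms] by simp
  show "(\<lambda>x. e (- x)) absolutely_integrable_on {- d..- c}"
    using second_orderD(2)[OF assms] by simp
  fix x assume x: "x \<in> {-d..-c}"
  have "(u has_real_derivative v (-x)) (at (-x) within uminus ` {-d..-c})"
    using second_orderD(4)[OF assms, of "-x"] x by simp
  moreover have "(uminus has_real_derivative - 1) (at x within {-d..-c})"
    by (auto intro!: derivative_eq_intros)
  ultimately show "((\<lambda>x. u (- x)) has_real_derivative - v (- x)) (at x within {- d..- c})"
    using DERIV_image_chain[of u "v (-x)" uminus x "{-d..-c}" "-1"] by (simp add: o_def)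
  have "v d - v (-x) = - integral {-x..d} e"
    using second_order_increment[OF assms, of "-x" d] x by auto
  moreover have "integral {-d..x} (\<lambda>x. e (-x)) = integral {-x..d} e"
    using Henstock_Kurzweil_Integration.integral_reflect_real[of d "-x" e] by simp
  ultimately show "- v (- x) = - v (- (- d)) - integral {- d..x} (\<lambda>x. e (- x))" by simp
qed

text \<open>
The left side is the derivative of the Wronskian \<open>u1 v2 - v1 u2\<close>. Every comparison of two equations below
consists in reading off the signs in this identity.
\<close>
lemma green_identity:
  assumes 1: "second_order c d e1 u1 v1" and 2: "second_order c d e2 u2 v2"
  shows "((\<lambda>t. e1 t * u2 t - u1 t * e2 t) has_integral
      (u1 d * v2 d - v1 d * u2 d) - (u1 c * v2 c - v1 c * u2 c)) {c..d}"
proof -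
  have cd: "c \<le> d" using second_orderD(1)[OF 1] .
  have ne: "(\<lambda>t. - e1 t) absolutely_integrable_on {c..d}" "(\<lambda>t. - e2 t) absolutely_integrable_on {c..d}"
    using second_orderD(2)[OF 1] second_orderD(2)[OF 2] by (auto intro: absolutely_integrable_uminus)
  have nv: "v1 absolutely_integrable_on {c..d}" "v2 absolutely_integrable_on {c..d}"
    using second_order_continuous[OF 1] second_order_continuous[OF 2] absolutely_integrable_continuous_real by blast+
  have U: "u1 x = u1 c + integral {c..x} v1" "u2 x = u2 c + integral {c..x} v2" if "x \<in> {c..d}" for x
    using second_order_integral_derivative[OF 1, of c x] second_order_integral_derivative[OF 2, of c x] that
    by (auto simp: integral_unique)
  have V: "v1 x = v1 c + integral {c..x} (\<lambda>t. - e1 t)" "v2 x = v2 c + integral {c..x} (\<lambda>t. - e2 t)"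
    if "x \<in> {c..d}" for x using second_orderD(5)[OF 1 that] second_orderD(5)[OF 2 that] by simp_all
  have A: "u1 d * v2 d - u1 c * v2 c = integral {c..d} (\<lambda>t. v1 t * v2 t + u1 t * (- e2 t))"
    using integral_product_rule[OF cd nv(1) ne(2), of u1 v2] U(1) V(2) by blast
  have B: "u2 d * v1 d - u2 c * v1 c = integral {c..d} (\<lambda>t. v2 t * v1 t + u2 t * (- e1 t))"
    using integral_product_rule[OF cd nv(2) ne(1), of u2 v1] U(2) V(1) by blast
  have I: "(\<lambda>t. e2 t * u1 t) integrable_on {c..d}" "(\<lambda>t. e1 t * u2 t) integrable_on {c..d}"
    "(\<lambda>t. v1 t * v2 t) integrable_on {c..d}"
    using absolutely_integrable_mult_continuous[OF second_orderD(2)[OF 2] second_order_continuous(1)[OF 1]]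
      absolutely_integrable_mult_continuous[OF second_orderD(2)[OF 1] second_order_continuous(1)[OF 2]]
      absolutely_integrable_mult_continuous[OF nv(1) second_order_continuous(2)[OF 2]]
    by (auto simp: absolutely_integrable_on_def)
  have C: "(\<lambda>t. v1 t * v2 t + u1 t * (- e2 t)) integrable_on {c..d}"
    using integrable_diff[OF I(3) I(1)] by (simp add: mult.commute)
  have D: "(\<lambda>t. v2 t * v1 t + u2 t * (- e1 t)) integrable_on {c..d}"
    using integrable_diff[OF I(3) I(2)] by (simp add: mult.commute)
  have "((\<lambda>t. (v1 t * v2 t + u1 t * (- e2 t)) - (v2 t * v1 t + u2 t * (- e1 t))) has_integral
     (u1 d * v2 d - u1 c * v2 c) - (u2 d * v1 d - u2 c * v1 c)) {c..d}"
    unfolding A B using C D by (intro has_integral_diff integrable_integral)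
  then show ?thesis by (simp add: algebra_simps)
qed

lemma AE_lebesgue_on_iff_negligible:
  assumes "S \<in> sets lebesgue"
  shows "(AE x in lebesgue_on S. P x) \<longleftrightarrow> (\<exists>E. negligible E \<and> (\<forall>x\<in>S - E. P x))"
proof -
  have "(AE x in lebesgue_on S. P x) \<longleftrightarrow> (AE x in lebesgue. x \<in> S \<longrightarrow> P x)"
    using assms by (subst AE_restrict_space_iff) auto
  also have "\<dots> \<longleftrightarrow> (\<exists>E. negligible E \<and> {x. \<not> (x \<in> S \<longrightarrow> P x)} \<subseteq> E)"
    by (rule eventually_ae_filter_negligible)
  also have "\<dots> \<longleftrightarrow> (\<exists>E. negligible E \<and> (\<forall>x\<in>S - E. P x))" by blast
  finally show ?thesis .
qed

lemma dirichlet_solution_if_second_order: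
  assumes so: "second_order c d (\<lambda>x. f x (u x)) u v" and "u c = 0" "u d = 0"
  shows "dirichlet_solution f c d u"
proof -
  have ne: "(\<lambda>x. - f x (u x)) absolutely_integrable_on {c..d}" using second_orderD(2)[OF so] by (rule absolutely_integrable_uminus)
  have V: "v x = v c + integral {c..x} (\<lambda>x. - f x (u x))" if "x \<in> {c..d}" for x
    using second_orderD(5)[OF so that] by simp
  have vi: "v absolutely_integrable_on {c..d}"
    using second_order_continuous[OF so] absolutely_integrable_continuous_real by blast
  have U: "u x = u c + integral {c..x} v" if "x \<in> {c..d}" for x
    using second_order_integral_derivative[OF so, of c x] that by (auto simp: integral_unique)
  obtain E where E: "negligible E"
    "\<And>x. x \<in> {c..d} - E \<Longrightarrow> (v has_real_derivative - f x (u x)) (at x within {c..d})"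
    using indefinite_integral_has_derivative_almost_everywhere[OF ne, of v] V by blast
  have "\<exists>w. (v has_real_derivative w) (at x within {c..d}) \<and> w + f x (u x) = 0" if "x \<in> {c..d} - E" for x
    using E(2)[OF that] by (intro exI[of _ "- f x (u x)"]) simp
  then have AE: "AE x in lebesgue_on {c..d}. \<exists>w. (v has_real_derivative w) (at x within {c..d}) \<and> w + f x (u x) = 0"
    unfolding AE_lebesgue_on_iff_negligible[OF fmeasurableD[OF lmeasurable_interval(1)]] using E(1) by blast
  show ?thesis
    unfolding dirichlet_solution_def
  proof (intro conjI exI[of _ v] ballI AE assms)
    show "abs_continuous_on c d u" by (rule abs_continuous_on_indefinite_integral[OF vi U])
    show "abs_continuous_on c d v" by (rule abs_continuous_on_indefinite_integral[OF ne V])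
  qed (rule second_orderD(4)[OF so])
qed

lemma abs_continuous_on_subinterval:
  assumes "abs_continuous_on c d f" "c \<le> x" "y \<le> d"
  shows "abs_continuous_on x y f"
  unfolding abs_continuous_on_def
proof (intro allI impI)
  fix \<epsilon> :: real assume "\<epsilon> > 0"
  from assms(1)[unfolded abs_continuous_on_def, rule_format, OF this] obtain \<delta> where "\<delta> > 0"
    and \<delta>: "\<And>(n::nat) s t. (\<forall>k<n. c \<le> s k \<and> s k \<le> t k \<and> t k \<le> d) \<Longrightarrow>
          disjoint_family_on (\<lambda>k. {s k<..<t k}) {..<n} \<Longrightarrow> (\<Sum>k<n. t k - s k) < \<delta>
          \<Longrightarrow> (\<Sum>k<n. \<bar>f (t k) - f (s k)\<bar>) < \<epsilon>" by blast
  show "\<exists>\<delta>>0. \<forall>(n::nat) s t. (\<forall>k<n. x \<le> s k \<and> s k \<le> t k \<and> t k \<le> y) \<and>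
      disjoint_family_on (\<lambda>k. {s k<..<t k}) {..<n} \<and> (\<Sum>k<n. t k - s k) < \<delta>
        \<longrightarrow> (\<Sum>k<n. \<bar>f (t k) - f (s k)\<bar>) < \<epsilon>"
  proof (intro exI[of _ \<delta>] conjI \<open>\<delta> > 0\<close> allI impI, elim conjE)
    fix n :: nat and s t :: "nat \<Rightarrow> real"
    assume A: "\<forall>k<n. x \<le> s k \<and> s k \<le> t k \<and> t k \<le> y"
      "disjoint_family_on (\<lambda>k. {s k<..<t k}) {..<n}" "(\<Sum>k<n. t k - s k) < \<delta>"
    have "\<forall>k<n. c \<le> s k \<and> s k \<le> t k \<and> t k \<le> d" using A(1) assms(2,3) by fastforce
    then show "(\<Sum>k<n. \<bar>f (t k) - f (s k)\<bar>) < \<epsilon>" using \<delta> A by blast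
  qed
qed

text \<open>
The eigenfunctions admitted by \<open>dirichlet_eigenvalue\<close> satisfy their equation only almost everywhere; the
integrated form, recovered from absolute continuity, is what excludes eigenvalues below the first one.
\<close>
lemma second_order_if_dirichlet_solution:
  assumes sol: "dirichlet_solution f c d u" and "c \<le> d"
    and int: "continuous_on {c..d} u \<Longrightarrow> (\<lambda>x. f x (u x)) absolutely_integrable_on {c..d}"
  obtains v where "second_order c d (\<lambda>x. f x (u x)) u v"
proof -
  obtain v where v: "\<And>x. x \<in> {c..d} \<Longrightarrow> (u has_real_derivative v x) (at x within {c..d})"
    "abs_continuous_on c d v"
    "AE x in lebesgue_on {c..d}. \<exists>w. (v has_real_derivative w) (at x within {c..d}) \<and> w + f x (u x) = 0"
    using sol unfolding dirichlet_solution_def by blast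
  have ei: "(\<lambda>x. f x (u x)) absolutely_integrable_on {c..d}"
    by (rule int) (use v(1) DERIV_continuous_on in blast)
  obtain E where E: "negligible E"
    "\<forall>x\<in>{c..d} - E. \<exists>w. (v has_real_derivative w) (at x within {c..d}) \<and> w + f x (u x) = 0"
    using v(3) unfolding AE_lebesgue_on_iff_negligible[OF fmeasurableD[OF lmeasurable_interval(1)]] by blast
  have d: "(v has_real_derivative - f x (u x)) (at x within {c..d})" if "x \<in> {c..d} - E" for x
    using E(2) that by (metis add_eq_0_iff2 minus_minus)
  have "v x = v c - integral {c..x} (\<lambda>x. f x (u x))" if x: "x \<in> {c..d}" for x
  proof -
    have "((\<lambda>x. - f x (u x)) has_integral v x - v c) {c..x}"
    proof (rule abs_continuous_fundamental_theorem[OF _ _ E(1)])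
      show "abs_continuous_on c x v" using abs_continuous_on_subinterval[OF v(2)] x by auto
      show "(v has_real_derivative - f y (u y)) (at y within {c..x})" if "y \<in> {c..x} - E" for y
        by (rule has_field_derivative_subset[OF d]) (use that x in auto)
    qed (use x in auto)
    from integral_unique[OF this] show ?thesis by simp
  qed
  then have "second_order c d (\<lambda>x. f x (u x)) u v"
    using v(1) ei assms(2) by (intro second_orderI)
  then show thesis using that by blast
qed

lemma integral_exp_weight:
  fixes m :: "real \<Rightarrow> real"
  assumes m: "m absolutely_integrable_on {c..d}" and x: "x \<in> {c..d}"
  shows "k * integral {c..x} (\<lambda>t. m t * exp (k * integral {c..t} m)) = exp (k * integral {c..x} m) - 1"
proof -
  have m': "m absolutely_integrable_on {c..x}"
    using absolutely_integrable_on_subinterval[OF m] x by auto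
  have d: "((\<lambda>y. exp (k * y)) has_real_derivative k * exp (k * y)) (at y)" for y
    by (auto intro!: derivative_eq_intros)
  have "exp (k * integral {c..x} m) - exp (k * integral {c..c} m)
     = integral {c..x} (\<lambda>t. k * exp (k * integral {c..t} m) * m t)"
    by (rule integral_chain_rule[OF _ m' _ d]) (use x in \<open>auto intro!: continuous_intros\<close>)
  also have "\<dots> = k * integral {c..x} (\<lambda>t. m t * exp (k * integral {c..t} m))"
    by (subst Henstock_Kurzweil_Integration.integral_mult_right[symmetric]) (simp add: mult_ac)
  finally show ?thesis by simp
qed

text \<open>
The supremum \<open>Q\<close> of \<open>N exp (- 2 A)\<close>, where \<open>A\<close> is the integral of \<open>m\<close>, is attained. At that point the
hypothesis gives \<open>Q \<le> \<eta> + Q / 2\<close>, because the weight \<open>exp (2 A)\<close> makes the integral of \<open>m exp (2 A)\<close> at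
most half of \<open>exp (2 A)\<close>. The factor 2 is harmless in the applications.
\<close>
lemma gronwall:
  fixes m N :: "real \<Rightarrow> real"
  assumes N: "continuous_on {c..d} N" and m: "m absolutely_integrable_on {c..d}"
    and m0: "\<And>x. x \<in> {c..d} \<Longrightarrow> m x \<ge> 0" and \<eta>: "\<eta> \<ge> 0"
    and le: "\<And>x. x \<in> {c..d} \<Longrightarrow> N x \<le> \<eta> + integral {c..x} (\<lambda>t. m t * N t)"
    and x: "x \<in> {c..d}"
  shows "N x \<le> 2 * \<eta> * exp (2 * integral {c..x} m)"
proof -
  define A where "A x = integral {c..x} m" for x
  have Ac: "continuous_on {c..d} A"
    unfolding A_def using m indefinite_integral_continuous_1 by (auto simp: absolutely_integrable_on_def)
  have "\<exists>y\<in>{c..d}. \<forall>z\<in>{c..d}. N z * exp (-2 * A z) \<le> N y * exp (-2 * A y)"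
    using x by (intro continuous_attains_sup continuous_intros N Ac) auto
  then obtain y where y: "y \<in> {c..d}" "\<And>z. z \<in> {c..d} \<Longrightarrow> N z * exp (-2 * A z) \<le> N y * exp (-2 * A y)" by blast
  define Q where "Q = N y * exp (-2 * A y)"
  have NQ: "N z \<le> Q * exp (2 * A z)" if "z \<in> {c..d}" for z
  proof -
    have "N z = N z * exp (-2 * A z) * exp (2 * A z)" by (simp add: exp_minus)
    also have "\<dots> \<le> Q * exp (2 * A z)" using y(2)[OF that] by (intro mult_right_mono) (auto simp: Q_def)
    finally show ?thesis .
  qed
  have my: "m absolutely_integrable_on {c..y}"
    using absolutely_integrable_on_subinterval[OF m] y by auto
  have s: "{c..y} \<subseteq> {c..d}" using y by auto
  have "integral {c..y} (\<lambda>t. m t * N t) \<le> integral {c..y} (\<lambda>t. Q * (m t * exp (2 * A t)))"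
  proof (rule integral_le)
    show "(\<lambda>t. m t * N t) integrable_on {c..y}"
      using absolutely_integrable_mult_continuous[OF my continuous_on_subset[OF N s]]
      by (simp add: absolutely_integrable_on_def)
    have "(\<lambda>t. m t * exp (2 * A t)) absolutely_integrable_on {c..y}"
      by (intro absolutely_integrable_mult_continuous[OF my] continuous_intros continuous_on_subset[OF Ac s])
    then show "(\<lambda>t. Q * (m t * exp (2 * A t))) integrable_on {c..y}"
      by (intro integrable_on_mult_right) (simp add: absolutely_integrable_on_def)
    fix t assume t: "t \<in> {c..y}"
    then have "m t * N t \<le> m t * (Q * exp (2 * A t))"
      using NQ[of t] m0[of t] s by (intro mult_left_mono) auto
    then show "m t * N t \<le> Q * (m t * exp (2 * A t))" by (simp add: mult_ac)
  qed
  also have "\<dots> = Q * ((exp (2 * A y) - 1) / 2)"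
    using integral_exp_weight[OF m y(1), of 2] by (simp add: A_def)
  finally have "N y \<le> \<eta> + Q * ((exp (2 * A y) - 1) / 2)" using le[OF y(1)] by simp
  then have "Q \<le> (\<eta> + Q * ((exp (2 * A y) - 1) / 2)) * exp (-2 * A y)"
    unfolding Q_def[symmetric] by (simp add: Q_def)
  also have "\<dots> = \<eta> * exp (-2 * A y) + Q / 2 - Q / 2 * exp (-2 * A y)"
    by (simp add: field_simps exp_minus)
  finally have 1: "Q \<le> \<eta> * exp (-2 * A y) + Q / 2 - Q / 2 * exp (-2 * A y)" .
  have "Q \<le> 2 * \<eta>"
  proof (cases "Q \<le> 0")
    case False
    have "A y \<ge> 0" unfolding A_def using m0 s my
      by (intro integral_nonneg) (auto simp: absolutely_integrable_on_def)
    then have "\<eta> * exp (-2 * A y) \<le> \<eta> * 1" using \<eta> by (intro mult_left_mono) auto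
    moreover have "Q / 2 * exp (-2 * A y) \<ge> 0" using False by auto
    ultimately show ?thesis using 1 by linarith
  qed (use \<eta> in auto)
  then show ?thesis using NQ[OF x] by (simp add: A_def mult_right_mono order_trans)
qed

text \<open>
Gronwall's inequality for \<open>\<bar>u\<bar> + \<bar>v\<bar>\<close>. The summand \<open>d - c\<close> in the exponent comes from \<open>u' = v\<close>; the
inhomogeneity \<open>r\<close> measures the change of a parameter in the equation.
\<close>
lemma second_order_growth:
  assumes so: "second_order c d e u v"
    and k: "k absolutely_integrable_on {c..d}" "\<And>x. x \<in> {c..d} \<Longrightarrow> k x \<ge> 0"
    and r: "r absolutely_integrable_on {c..d}" "\<And>x. x \<in> {c..d} \<Longrightarrow> r x \<ge> 0"
    and e: "\<And>x. x \<in> {c..d} \<Longrightarrow> \<bar>e x\<bar> \<le> k x * \<bar>u x\<bar> + r x" and x: "x \<in> {c..d}"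
  shows "\<bar>u x\<bar> + \<bar>v x\<bar> \<le> 2 * (\<bar>u c\<bar> + \<bar>v c\<bar> + integral {c..d} r) * exp (2 * (d - c + integral {c..d} k))"
proof -
  define N where "N x = \<bar>u x\<bar> + \<bar>v x\<bar>" for x
  define m where "m x = 1 + k x" for x
  define \<eta> where "\<eta> = N c + integral {c..d} r"
  note cont = second_order_continuous[OF so]
  have cd: "c \<le> d" using second_orderD(1)[OF so] .
  have Nc: "continuous_on {c..d} N" unfolding N_def by (intro continuous_intros cont)
  have m: "m absolutely_integrable_on {c..d}" unfolding m_def using k(1) by auto
  have rd: "integral {c..d} r \<ge> 0" using r by (intro integral_nonneg) (auto simp: absolutely_integrable_on_def)
  have \<eta>0: "\<eta> \<ge> 0" using rd by (simp add: \<eta>_def N_def)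
  have le: "N x \<le> \<eta> + integral {c..x} (\<lambda>t. m t * N t)" if x: "x \<in> {c..d}" for x
  proof -
    have s: "{c..x} \<subseteq> {c..d}" using x by auto
    have ei: "e integrable_on {c..x}"
      using integrable_on_subinterval[OF second_orderD(3)[OF so] s] .
    have vi: "v integrable_on {c..x}" "(\<lambda>t. \<bar>v t\<bar>) integrable_on {c..x}"
      by (intro integrable_continuous_real continuous_intros continuous_on_subset[OF cont(2) s])+
    have kx: "k absolutely_integrable_on {c..x}" "r absolutely_integrable_on {c..x}" "m absolutely_integrable_on {c..x}"
      using absolutely_integrable_on_subinterval[OF k(1) s] absolutely_integrable_on_subinterval[OF r(1) s]
        absolutely_integrable_on_subinterval[OF m s] by auto
    have kr: "(\<lambda>t. k t * \<bar>u t\<bar> + r t) integrable_on {c..x}"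
      using absolutely_integrable_mult_continuous[OF kx(1), of "\<lambda>t. \<bar>u t\<bar>"] kx(2) continuous_on_subset[OF cont(1) s]
      by (intro integrable_add) (auto simp: absolutely_integrable_on_def intro: continuous_intros)
    have mN: "(\<lambda>t. m t * N t) integrable_on {c..x}"
      using absolutely_integrable_mult_continuous[OF kx(3) continuous_on_subset[OF Nc s]]
      by (simp add: absolutely_integrable_on_def)
    have "\<bar>u x - u c\<bar> \<le> integral {c..x} (\<lambda>t. \<bar>v t\<bar>)"
      using second_order_integral_derivative[OF so, of c x] x integral_norm_bound_integral[OF vi]
      by (auto simp: integral_unique)
    moreover have "\<bar>v x - v c\<bar> \<le> integral {c..x} (\<lambda>t. k t * \<bar>u t\<bar> + r t)"
      using second_order_increment[OF so, of c x] x integral_norm_bound_integral[OF ei kr] e s by auto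
    ultimately have "N x \<le> N c + (integral {c..x} (\<lambda>t. \<bar>v t\<bar>) + integral {c..x} (\<lambda>t. k t * \<bar>u t\<bar> + r t))"
      unfolding N_def by linarith
    also have "integral {c..x} (\<lambda>t. \<bar>v t\<bar>) + integral {c..x} (\<lambda>t. k t * \<bar>u t\<bar> + r t)
       = integral {c..x} (\<lambda>t. \<bar>v t\<bar> + (k t * \<bar>u t\<bar> + r t))"
      by (rule Henstock_Kurzweil_Integration.integral_add[OF vi(2) kr, symmetric])
    also have "\<dots> \<le> integral {c..x} (\<lambda>t. m t * N t + r t)"
    proof (rule integral_le)
      show "(\<lambda>t. \<bar>v t\<bar> + (k t * \<bar>u t\<bar> + r t)) integrable_on {c..x}" using vi(2) kr by (rule integrable_add)
      show "(\<lambda>t. m t * N t + r t) integrable_on {c..x}" using mN kx(2)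
        by (intro integrable_add) (auto simp: absolutely_integrable_on_def)
      fix t assume t: "t \<in> {c..x}"
      have "m t * N t = \<bar>v t\<bar> + k t * \<bar>u t\<bar> + (\<bar>u t\<bar> + k t * \<bar>v t\<bar>)" by (simp add: m_def N_def algebra_simps)
      moreover have "k t * \<bar>v t\<bar> \<ge> 0" using k(2)[of t] t s by auto
      ultimately show "\<bar>v t\<bar> + (k t * \<bar>u t\<bar> + r t) \<le> m t * N t + r t" by linarith
    qed
    also have "\<dots> = integral {c..x} (\<lambda>t. m t * N t) + integral {c..x} r"
      using mN kx(2) by (intro Henstock_Kurzweil_Integration.integral_add) (auto simp: absolutely_integrable_on_def)
    also have "integral {c..x} r \<le> integral {c..d} r"
      using r s kx(2) by (intro integral_subset_le) (auto simp: absolutely_integrable_on_def)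
    finally show ?thesis by (simp add: \<eta>_def)
  qed
  have "N x \<le> 2 * \<eta> * exp (2 * integral {c..x} m)"
  proof (rule gronwall[OF Nc m _ \<eta>0 le x])
    show "m t \<ge> 0" if "t \<in> {c..d}" for t using k(2)[OF that] by (simp add: m_def)
  qed
  also have "\<dots> \<le> 2 * \<eta> * exp (2 * (d - c + integral {c..d} k))"
  proof -
    have "integral {c..x} m \<le> integral {c..d} m"
      using m k(2) x absolutely_integrable_on_subinterval[OF m, of c x]
      by (intro integral_subset_le) (auto simp: absolutely_integrable_on_def m_def)
    also have "\<dots> = d - c + integral {c..d} k"
      using k(1) cd unfolding m_def
      by (subst Henstock_Kurzweil_Integration.integral_add) (auto simp: absolutely_integrable_on_def)
    finally show ?thesis using \<eta>0 by (intro mult_left_mono) auto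
  qed
  finally show ?thesis by (simp add: N_def \<eta>_def)
qed

text \<open>
Forwards this is the previous estimate, backwards it is the previous estimate for the reflected equation.
It contains uniqueness, Lipschitz dependence on the initial slope, and the simplicity of zeros.
\<close>
lemma second_order_growth_between:
  assumes so: "second_order c d e u v"
    and k: "k absolutely_integrable_on {c..d}" "\<And>x. x \<in> {c..d} \<Longrightarrow> k x \<ge> 0"
    and e: "\<And>x. x \<in> {c..d} \<Longrightarrow> \<bar>e x\<bar> \<le> k x * \<bar>u x\<bar>" and x: "x \<in> {c..d}" "y \<in> {c..d}"
  shows "\<bar>u x\<bar> + \<bar>v x\<bar> \<le> 2 * exp (2 * (d - c + integral {c..d} k)) * (\<bar>u y\<bar> + \<bar>v y\<bar>)"
proof -
  have mono: "2 * (\<bar>u y\<bar> + \<bar>v y\<bar> + 0) * exp (2 * (q - p + integral {p..q} k)) \<le>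
     2 * exp (2 * (d - c + integral {c..d} k)) * (\<bar>u y\<bar> + \<bar>v y\<bar>)" if "c \<le> p" "p \<le> q" "q \<le> d" for p q
  proof -
    have "integral {p..q} k \<le> integral {c..d} k"
      using k absolutely_integrable_on_subinterval[OF k(1), of p q] that
      by (intro integral_subset_le) (auto simp: absolutely_integrable_on_def)
    then have "exp (2 * (q - p + integral {p..q} k)) \<le> exp (2 * (d - c + integral {c..d} k))" using that by simp
    then have "2 * (\<bar>u y\<bar> + \<bar>v y\<bar>) * exp (2 * (q - p + integral {p..q} k)) \<le>
       2 * (\<bar>u y\<bar> + \<bar>v y\<bar>) * exp (2 * (d - c + integral {c..d} k))" by (intro mult_left_mono) auto
    then show ?thesis by (simp only: mult_ac add_0_right)
  qed
  show ?thesis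
  proof (cases "y \<le> x")
    case True
    have "\<bar>u x\<bar> + \<bar>v x\<bar> \<le> 2 * (\<bar>u y\<bar> + \<bar>v y\<bar> + integral {y..x} (\<lambda>_. 0)) * exp (2 * (x - y + integral {y..x} k))"
      by (rule second_order_growth[OF second_order_subinterval[OF so]])
        (use True x k e absolutely_integrable_on_subinterval[OF k(1), of y x] in auto)
    with mono[of y x] True x show ?thesis by auto
  next
    case False
    have k': "k absolutely_integrable_on {x..y}" using absolutely_integrable_on_subinterval[OF k(1), of x y] x by auto
    have ik: "integral {-y..-x} (\<lambda>t. k (-t)) = integral {x..y} k" by simp
    have "\<bar>u (-(-x))\<bar> + \<bar>- v (-(-x))\<bar> \<le> 2 * (\<bar>u (-(-y))\<bar> + \<bar>- v (-(-y))\<bar> + integral {-y..-x} (\<lambda>_. 0)) *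
        exp (2 * (-x - (-y) + integral {-y..-x} (\<lambda>t. k (-t))))"
    proof (rule second_order_growth[OF second_order_reflect[OF second_order_subinterval[OF so]]])
      show "(\<lambda>t. k (-t)) absolutely_integrable_on {-y..-x}" using k' by simp
      show "0 \<le> k (-t)" if "t \<in> {-y..-x}" for t using k(2) that x by auto
      show "\<bar>e (- t)\<bar> \<le> k (- t) * \<bar>u (- t)\<bar> + 0" if "t \<in> {-y..-x}" for t using e[of "-t"] that x by auto
    qed (use False x in auto)
    with mono[of x y] ik False x show ?thesis by auto
  qed
qed

section \<open>Initial value problems and shooting\<close>

text \<open>
A fixed point for \<open>v\<close>, with \<open>u\<close> recovered as the integral of \<open>v\<close>. Measured in the weight \<open>exp (k A)\<close>, where \<open>A\<close>
is the integral of \<open>\<bar>a\<bar>\<close>, the integral operator is a contraction on the whole interval once \<open>k\<close> exceeds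
\<open>2 K (d - c)\<close>. Functions on \<open>{c..d}\<close> are extended to the line by constants (\<open>clamp\<close>), which places them in the
complete space of bounded continuous functions.
\<close>
lemma initial_value_problem:
  fixes a f :: "real \<Rightarrow> real"
  assumes cd: "c \<le> d" and a: "a absolutely_integrable_on {c..d}"
    and f: "\<And>x y. \<bar>f x - f y\<bar> \<le> K * \<bar>x - y\<bar>"
  obtains u v where "second_order c d (\<lambda>x. a x * f (u x)) u v" "u c = 0" "v c = s"
proof -
  have K: "K \<ge> 0" using order_trans[OF abs_ge_zero f[of 0 1]] by simp
  have fc: "continuous_on UNIV f"
  proof (rule continuous_onI)
    fix x e :: real assume e: "e > 0"
    show "\<exists>\<delta>>0. \<forall>y\<in>UNIV. dist y x < \<delta> \<longrightarrow> dist (f y) (f x) \<le> e"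
    proof (intro exI[of _ "e / (K + 1)"] conjI ballI impI)
      show "e / (K + 1) > 0" using e K by simp
      fix y assume "dist y x < e / (K + 1)"
      then have "K * \<bar>y - x\<bar> \<le> (K + 1) * (e / (K + 1))"
        using K by (intro mult_mono) (auto simp: dist_real_def)
      then show "dist (f y) (f x) \<le> e" using f[of y x] K by (simp add: dist_real_def)
    qed
  qed
  define am where "am x = \<bar>a x\<bar>" for x
  have am: "am absolutely_integrable_on {c..d}" unfolding am_def using a by (rule set_integrable_abs)
  define A where "A x = integral {c..x} am" for x
  \<comment> \<open>\<open>K (d - c) / k \<le> 1 / 2\<close>; the summand 1 keeps \<open>k\<close> positive if \<open>K = 0\<close> or \<open>c = d\<close>\<close>
  define k where "k = 2 * K * (d - c) + 1"
  have k: "k > 0" using K cd by (simp add: k_def add_nonneg_pos)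
  define E where "E x = exp (k * A x)" for x
  have Ac: "continuous_on {c..d} A"
    unfolding A_def using am indefinite_integral_continuous_1 by (auto simp: absolutely_integrable_on_def)
  have Ec: "continuous_on {c..d} E" unfolding E_def by (intro continuous_intros Ac)
  have Epos: "E x > 0" for x by (simp add: E_def)
  have Amono: "A x \<le> A y" if "c \<le> x" "x \<le> y" "y \<le> d" for x y
  proof -
    have "A y - A x = integral {x..y} am" unfolding A_def by (rule integral_difference[OF am that])
    also have "\<dots> \<ge> 0"
      using absolutely_integrable_on_subinterval[OF am, of x y] that
      by (intro integral_nonneg) (auto simp: absolutely_integrable_on_def am_def)
    finally show ?thesis by simp
  qed
  define U where "U z t = integral {c..t} (\<lambda>r. apply_bcontfun z r * E r)" for z :: "real \<Rightarrow>\<^sub>C real" and t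
  define S where "S z x = s - integral {c..x} (\<lambda>t. a t * f (U z t))" for z :: "real \<Rightarrow>\<^sub>C real" and x
  have zE: "continuous_on {c..d} (\<lambda>r. apply_bcontfun z r * E r)" for z :: "real \<Rightarrow>\<^sub>C real"
    by (rule continuous_on_mult[OF continuous_on_apply_bcontfun Ec])
  have Uc: "continuous_on {c..d} (U z)" for z
    unfolding U_def by (intro indefinite_integral_continuous_1 integrable_continuous_real zE)
  have afU: "(\<lambda>t. a t * f (U z t)) absolutely_integrable_on {c..d}" for z
    by (intro absolutely_integrable_mult_continuous[OF a] continuous_on_compose2[OF fc Uc]) auto
  have Sc: "continuous_on {c..d} (S z)" for z
    unfolding S_def using afU indefinite_integral_continuous_1
    by (intro continuous_intros) (auto simp: absolutely_integrable_on_def)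
  define clamp where "clamp x = max c (min d x)" for x
  have clamp: "clamp x \<in> {c..d}" for x using cd by (auto simp: clamp_def)
  have clc: "continuous_on UNIV clamp" unfolding clamp_def by (intro continuous_intros)
  define g where "g z x = S z x / E x" for z x
  have gc: "continuous_on {c..d} (g z)" for z
    unfolding g_def using Epos by (intro continuous_intros Sc Ec) (auto simp: less_imp_neq[symmetric] E_def)
  have gb: "(\<lambda>x. g z (clamp x)) \<in> bcontfun" for z
  proof -
    have "bounded (g z ` {c..d})"
      using gc compact_continuous_image compact_imp_bounded by blast
    then obtain B where "\<And>x. x \<in> {c..d} \<Longrightarrow> norm (g z x) \<le> B" unfolding bounded_iff by blast
    moreover have "continuous_on UNIV (\<lambda>x. g z (clamp x))"
      by (rule continuous_on_compose2[OF gc clc]) (use clamp in auto)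
    ultimately show ?thesis using clamp by (intro bcontfun_normI[of _ B]) auto
  qed
  define T where "T z = Bcontfun (\<lambda>x. g z (clamp x))" for z
  have T: "apply_bcontfun (T z) x = g z (clamp x)" for z x
    unfolding T_def using Bcontfun_inverse[OF gb] by simp
  have contraction: "dist (T z1) (T z2) \<le> 1/2 * dist z1 z2" for z1 z2
  proof (rule dist_bound)
    fix y
    define x where "x = clamp y"
    define D where "D = dist z1 z2"
    have D: "\<bar>apply_bcontfun z1 r - apply_bcontfun z2 r\<bar> \<le> D" for r
      using dist_bounded[of z1 r z2] by (simp add: D_def dist_real_def)
    have x: "c \<le> x" "x \<le> d" using clamp[of y] by (auto simp: x_def)
    have Ud: "\<bar>U z1 t - U z2 t\<bar> \<le> (d - c) * D * E t" if t: "t \<in> {c..d}" for t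
    proof -
      have i: "(\<lambda>r. apply_bcontfun z r * E r) integrable_on {c..t}" for z :: "real \<Rightarrow>\<^sub>C real"
        using integrable_continuous_real[OF continuous_on_subset[OF zE]] t by auto
      have "U z1 t - U z2 t = integral {c..t} (\<lambda>r. apply_bcontfun z1 r * E r - apply_bcontfun z2 r * E r)"
        unfolding U_def using i by (intro Henstock_Kurzweil_Integration.integral_diff[symmetric])
      also have "norm \<dots> \<le> integral {c..t} (\<lambda>r. D * E t)"
      proof (rule integral_norm_bound_integral)
        show "(\<lambda>r. apply_bcontfun z1 r * E r - apply_bcontfun z2 r * E r) integrable_on {c..t}"
          using i by (intro integrable_diff)
        fix r assume r: "r \<in> {c..t}"
        have "E r \<le> E t" using Amono[of r t] r t k by (simp add: E_def)
        then have "\<bar>apply_bcontfun z1 r - apply_bcontfun z2 r\<bar> * E r \<le> D * E t"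
          using D[of r] Epos[of r] by (intro mult_mono) auto
        then show "norm (apply_bcontfun z1 r * E r - apply_bcontfun z2 r * E r) \<le> D * E t"
          using Epos[of r] by (simp add: left_diff_distrib[symmetric] abs_mult)
      qed auto
      also have "\<dots> = (t - c) * (D * E t)" using t by simp
      also have "\<dots> \<le> (d - c) * (D * E t)"
        using t Epos[of t] by (intro mult_right_mono) (auto simp: D_def)
      finally show ?thesis by (simp add: mult.assoc)
    qed
    have ax: "a absolutely_integrable_on {c..x}" "am absolutely_integrable_on {c..x}"
      using absolutely_integrable_on_subinterval[OF a] absolutely_integrable_on_subinterval[OF am] x by auto
    have sx: "{c..x} \<subseteq> {c..d}" using x by auto
    have iaf: "(\<lambda>t. a t * f (U z t)) integrable_on {c..x}" for z
      using absolutely_integrable_on_subinterval[OF afU sx] by (simp add: absolutely_integrable_on_def)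
    have amE: "(\<lambda>t. am t * E t) integrable_on {c..x}"
      using absolutely_integrable_mult_continuous[OF ax(2) continuous_on_subset[OF Ec sx]]
      by (simp add: absolutely_integrable_on_def)
    have "S z2 x - S z1 x = integral {c..x} (\<lambda>t. a t * f (U z1 t) - a t * f (U z2 t))"
      unfolding S_def using iaf by (subst Henstock_Kurzweil_Integration.integral_diff) auto
    also have "norm \<dots> \<le> integral {c..x} (\<lambda>t. (K * (d - c) * D) * (am t * E t))"
    proof (rule integral_norm_bound_integral)
      show "(\<lambda>t. a t * f (U z1 t) - a t * f (U z2 t)) integrable_on {c..x}"
        using iaf by (intro integrable_diff)
      show "(\<lambda>t. (K * (d - c) * D) * (am t * E t)) integrable_on {c..x}"
        by (intro integrable_on_mult_right amE)
      fix t assume "t \<in> {c..x}"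
      then have t: "t \<in> {c..d}" using sx by auto
      have "\<bar>f (U z1 t) - f (U z2 t)\<bar> \<le> K * \<bar>U z1 t - U z2 t\<bar>" by (rule f)
      also have "\<dots> \<le> K * ((d - c) * D * E t)" by (intro mult_left_mono Ud[OF t] K)
      finally have "am t * \<bar>f (U z1 t) - f (U z2 t)\<bar> \<le> am t * (K * ((d - c) * D * E t))"
        by (intro mult_left_mono) (auto simp: am_def)
      then show "norm (a t * f (U z1 t) - a t * f (U z2 t)) \<le> (K * (d - c) * D) * (am t * E t)"
        by (simp add: am_def right_diff_distrib[symmetric] abs_mult mult_ac)
    qed
    also have "\<dots> = (K * (d - c) * D) * ((E x - 1) / k)"
    proof -
      have "k * integral {c..x} (\<lambda>t. am t * E t) = E x - 1"
        using integral_exp_weight[OF am, of x k] x by (simp add: E_def A_def)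
      then have "integral {c..x} (\<lambda>t. am t * E t) = (E x - 1) / k" using k by (simp add: field_simps)
      then show ?thesis by (simp only: Henstock_Kurzweil_Integration.integral_mult_right)
    qed
    also have "\<dots> \<le> (K * (d - c) * D) * (E x / k)"
      using K cd k by (intro mult_left_mono divide_right_mono) (auto simp: D_def)
    also have "\<dots> = (K * (d - c) / k) * (D * E x)" by simp
    also have "\<dots> \<le> 1/2 * (D * E x)"
    proof (rule mult_right_mono)
      show "K * (d - c) / k \<le> 1/2" using k by (simp add: divide_le_eq) (simp add: k_def)
      show "0 \<le> D * E x" using Epos[of x] by (simp add: D_def)
    qed
    finally have le: "\<bar>S z2 x - S z1 x\<bar> \<le> 1/2 * D * E x" by simp
    have "dist (apply_bcontfun (T z1) y) (apply_bcontfun (T z2) y) = \<bar>S z2 x - S z1 x\<bar> / E x"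
      using Epos[of x] unfolding T x_def[symmetric] g_def dist_real_def
      by (simp add: diff_divide_distrib[symmetric] abs_minus_commute)
    also have "\<dots> \<le> 1/2 * D" using le Epos[of x] by (simp add: divide_le_eq)
    finally show "dist (apply_bcontfun (T z1) y) (apply_bcontfun (T z2) y) \<le> 1/2 * dist z1 z2" by (simp add: D_def)
  qed
  obtain z where z: "T z = z"
    using banach_fix_type[of "1/2" T] contraction by auto
  define v where "v x = apply_bcontfun z x * E x" for x
  have v: "v x = S z x" if "x \<in> {c..d}" for x
  proof -
    have "clamp x = x" using that by (auto simp: clamp_def)
    then have "apply_bcontfun z x = S z x / E x" using T[of z x] z by (simp add: g_def)
    then show ?thesis using Epos[of x] by (simp add: v_def)
  qed
  have vc: "v c = s" using v[of c] cd by (simp add: S_def)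
  have "second_order c d (\<lambda>x. a x * f (U z x)) (U z) v"
  proof (rule second_orderI[OF cd afU])
    fix x assume x: "x \<in> {c..d}"
    show "(U z has_real_derivative v x) (at x within {c..d})"
      unfolding U_def v_def using integral_has_real_derivative[OF zE x] .
    show "v x = v c - integral {c..x} (\<lambda>x. a x * f (U z x))" using v[OF x] vc by (simp add: S_def)
  qed
  moreover have "U z c = 0" by (simp add: U_def)
  ultimately show thesis using vc that by blast
qed

text \<open>
The concavity estimate at one point: \<open>u\<close> and \<open>t\<close> are the value and the slope there, \<open>p\<close> the distance to the end
of the interval, \<open>q\<close> the distance to a point with value \<open>M\<close>, and \<open>A\<close> bounds the increase of the slope.
Eliminating \<open>t\<close> from the two estimates leaves the bound for \<open>u\<close>.
\<close>
lemma tent_inequality: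
  fixes p q u M t A D :: real
  assumes "p \<ge> 0" "q > 0" "A \<ge> 0" "u \<ge> 0" "M \<ge> 0" "p * (t - A) \<le> u" "M - u \<le> q * (t + A)" "p + q \<le> D"
  shows "M * (p / D) - 2 * A * D \<le> u"
proof -
  have D: "D > 0" using assms by linarith
  have "q * (p * (t - A)) \<le> q * u" "p * (M - u) \<le> p * (q * (t + A))"
    using assms by (auto intro: mult_left_mono)
  then have 1: "p * M - 2 * A * (p * q) \<le> u * (p + q)" by (simp add: algebra_simps)
  have "p * q \<le> D * (p + q)" using assms by (intro mult_mono) auto
  then have "A * (p * q) \<le> A * (D * (p + q))" using assms by (intro mult_left_mono)
  then have "p * M \<le> (u + 2 * A * D) * (p + q)" using 1 by (simp add: algebra_simps)
  also have "\<dots> \<le> (u + 2 * A * D) * D" using assms D by (intro mult_left_mono) auto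
  finally show ?thesis using D by (simp add: field_simps)
qed

text \<open>
For \<open>A = 0\<close> the function is concave and nonnegative, so it lies above the chords from \<open>(y, u y)\<close> to \<open>(c, 0)\<close> and
\<open>(d, 0)\<close>, hence above a multiple of \<open>(x - c) (d - x)\<close>. A slope that increases by at most \<open>A\<close> costs a constant.
\<close>
lemma nearly_concave_above_tent:
  assumes so: "second_order c d e u v" and u: "\<And>x. x \<in> {c..d} \<Longrightarrow> u x \<ge> 0" and A: "A \<ge> 0"
    and v: "\<And>x y. c \<le> x \<Longrightarrow> x \<le> y \<Longrightarrow> y \<le> d \<Longrightarrow> v y - v x \<le> A"
    and x: "x \<in> {c..d}" "y \<in> {c..d}" and "c < d"
  shows "u y * ((x - c) * (d - x) / (d - c)\<^sup>2) - 2 * A * (d - c) \<le> u x"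
proof -
  have D: "d - c > 0" using assms by simp
  have frac: "(x - c) * (d - x) / (d - c)\<^sup>2 = (x - c) / (d - c) * ((d - x) / (d - c))"
    by (simp add: power2_eq_square)
  have f1: "0 \<le> (x - c) / (d - c)" "(x - c) / (d - c) \<le> 1" "0 \<le> (d - x) / (d - c)" "(d - x) / (d - c) \<le> 1"
    using x D by auto
  consider "x < y" | "x = y" | "y < x" by linarith
  then show ?thesis
  proof cases
    case 1
    obtain z1 where z1: "z1 \<in> {c..x}" "u x - u c = v z1 * (x - c)"
    proof (cases "x = c")
      case False
      then obtain z where "c < z" "z < x" "u x - u c = v z * (x - c)"
        using second_order_mean_value[OF so, of c x] x by auto
      then show thesis using that[of z] by auto
    qed (use that[of c] x in auto)
    obtain z2 where z2: "x < z2" "z2 < y" "u y - u x = v z2 * (y - x)"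
      using second_order_mean_value[OF so, of x y] x 1 by auto
    have "(x - c) * (v x - A) \<le> (x - c) * v z1"
      using v[of z1 x] z1 x by (intro mult_left_mono) auto
    then have a: "(x - c) * (v x - A) \<le> u x" using z1 u[of c] D by (simp add: mult.commute)
    have "(y - x) * v z2 \<le> (y - x) * (v x + A)"
      using v[of x z2] z2 x 1 by (intro mult_left_mono) auto
    then have b: "u y - u x \<le> (y - x) * (v x + A)" using z2 by (simp add: mult.commute)
    have "u y * ((x - c) / (d - c)) - 2 * A * (d - c) \<le> u x"
      using tent_inequality[OF _ _ A _ _ a b] 1 x u by auto
    moreover have "u y * ((x - c) / (d - c) * ((d - x) / (d - c))) \<le> u y * ((x - c) / (d - c) * 1)"
      using u[OF x(2)] f1 by (intro mult_left_mono) auto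
    ultimately show ?thesis unfolding frac by simp
  next
    case 2
    have "(x - c) / (d - c) * ((d - x) / (d - c)) \<le> 1" using f1 by (intro mult_le_one) auto
    then have "u y * ((x - c) / (d - c) * ((d - x) / (d - c))) \<le> u y * 1"
      using u[OF x(2)] by (intro mult_left_mono) auto
    moreover have "0 \<le> 2 * A * (d - c)" using A D by simp
    ultimately have "u y * ((x - c) / (d - c) * ((d - x) / (d - c))) - 2 * A * (d - c) \<le> u y" by linarith
    then show ?thesis unfolding frac using 2 by simp
  next
    case 3
    obtain z1 where z1: "z1 \<in> {x..d}" "u d - u x = v z1 * (d - x)"
    proof (cases "x = d")
      case False
      then obtain z where "x < z" "z < d" "u d - u x = v z * (d - x)"
        using second_order_mean_value[OF so, of x d] x by auto
      then show thesis using that[of z] by auto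
    qed (use that[of d] x in auto)
    obtain z2 where z2: "y < z2" "z2 < x" "u x - u y = v z2 * (x - y)"
      using second_order_mean_value[OF so, of y x] x 3 by auto
    have "(d - x) * v z1 \<le> (d - x) * (v x + A)"
      using v[of x z1] z1 x by (intro mult_left_mono) auto
    then have a: "(d - x) * (- v x - A) \<le> u x" using z1 u[of d] D by (simp add: algebra_simps)
    have "(x - y) * (v x - A) \<le> (x - y) * v z2"
      using v[of z2 x] z2 x 3 by (intro mult_left_mono) auto
    then have b: "u y - u x \<le> (x - y) * (- v x + A)" using z2 by (simp add: algebra_simps)
    have "u y * ((d - x) / (d - c)) - 2 * A * (d - c) \<le> u x"
      using tent_inequality[OF _ _ A _ _ a b] 3 x u by auto
    moreover have "u y * ((x - c) / (d - c) * ((d - x) / (d - c))) \<le> u y * (1 * ((d - x) / (d - c)))"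
      using u[OF x(2)] f1 by (intro mult_left_mono mult_right_mono) auto
    ultimately show ?thesis unfolding frac by simp
  qed
qed

lemma second_order_interior_minimum:
  assumes so: "second_order c d e u v" and "x \<in> {c<..<d}" "\<And>y. y \<in> {c..d} \<Longrightarrow> u x \<le> u y"
  shows "v x = 0"
proof -
  have "(u has_real_derivative v x) (at x within {c..d})"
    using second_orderD(4)[OF so, of x] assms by auto
  then have "(u has_real_derivative v x) (at x)" using assms at_within_Icc_at[of c x d] by simp
  then show ?thesis
  proof (rule DERIV_local_min)
    show "0 < min (x - c) (d - x)" using assms by auto
    show "\<forall>y. \<bar>x - y\<bar> < min (x - c) (d - x) \<longrightarrow> u x \<le> u y" using assms(3) by (auto simp: abs_if split: if_splits)
  qed
qed

text \<open>
Let \<open>p\<close> be the infimum of the parameters whose solution is not positive on \<open>]c, d]\<close>. Positivity on \<open>]c, d]\<close> is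
stable under small changes of the parameter: near \<open>c\<close> because the slope there is positive, elsewhere by
compactness. So \<open>p\<close> itself is one of these parameters, while \<open>U p\<close> is nonnegative as a limit. A zero inside the
interval would be a minimum, hence double; only a zero at \<open>d\<close> remains.
\<close>
theorem shooting:
  fixes U V :: "real \<Rightarrow> real \<Rightarrow> real"
  assumes cd: "c < d" and so: "\<And>p. p \<in> {p0..p1} \<Longrightarrow> second_order c d (e p) (U p) (V p)"
    and init: "\<And>p. p \<in> {p0..p1} \<Longrightarrow> U p c = 0" "\<And>p. p \<in> {p0..p1} \<Longrightarrow> V p c > 0"
    and lip: "\<And>p q x. p \<in> {p0..p1} \<Longrightarrow> q \<in> {p0..p1} \<Longrightarrow> x \<in> {c..d} \<Longrightarrow>
        \<bar>U p x - U q x\<bar> + \<bar>V p x - V q x\<bar> \<le> B * \<bar>p - q\<bar>"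
    and simple: "\<And>p x. p \<in> {p0..p1} \<Longrightarrow> x \<in> {c<..<d} \<Longrightarrow> U p x = 0 \<Longrightarrow> V p x \<noteq> 0"
    and p01: "p0 \<le> p1" and start: "\<And>x. x \<in> {c<..d} \<Longrightarrow> U p0 x > 0"
    and stop: "\<exists>x\<in>{c<..d}. U p1 x \<le> 0"
  obtains p where "p0 < p" "p \<le> p1" "\<And>x. x \<in> {c<..<d} \<Longrightarrow> U p x > 0" "U p d = 0"
    "\<And>q x. p0 \<le> q \<Longrightarrow> q < p \<Longrightarrow> x \<in> {c<..d} \<Longrightarrow> U q x > 0"
proof -
  define good where "good p \<longleftrightarrow> (\<forall>x\<in>{c<..d}. U p x > 0)" for p
  define B' where "B' = \<bar>B\<bar> + 1"
  have B': "B' > 0" by (simp add: B'_def)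
  have lip': "\<bar>U p x - U q x\<bar> \<le> B' * \<bar>p - q\<bar>" "\<bar>V p x - V q x\<bar> \<le> B' * \<bar>p - q\<bar>"
    if "p \<in> {p0..p1}" "q \<in> {p0..p1}" "x \<in> {c..d}" for p q x
  proof -
    have "B * \<bar>p - q\<bar> \<le> B' * \<bar>p - q\<bar>" by (intro mult_right_mono) (auto simp: B'_def)
    then show "\<bar>U p x - U q x\<bar> \<le> B' * \<bar>p - q\<bar>" "\<bar>V p x - V q x\<bar> \<le> B' * \<bar>p - q\<bar>"
      using lip[OF that] by linarith+
  qed
  have good_open: "\<exists>\<delta>>0. \<forall>q\<in>{p0..p1}. \<bar>q - p\<bar> < \<delta> \<longrightarrow> good q" if p: "p \<in> {p0..p1}" and g: "good p" for p
  proof -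
    have "continuous_on {c..d} (V p)" using second_order_continuous(2)[OF so[OF p]] .
    then obtain \<eta> where \<eta>: "\<eta> > 0" "\<And>x. x \<in> {c..d} \<Longrightarrow> \<bar>x - c\<bar> < \<eta> \<Longrightarrow> \<bar>V p x - V p c\<bar> < V p c / 2"
      using init(2)[OF p] cd unfolding continuous_on_iff dist_real_def
      by (metis atLeastAtMost_iff half_gt_zero less_eq_real_def order_refl)
    define b where "b = min d (c + \<eta> / 2)"
    have b: "c < b" "b \<le> d" "b < c + \<eta>" using \<eta>(1) cd by (auto simp: b_def)
    have "\<exists>x\<in>{b..d}. \<forall>y\<in>{b..d}. U p x \<le> U p y"
      using b second_order_continuous(1)[OF so[OF p]]
      by (intro continuous_attains_inf) (auto elim: continuous_on_subset)
    then obtain x0 where x0: "x0 \<in> {b..d}" "\<And>y. y \<in> {b..d} \<Longrightarrow> U p x0 \<le> U p y" by blast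
    define \<mu> where "\<mu> = min (U p x0) (V p c / 2)"
    have \<mu>: "\<mu> > 0" using g x0 b init(2)[OF p] by (auto simp: \<mu>_def good_def)
    have "good q" if q: "q \<in> {p0..p1}" "\<bar>q - p\<bar> < \<mu> / B'" for q
      unfolding good_def
    proof
      fix x assume x: "x \<in> {c<..d}"
      have "B' * \<bar>p - q\<bar> < \<mu>" using q(2) B' by (simp add: pos_less_divide_eq mult.commute abs_minus_commute)
      then have near: "\<bar>U p y - U q y\<bar> < \<mu>" "\<bar>V p y - V q y\<bar> < \<mu>" if "y \<in> {c..d}" for y
        using lip'[OF p q(1) that] by linarith+
      show "U q x > 0"
      proof (cases "x \<ge> b")
        case True
        then show ?thesis using near(1)[of x] x0(2)[of x] x by (auto simp: \<mu>_def)
      next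
        case False
        obtain z where z: "c < z" "z < x" "U q x - U q c = V q z * (x - c)"
          using second_order_mean_value[OF so[OF q(1)], of c x] x by auto
        have "z \<in> {c..d}" "\<bar>z - c\<bar> < \<eta>" using z x b False by auto
        from near(2)[OF this(1)] \<eta>(2)[OF this] have "V q z > 0" unfolding \<mu>_def by linarith
        then show ?thesis using z x init(1)[OF q(1)] by simp
      qed
    qed
    then show ?thesis using \<mu> B' by (intro exI[of _ "\<mu> / B'"]) auto
  qed
  define bad where "bad = {p \<in> {p0..p1}. \<not> good p}"
  have p1bad: "p1 \<in> bad"
  proof -
    obtain x where "x \<in> {c<..d}" "U p1 x \<le> 0" using stop by blast
    then have "\<not> good p1" unfolding good_def by (meson leD)
    then show ?thesis using p01 by (simp add: bad_def)
  qed
  have bdd: "bdd_below bad" by (auto simp: bad_def)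
  define p where "p = Inf bad"
  have pp: "p \<in> {p0..p1}"
    unfolding p_def using p1bad bdd by (auto intro!: cInf_lower cInf_greatest simp: bad_def)
  have below: "good q" if "p0 \<le> q" "q < p" for q
    using that pp cInf_lower[OF _ bdd, of q] by (force simp: bad_def p_def)
  have nb: "\<not> good p"
  proof
    assume "good p"
    then obtain \<delta> where \<delta>: "\<delta> > 0" "\<And>q. q \<in> {p0..p1} \<Longrightarrow> \<bar>q - p\<bar> < \<delta> \<Longrightarrow> good q"
      using good_open[OF pp] by blast
    obtain q where q: "q \<in> bad" "q < p + \<delta>"
      using cInf_lessD[of bad "p + \<delta>"] p1bad \<delta>(1) by (auto simp: p_def)
    moreover have "p \<le> q" using cInf_lower[OF q(1) bdd] by (simp add: p_def)
    ultimately show False using \<delta>(2)[of q] by (auto simp: bad_def)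
  qed
  have "p \<noteq> p0" using nb start by (auto simp: good_def)
  then have p0p: "p0 < p" using pp by auto
  have nonneg: "U p x \<ge> 0" if x: "x \<in> {c..d}" for x
  proof (rule ccontr)
    assume "\<not> U p x \<ge> 0"
    then have n: "- U p x > 0" by simp
    define q where "q = max p0 (p - (- U p x) / (2 * B'))"
    have "(- U p x) / (2 * B') > 0" using n B' by (intro divide_pos_pos) auto
    then have q: "p0 \<le> q" "q < p" "\<bar>p - q\<bar> \<le> (- U p x) / (2 * B')"
      unfolding q_def using p0p by linarith+
    have xq: "U q x \<ge> 0" using below[OF q(1,2)] x init(1)[of q] q pp
      by (cases "x = c") (auto simp: good_def intro: less_imp_le)
    have "\<bar>U p x - U q x\<bar> \<le> B' * \<bar>p - q\<bar>" using lip'(1)[OF pp _ x, of q] q pp by auto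
    also have "\<dots> \<le> B' * ((- U p x) / (2 * B'))" using q B' by (intro mult_left_mono) auto
    also have "\<dots> = - U p x / 2" using B' by simp
    finally show False using xq n by linarith
  qed
  have inner: "U p x > 0" if x: "x \<in> {c<..<d}" for x
  proof (rule ccontr)
    assume "\<not> U p x > 0"
    then have 0: "U p x = 0" using nonneg[of x] x by auto
    then have "V p x = 0" using second_order_interior_minimum[OF so[OF pp] x] nonneg by auto
    then show False using simple[OF pp x 0] by simp
  qed
  have "U p d = 0"
  proof -
    obtain x where x: "x \<in> {c<..d}" "U p x \<le> 0" using nb by (force simp: good_def)
    then have "x = d" using inner[of x] by force
    then show ?thesis using x nonneg[of d] by auto
  qed
  then show thesis using that[OF p0p _ inner] pp below by (auto simp: good_def)
qed

section \<open>The first eigenvalue\<close>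

lemma second_order_cmult:
  assumes "second_order c d e u v"
  shows "second_order c d (\<lambda>x. r * e x) (\<lambda>x. r * u x) (\<lambda>x. r * v x)"
proof (rule second_orderI)
  show "c \<le> d" using second_orderD(1)[OF assms] .
  show "(\<lambda>x. r * e x) absolutely_integrable_on {c..d}"
    using absolutely_integrable_mult_continuous[OF second_orderD(2)[OF assms] continuous_on_const[of _ r]]
    by (simp add: mult.commute)
  fix x assume x: "x \<in> {c..d}"
  show "((\<lambda>x. r * u x) has_real_derivative r * v x) (at x within {c..d})"
    using DERIV_cmult[OF second_orderD(4)[OF assms x], of r] .
  show "r * v x = r * v c - integral {c..x} (\<lambda>x. r * e x)"
    using second_orderD(5)[OF assms x] by (simp add: right_diff_distrib)
qed

lemma second_order_no_double_zero:
  assumes so: "second_order c d e u v"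
    and k: "k absolutely_integrable_on {c..d}" "\<And>x. x \<in> {c..d} \<Longrightarrow> k x \<ge> 0"
    and e: "\<And>x. x \<in> {c..d} \<Longrightarrow> \<bar>e x\<bar> \<le> k x * \<bar>u x\<bar>"
    and x: "x \<in> {c..d}" "u x = 0" "v x = 0" and y: "y \<in> {c..d}"
  shows "u y = 0" "v y = 0"
proof -
  have "\<bar>u y\<bar> + \<bar>v y\<bar> \<le> 0" using second_order_growth_between[OF so k e y x(1)] x by simp
  then show "u y = 0" "v y = 0" by auto
qed

text \<open>
The parabola that minorizes all nonnegative concave functions with maximum 1. Its second derivative is constant,
so it also serves as an explicit test function.
\<close>
definition tent :: "real \<Rightarrow> real \<Rightarrow> real \<Rightarrow> real" where
  "tent c d x = (x - c) * (d - x) / (d - c)\<^sup>2"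

lemma continuous_on_tent: "c < d \<Longrightarrow> continuous_on S (tent c d)"
  unfolding tent_def by (intro continuous_intros) auto

lemma integral_weight_positive:
  fixes w h :: "real \<Rightarrow> real"
  assumes w: "w absolutely_integrable_on {c..d}" "\<And>x. x \<in> {c..d} \<Longrightarrow> w x \<ge> 0" "not_ae_zero_on w {c..d}"
    and h: "continuous_on {c..d} h" "\<And>x. x \<in> {c..d} \<Longrightarrow> h x \<ge> 0" "\<And>x. x \<in> {c<..<d} \<Longrightarrow> h x > 0"
  shows "integral {c..d} (\<lambda>x. w x * h x) > 0"
proof (rule ccontr)
  assume n: "\<not> ?thesis"
  have ai: "(\<lambda>x. w x * h x) absolutely_integrable_on {c..d}"
    by (rule absolutely_integrable_mult_continuous[OF w(1) h(1)])
  then have i: "(\<lambda>x. w x * h x) integrable_on {c..d}" by (simp add: absolutely_integrable_on_def)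
  have nn: "w x * h x \<ge> 0" if "x \<in> {c..d}" for x using w(2) h(2) that by simp
  have "integral {c..d} (\<lambda>x. w x * h x) = 0"
    using n integral_nonneg[OF i nn] by linarith
  moreover have iL: "integrable (lebesgue_on {c..d}) (\<lambda>x. w x * h x)"
    using absolutely_integrable_imp_integrable[OF ai] by simp
  ultimately have "integral\<^sup>L (lebesgue_on {c..d}) (\<lambda>x. w x * h x) = 0"
    using lebesgue_integral_eq_integral[OF iL] by simp
  then have "AE x in lebesgue_on {c..d}. w x * h x = 0"
  proof (subst integral_nonneg_eq_0_iff_AE[OF iL, symmetric])
    show "AE x in lebesgue_on {c..d}. 0 \<le> w x * h x" by (rule AE_I2) (use nn in simp)
  qed
  then obtain E where E: "negligible E" "\<forall>x\<in>{c..d} - E. w x * h x = 0"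
    unfolding AE_lebesgue_on_iff_negligible[OF fmeasurableD[OF lmeasurable_interval(1)]] by blast
  have "w x = 0" if "x \<in> {c..d} - (E \<union> {c, d})" for x
    using that h(3)[of x] E(2) by force
  then have "AE x in lebesgue_on {c..d}. w x = 0"
    unfolding AE_lebesgue_on_iff_negligible[OF fmeasurableD[OF lmeasurable_interval(1)]]
    using E(1) by (intro exI[of _ "E \<union> {c, d}"]) simp
  then show False using w(3) by (simp add: not_ae_zero_on_def)
qed

lemma not_ae_zero_on_nondegenerate:
  assumes "not_ae_zero_on w {c..d}"
  shows "c < d"
proof (rule ccontr)
  assume "\<not> c < d"
  then have "negligible {c..d}" by (intro negligible_atLeastAtMostI) simp
  then have "AE x in lebesgue_on {c..d}. w x = 0"
    unfolding AE_lebesgue_on_iff_negligible[OF fmeasurableD[OF lmeasurable_interval(1)]] by blast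
  then show False using assms by (simp add: not_ae_zero_on_def)
qed

lemma second_order_tent:
  assumes "c < d"
  shows "second_order c d (\<lambda>x. 2 / (d - c)\<^sup>2) (tent c d) (\<lambda>x. (c + d - 2 * x) / (d - c)\<^sup>2)"
proof (rule second_orderI)
  show "c \<le> d" using assms by simp
  show "(\<lambda>x. 2 / (d - c)\<^sup>2) absolutely_integrable_on {c..d}"
    by (intro absolutely_integrable_continuous_real continuous_intros)
  fix x assume x: "x \<in> {c..d}"
  show "(tent c d has_real_derivative (c + d - 2 * x) / (d - c)\<^sup>2) (at x within {c..d})"
    unfolding tent_def using assms
    by (auto intro!: derivative_eq_intros simp: field_simps)
  show "(c + d - 2 * x) / (d - c)\<^sup>2 = (c + d - 2 * c) / (d - c)\<^sup>2 - integral {c..x} (\<lambda>x. 2 / (d - c)\<^sup>2)"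
    using x assms by (simp add: diff_divide_distrib[symmetric])
qed

text \<open>
Shooting with the eigenvalue parameter, at fixed initial slope 1. At parameter 0 the solution is \<open>x - c\<close>. A
solution that stays positive is concave, and testing the equation against the parabola \<open>tent c d\<close> bounds its
parameter by \<open>2 / ((d - c) * integral {c..d} (\<lambda>x. w x * (tent c d x)\<^sup>2))\<close>. An eigenfunction for a smaller parameter
\<open>\<mu>\<close> would be a multiple of the solution \<open>U \<mu>\<close>, which does not vanish at \<open>d\<close>.
\<close>
theorem first_eigenvalue_properties:
  assumes w: "w absolutely_integrable_on {c..d}" "\<And>x. x \<in> {c..d} \<Longrightarrow> w x \<ge> 0" "not_ae_zero_on w {c..d}"
  shows "first_eigenvalue w c d > 0"
    and "\<exists>\<phi> \<psi>. second_order c d (\<lambda>x. first_eigenvalue w c d * w x * \<phi> x) \<phi> \<psi> \<and> \<phi> c = 0 \<and> \<phi> d = 0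
       \<and> (\<forall>x\<in>{c<..<d}. \<phi> x > 0)"
    and "\<And>\<kappa>. 0 \<le> \<kappa> \<Longrightarrow> \<kappa> < first_eigenvalue w c d \<Longrightarrow>
       \<exists>\<phi> \<psi>. second_order c d (\<lambda>x. \<kappa> * w x * \<phi> x) \<phi> \<psi> \<and> \<phi> c = 0 \<and> (\<forall>x\<in>{c<..d}. \<phi> x > 0)"
proof -
  have cd: "c < d" using not_ae_zero_on_nondegenerate[OF w(3)] .
  then have cd': "c \<le> d" by simp
  have wI: "w integrable_on {c..d}" using w(1) by (simp add: absolutely_integrable_on_def)
  have \<mu>w: "(\<lambda>x. \<mu> * w x) absolutely_integrable_on {c..d}" for \<mu>
    using absolutely_integrable_mult_continuous[OF w(1) continuous_on_const[of _ \<mu>]] by (simp add: mult.commute)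
  have "\<exists>u v. second_order c d (\<lambda>x. \<mu> * w x * u x) u v \<and> u c = 0 \<and> v c = 1" for \<mu>
    using initial_value_problem[OF cd' \<mu>w[of \<mu>], of "\<lambda>s. s" 1 1] by (metis order_refl mult_1)
  then obtain U V where UV: "\<And>\<mu>. second_order c d (\<lambda>x. \<mu> * w x * U \<mu> x) (U \<mu>) (V \<mu>)"
    "\<And>\<mu>. U \<mu> c = 0" "\<And>\<mu>. V \<mu> c = 1" by metis
  define W where "W = integral {c..d} w"
  have W: "W \<ge> 0" unfolding W_def using wI w(2) by (intro integral_nonneg)
  define G where "G \<mu> = 2 * exp (2 * (d - c + \<mu> * W))" for \<mu>
  have kI: "integral {c..d} (\<lambda>x. \<mu> * w x) = \<mu> * W" for \<mu> by (simp add: W_def)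
  have bound: "\<bar>U \<mu> x\<bar> + \<bar>V \<mu> x\<bar> \<le> G \<mu>" if "\<mu> \<ge> 0" "x \<in> {c..d}" for \<mu> x
  proof -
    have "\<bar>U \<mu> x\<bar> + \<bar>V \<mu> x\<bar> \<le> 2 * exp (2 * (d - c + integral {c..d} (\<lambda>x. \<mu> * w x))) * (\<bar>U \<mu> c\<bar> + \<bar>V \<mu> c\<bar>)"
      using w(2) that cd by (intro second_order_growth_between[OF UV(1) \<mu>w]) (auto simp: abs_mult)
    then show ?thesis using UV(2,3) by (simp add: G_def W_def)
  qed
  \<comment> \<open>changing \<open>\<mu>\<close> from \<open>q\<close> to \<open>p\<close> adds the inhomogeneity \<open>(p - q) w (U q)\<close> to the equation\<close>
  have lip: "\<bar>U p x - U q x\<bar> + \<bar>V p x - V q x\<bar> \<le> G P * G P * W * \<bar>p - q\<bar>"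
    if p: "p \<in> {0..P}" and q: "q \<in> {0..P}" and x: "x \<in> {c..d}" for p q P x
  proof -
    have GP: "G q \<le> G P" "G p \<le> G P" "G P \<ge> 0"
      using p q W by (auto simp: G_def intro!: mult_right_mono)
    have so: "second_order c d (\<lambda>x. p * w x * U p x - q * w x * U q x) (\<lambda>x. U p x - U q x) (\<lambda>x. V p x - V q x)"
      by (rule second_order_diff[OF UV(1) UV(1)])
    have "\<bar>U p x - U q x\<bar> + \<bar>V p x - V q x\<bar> \<le> 2 * (\<bar>U p c - U q c\<bar> + \<bar>V p c - V q c\<bar>
         + integral {c..d} (\<lambda>x. (\<bar>p - q\<bar> * G P) * w x)) * exp (2 * (d - c + integral {c..d} (\<lambda>x. p * w x)))"
    proof (rule second_order_growth[OF so \<mu>w _ \<mu>w _ _ x])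
      fix x assume x: "x \<in> {c..d}"
      show "p * w x \<ge> 0" "\<bar>p - q\<bar> * G P * w x \<ge> 0" using p w(2)[OF x] GP by auto
      have "\<bar>U q x\<bar> \<le> G P" using bound[of q x] q x GP by auto
      then have "\<bar>p - q\<bar> * w x * \<bar>U q x\<bar> \<le> \<bar>p - q\<bar> * w x * G P"
        using w(2)[OF x] by (intro mult_left_mono) auto
      moreover have "p * w x * U p x - q * w x * U q x = p * w x * (U p x - U q x) + (p - q) * w x * U q x"
        by (simp add: algebra_simps)
      moreover have "\<bar>p * w x * (U p x - U q x)\<bar> = p * w x * \<bar>U p x - U q x\<bar>"
        "\<bar>(p - q) * w x * U q x\<bar> = \<bar>p - q\<bar> * w x * \<bar>U q x\<bar>"
        using w(2)[OF x] p by (simp_all add: abs_mult)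
      ultimately show "\<bar>p * w x * U p x - q * w x * U q x\<bar> \<le> p * w x * \<bar>U p x - U q x\<bar> + \<bar>p - q\<bar> * G P * w x"
        by (smt (verit) mult.assoc mult.commute)
    qed
    also have "\<dots> = (\<bar>p - q\<bar> * G P * W) * G p"
      using UV(2,3) by (simp add: kI G_def W_def)
    also have "\<dots> \<le> (\<bar>p - q\<bar> * G P * W) * G P" using GP W by (intro mult_left_mono) auto
    finally show ?thesis by (simp add: mult_ac)
  qed
  \<comment> \<open>just above the bound that the test function \<open>tent c d\<close> imposes\<close>
  define P where "P = 2 / (d - c) / integral {c..d} (\<lambda>x. w x * (tent c d x)\<^sup>2) + 1"
  have J: "integral {c..d} (\<lambda>x. w x * (tent c d x)\<^sup>2) > 0"
    using cd by (intro integral_weight_positive w continuous_intros continuous_on_tent) (auto simp: tent_def)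
  have P: "P > 0" using J cd by (simp add: P_def add_pos_pos)
  have stop: "\<exists>x\<in>{c<..d}. U P x \<le> 0"
  proof (rule ccontr)
    assume "\<not> ?thesis"
    then have pos: "U P x > 0" if "x \<in> {c<..d}" for x using that by force
    then have nn: "U P x \<ge> 0" if "x \<in> {c..d}" for x using that UV(2)[of P] by (cases "x = c") (auto intro: less_imp_le)
    obtain x0 where x0: "x0 \<in> {c..d}" "\<And>y. y \<in> {c..d} \<Longrightarrow> U P y \<le> U P x0"
      using continuous_attains_sup[OF _ _ second_order_continuous(1)[OF UV(1)[of P]]] cd by force
    define M where "M = U P x0"
    have M: "M > 0" using pos[of d] x0(2)[of d] cd by (simp add: M_def)
    have dec: "V P y - V P x \<le> 0" if "c \<le> x" "x \<le> y" "y \<le> d" for x y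
    proof -
      have "integral {x..y} (\<lambda>x. P * w x * U P x) \<ge> 0"
        using second_orderD(3)[OF second_order_subinterval[OF UV(1)[of P] that]] that P w(2) nn
        by (intro integral_nonneg) auto
      then show ?thesis using second_order_increment[OF UV(1)[of P] that] by simp
    qed
    have tb: "M * tent c d x \<le> U P x" if "x \<in> {c..d}" for x
      using nearly_concave_above_tent[OF UV(1)[of P] nn _ dec that x0(1) cd] by (simp add: M_def tent_def)
    have tent0: "tent c d c = 0" "tent c d d = 0" by (simp_all add: tent_def)
    have vd: "(c + d - 2 * d) / (d - c)\<^sup>2 \<le> 0" using cd by (intro divide_nonpos_nonneg) auto
    have upper: "((\<lambda>t. P * w t * U P t * tent c d t - U P t * (2 / (d - c)\<^sup>2)) has_integral
       U P d * ((c + d - 2 * d) / (d - c)\<^sup>2)) {c..d}"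
      using green_identity[OF UV(1)[of P] second_order_tent[OF cd]] UV(2)[of P] tent0 by simp
    have lower: "((\<lambda>t. (P * M) * (w t * (tent c d t)\<^sup>2) - M * (2 / (d - c)\<^sup>2)) has_integral
       (P * M) * integral {c..d} (\<lambda>x. w x * (tent c d x)\<^sup>2) - (d - c) * (M * (2 / (d - c)\<^sup>2))) {c..d}"
    proof (intro has_integral_diff has_integral_mult_right integrable_integral)
      show "(\<lambda>x. w x * (tent c d x)\<^sup>2) integrable_on {c..d}"
        using absolutely_integrable_mult_continuous[OF w(1), of "\<lambda>x. (tent c d x)\<^sup>2"] cd
        by (auto simp: absolutely_integrable_on_def intro!: continuous_intros continuous_on_tent)
      show "((\<lambda>x. M * (2 / (d - c)\<^sup>2)) has_integral (d - c) * (M * (2 / (d - c)\<^sup>2))) {c..d}"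
        using has_integral_const_real[of "M * (2 / (d - c)\<^sup>2)" c d] cd by simp
    qed
    have "(P * M) * integral {c..d} (\<lambda>x. w x * (tent c d x)\<^sup>2) - (d - c) * (M * (2 / (d - c)\<^sup>2))
        \<le> U P d * ((c + d - 2 * d) / (d - c)\<^sup>2)"
    proof (rule has_integral_le[OF lower upper])
      fix t assume t: "t \<in> {c..d}"
      have tp: "tent c d t \<ge> 0" using t by (simp add: tent_def)
      have "(P * w t * tent c d t) * (M * tent c d t) \<le> (P * w t * tent c d t) * U P t"
        using tb[OF t] P w(2)[OF t] tp by (intro mult_left_mono) auto
      moreover have "U P t * (2 / (d - c)\<^sup>2) \<le> M * (2 / (d - c)\<^sup>2)"
        using x0(2)[OF t] by (intro mult_right_mono) (auto simp: M_def)
      ultimately show "(P * M) * (w t * (tent c d t)\<^sup>2) - M * (2 / (d - c)\<^sup>2)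
         \<le> P * w t * U P t * tent c d t - U P t * (2 / (d - c)\<^sup>2)"
        by (simp add: power2_eq_square mult_ac)
    qed
    also have "\<dots> \<le> 0" using nn[of d] vd cd by (intro mult_nonneg_nonpos) auto
    finally have *: "(P * M) * integral {c..d} (\<lambda>x. w x * (tent c d x)\<^sup>2) - (d - c) * (M * (2 / (d - c)\<^sup>2)) \<le> 0" .
    have "M * (P * integral {c..d} (\<lambda>x. w x * (tent c d x)\<^sup>2)) \<le> M * (2 / (d - c))"
    proof -
      have "(d - c) * (M * (2 / (d - c)\<^sup>2)) = M * (2 / (d - c))" using cd by (simp add: power2_eq_square)
      then show ?thesis using * by (simp add: mult_ac)
    qed
    then have "P * integral {c..d} (\<lambda>x. w x * (tent c d x)\<^sup>2) \<le> 2 / (d - c)" using M by (simp only: mult_le_cancel_left_pos)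
    then have "P \<le> 2 / (d - c) / integral {c..d} (\<lambda>x. w x * (tent c d x)\<^sup>2)" by (subst pos_le_divide_eq[OF J])
    then show False by (simp add: P_def)
  qed
  have start: "U 0 x > 0" if x: "x \<in> {c<..d}" for x
  proof -
    obtain z where z: "c < z" "z < x" "U 0 x - U 0 c = V 0 z * (x - c)"
      using second_order_mean_value[OF UV(1)[of 0], of c x] x by auto
    have "V 0 z = V 0 c" using second_orderD(5)[OF UV(1)[of 0], of z] z x by simp
    then show ?thesis using z x UV(2,3) by simp
  qed
  have slope: "V p c > 0" for p using UV(3) by simp
  have simple: "V p x \<noteq> 0" if p: "p \<in> {0..P}" and x: "x \<in> {c<..<d}" "U p x = 0" for p x
  proof
    assume vx: "V p x = 0"
    have "V p c = 0"
    proof (rule second_order_no_double_zero(2)[OF UV(1) \<mu>w[of p], where x=x])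
      fix t assume t: "t \<in> {c..d}"
      show "p * w t \<ge> 0" using p w(2)[OF t] by simp
      then show "\<bar>p * w t * U p t\<bar> \<le> p * w t * \<bar>U p t\<bar>" using p w(2)[OF t] by (simp add: abs_mult)
    qed (use x cd vx in auto)
    then show False using UV(3)[of p] by simp
  qed
  obtain \<nu> where \<nu>: "0 < \<nu>" "\<nu> \<le> P" "\<And>x. x \<in> {c<..<d} \<Longrightarrow> U \<nu> x > 0" "U \<nu> d = 0"
    "\<And>q x. 0 \<le> q \<Longrightarrow> q < \<nu> \<Longrightarrow> x \<in> {c<..d} \<Longrightarrow> U q x > 0"
    by (rule shooting[where U=U and V=V and ?p0.0=0 and ?p1.0=P and B="G P * G P * W"
          and e="\<lambda>\<mu> x. \<mu> * w x * U \<mu> x" and c=c and d=d],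
        rule cd, rule UV(1), rule UV(2), rule slope, rule lip, assumption+, rule simple, assumption+,
        rule less_imp_le[OF P], rule start, assumption, rule stop, rule that; blast)
  have ev: "dirichlet_eigenvalue w c d \<nu>"
  proof -
    have "dirichlet_solution (\<lambda>x s. \<nu> * w x * s) c d (U \<nu>)"
      using UV(1)[of \<nu>] UV(2)[of \<nu>] \<nu>(4) by (intro dirichlet_solution_if_second_order)
    moreover have "(c + d) / 2 \<in> {c..d}" "U \<nu> ((c + d) / 2) \<noteq> 0" using \<nu>(3)[of "(c + d) / 2"] cd by auto
    ultimately show ?thesis unfolding dirichlet_eigenvalue_def by blast
  qed
  have least: "\<nu> \<le> \<mu>" if \<mu>: "\<mu> > 0" "dirichlet_eigenvalue w c d \<mu>" for \<mu>
  proof (rule ccontr)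
    assume "\<not> \<nu> \<le> \<mu>"
    then have pos: "U \<mu> d > 0" using \<nu>(5)[of \<mu> d] \<mu> cd by auto
    obtain \<phi> z where \<phi>: "dirichlet_solution (\<lambda>x s. \<mu> * w x * s) c d \<phi>" "z \<in> {c..d}" "\<phi> z \<noteq> 0"
      using \<mu>(2) unfolding dirichlet_eigenvalue_def by blast
    have z0: "\<phi> c = 0" "\<phi> d = 0" using \<phi>(1) by (auto simp: dirichlet_solution_def)
    obtain \<psi> where \<psi>: "second_order c d (\<lambda>x. \<mu> * w x * \<phi> x) \<phi> \<psi>"
      by (rule second_order_if_dirichlet_solution[OF \<phi>(1) cd'])
        (auto intro: absolutely_integrable_mult_continuous[OF \<mu>w])
    define r where "r = \<psi> c"
    have so: "second_order c d (\<lambda>x. \<mu> * w x * \<phi> x - r * (\<mu> * w x * U \<mu> x)) (\<lambda>x. \<phi> x - r * U \<mu> x) (\<lambda>x. \<psi> x - r * V \<mu> x)"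
      by (rule second_order_diff[OF \<psi> second_order_cmult[OF UV(1)]])
    have id: "\<phi> x - r * U \<mu> x = 0" if x: "x \<in> {c..d}" for x
    proof (rule second_order_no_double_zero(1)[OF so \<mu>w[of \<mu>] _ _ _ _ _ x, of c])
      fix t assume t: "t \<in> {c..d}"
      show "\<mu> * w t \<ge> 0" using \<mu> w(2)[OF t] by simp
      have "\<mu> * w t * \<phi> t - r * (\<mu> * w t * U \<mu> t) = \<mu> * w t * (\<phi> t - r * U \<mu> t)" by (simp add: algebra_simps)
      then show "\<bar>\<mu> * w t * \<phi> t - r * (\<mu> * w t * U \<mu> t)\<bar> \<le> \<mu> * w t * \<bar>\<phi> t - r * U \<mu> t\<bar>"
        using \<mu> w(2)[OF t] by (simp add: abs_mult)
    qed (use cd z0 UV in \<open>auto simp: r_def\<close>)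
    have "r = 0" using id[of d] z0 pos cd by auto
    then show False using id[OF \<phi>(2)] \<phi>(3) by simp
  qed
  have fe: "first_eigenvalue w c d = \<nu>"
    unfolding first_eigenvalue_def by (rule Least_equality) (use \<nu>(1) ev least in auto)
  show "first_eigenvalue w c d > 0" using fe \<nu>(1) by simp
  show "\<exists>\<phi> \<psi>. second_order c d (\<lambda>x. first_eigenvalue w c d * w x * \<phi> x) \<phi> \<psi> \<and> \<phi> c = 0 \<and> \<phi> d = 0
       \<and> (\<forall>x\<in>{c<..<d}. \<phi> x > 0)"
    unfolding fe using UV(1)[of \<nu>] UV(2)[of \<nu>] \<nu>(3,4) by blast
  show "\<exists>\<phi> \<psi>. second_order c d (\<lambda>x. \<kappa> * w x * \<phi> x) \<phi> \<psi> \<and> \<phi> c = 0 \<and> (\<forall>x\<in>{c<..d}. \<phi> x > 0)"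
    if "0 \<le> \<kappa>" "\<kappa> < first_eigenvalue w c d" for \<kappa>
    using UV(1)[of \<kappa>] UV(2)[of \<kappa>] \<nu>(5)[of \<kappa>] that unfolding fe by blast
qed

section \<open>Lipschitz nonlinearities\<close>

lemma second_order_spike:
  assumes so: "second_order c d e u v" and E: "negligible E"
    and eq: "\<And>x. x \<in> {c..d} - E \<Longrightarrow> e' x = e x"
  shows "second_order c d e' u v"
proof (rule second_orderI)
  note D = second_orderD[OF so]
  show "c \<le> d" by (rule D(1))
  show "e' absolutely_integrable_on {c..d}" by (rule absolutely_integrable_spike[OF D(2) E eq])
  fix x assume x: "x \<in> {c..d}"
  show "(u has_real_derivative v x) (at x within {c..d})" by (rule D(4)[OF x])
  have "integral {c..x} e' = integral {c..x} e"
    by (rule integral_spike[OF E]) (use eq x in auto)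
  then show "v x = v c - integral {c..x} e'" using D(5)[OF x] by simp
qed

lemma slope_at_left_zero:
  assumes so: "second_order c d e u v" and "c < d" "u c = 0" "\<And>x. x \<in> {c..d} \<Longrightarrow> u x \<ge> 0"
  shows "v c \<ge> 0"
proof (rule ccontr)
  assume "\<not> v c \<ge> 0"
  moreover have "(u has_real_derivative v c) (at c within {c..d})" using second_orderD(4)[OF so, of c] assms(2) by simp
  ultimately obtain r where r: "r > 0" "\<And>h. h > 0 \<Longrightarrow> c + h \<in> {c..d} \<Longrightarrow> h < r \<Longrightarrow> u c > u (c + h)"
    using has_real_derivative_neg_dec_right[of u "v c" c "{c..d}"] by force
  define h where "h = min (r / 2) (d - c)"
  have "h > 0" "c + h \<in> {c..d}" "h < r" using r(1) assms(2) by (auto simp: h_def)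
  with r(2)[of h] assms(3) assms(4)[of "c + h"] show False by simp
qed

lemma slope_at_right_zero:
  assumes so: "second_order c d e u v" and "c < d" "u d = 0" "\<And>x. x \<in> {c..d} \<Longrightarrow> u x \<ge> 0"
  shows "v d \<le> 0"
proof -
  have "- v (- (- d)) \<ge> 0"
    by (rule slope_at_left_zero[OF second_order_reflect[OF so]]) (use assms in auto)
  then show ?thesis by simp
qed

text \<open>
The positive slope keeps \<open>u\<close> positive on some \<open>]c, c + r[\<close>, so the first point with \<open>u \<le> 0\<close> is the infimum of a
closed set that stays away from \<open>c\<close>.
\<close>
lemma first_zero:
  assumes so: "second_order c d e u v" and "u c = 0" "v c > 0" and neg: "\<exists>x\<in>{c<..d}. u x \<le> 0"
  obtains z where "z \<in> {c<..d}" "u z = 0" "\<And>x. x \<in> {c<..<z} \<Longrightarrow> u x > 0"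
proof -
  obtain y where y: "y \<in> {c<..d}" "u y \<le> 0" using neg by blast
  have cd: "c < d" using y by auto
  have "(u has_real_derivative v c) (at c within {c..d})" using second_orderD(4)[OF so, of c] cd by simp
  then obtain r where r: "r > 0" "\<And>h. h > 0 \<Longrightarrow> c + h \<in> {c..d} \<Longrightarrow> h < r \<Longrightarrow> u c < u (c + h)"
    using has_real_derivative_pos_inc_right[of u "v c" c "{c..d}"] assms(3) by force
  have near: "u x > 0" if "x \<in> {c<..d}" "x < c + r" for x
    using r(2)[of "x - c"] that assms(2) by auto
  define S where "S = {x \<in> {c + r..d}. u x \<le> 0}"
  have "closed S"
    unfolding S_def
    by (intro continuous_on_closed_Collect_le continuous_on_const closed_atLeastAtMost
        continuous_on_subset[OF second_order_continuous(1)[OF so]]) (use r(1) in auto)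
  moreover have yS: "y \<in> S" using near[of y] y by (force simp: S_def)
  moreover have bdd: "bdd_below S" by (auto simp: S_def)
  ultimately have zS: "Inf S \<in> S" using closed_contains_Inf by blast
  define z where "z = Inf S"
  have z: "z \<in> {c<..d}" "u z \<le> 0" using zS r(1) by (auto simp: S_def z_def)
  have pos: "u x > 0" if x: "x \<in> {c<..<z}" for x
  proof (rule ccontr)
    assume "\<not> u x > 0"
    then have "x \<in> S" using near[of x] x z by (force simp: S_def)
    then show False using cInf_lower[OF _ bdd, of x] x by (auto simp: z_def)
  qed
  have "u z = 0"
  proof (rule ccontr)
    assume "u z \<noteq> 0"
    then have n: "u z < 0" using z by simp
    \<comment> \<open>a point where \<open>u\<close> is positive, to apply the intermediate value theorem up to \<open>z\<close>\<close>
    define b where "b = min (c + r / 2) ((c + z) / 2)"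
    have b: "c < b" "b < z" "b < c + r" using r(1) z by (auto simp: b_def min_less_iff_disj)
    have "continuous_on {b..z} u" by (rule continuous_on_subset[OF second_order_continuous(1)[OF so]]) (use b z in auto)
    then obtain x where x: "b \<le> x" "x \<le> z" "u x = 0"
      using IVT2'[of u z 0 b] n pos[of b] b by force
    then show False using pos[of x] n b by (cases "x = z") auto
  qed
  with z pos show thesis using that by blast
qed

text \<open>
Sturm comparison: up to a first zero \<open>z\<close> of \<open>u\<close> the Wronskian of \<open>u\<close> and \<open>\<phi>\<close> is nonincreasing and starts at 0,
whereas its value \<open>- v z * \<phi> z\<close> at \<open>z\<close> is nonnegative. Hence \<open>v z = 0\<close>, and a double zero contradicts the
positive initial slope.
\<close>
lemma small_solution_positive:
  assumes L: "L > 0" and so: "second_order 0 L (\<lambda>x. a x * f (u x)) u v" and u0: "u 0 = 0" "v 0 > 0"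
    and a: "a absolutely_integrable_on {0..L}" and f: "\<And>s. \<bar>f s\<bar> \<le> K * \<bar>s\<bar>" and K: "K \<ge> 0"
    and cmp: "\<And>x s. x \<in> {0..L} \<Longrightarrow> s \<in> {0..\<delta>} \<Longrightarrow> a x * f s \<le> \<kappa> * w x * s"
    and \<phi>: "second_order 0 L (\<lambda>x. \<kappa> * w x * \<phi> x) \<phi> \<psi>" "\<phi> 0 = 0" "\<And>x. x \<in> {0<..L} \<Longrightarrow> \<phi> x > 0"
    and small: "\<And>x. x \<in> {0..L} \<Longrightarrow> u x \<le> \<delta>" and x: "x \<in> {0<..L}"
  shows "u x > 0"
proof (rule ccontr)
  assume "\<not> u x > 0"
  then have "\<exists>x\<in>{0<..L}. u x \<le> 0" using x by force
  then obtain z where z: "z \<in> {0<..L}" "u z = 0" "\<And>x. x \<in> {0<..<z} \<Longrightarrow> u x > 0"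
    using first_zero[OF so u0] by blast
  have nn: "u t \<ge> 0" if "t \<in> {0..z}" for t
    using z(2) z(3)[of t] u0 that by (cases "t = 0 \<or> t = z") (auto intro: less_imp_le)
  have phi_nn: "\<phi> t \<ge> 0" if "t \<in> {0..L}" for t
    using \<phi>(2) \<phi>(3)[of t] that by (cases "t = 0") (auto intro: less_imp_le)
  have so': "second_order 0 z (\<lambda>x. a x * f (u x)) u v" "second_order 0 z (\<lambda>x. \<kappa> * w x * \<phi> x) \<phi> \<psi>"
    using second_order_subinterval[OF so] second_order_subinterval[OF \<phi>(1)] z by auto
  have "((\<lambda>t. a t * f (u t) * \<phi> t - u t * (\<kappa> * w t * \<phi> t)) has_integral - v z * \<phi> z) {0..z}"
    using green_identity[OF so'] u0 \<phi>(2) z(2) by simp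
  moreover have "((\<lambda>t. 0) has_integral (0::real)) {0..z}" by simp
  ultimately have "- v z * \<phi> z \<le> 0"
  proof (rule has_integral_le)
    fix t assume t: "t \<in> {0..z}"
    then have "t \<in> {0..L}" using z by auto
    then have "a t * f (u t) * \<phi> t \<le> \<kappa> * w t * u t * \<phi> t"
      using cmp[of t "u t"] small[of t] nn[OF t] phi_nn[of t] by (intro mult_right_mono) auto
    then show "a t * f (u t) * \<phi> t - u t * (\<kappa> * w t * \<phi> t) \<le> 0" by (simp add: mult_ac)
  qed
  then have "v z \<ge> 0" using \<phi>(3)[of z] z(1) by (simp add: zero_le_mult_iff)
  moreover have "v z \<le> 0" using slope_at_right_zero[OF so'(1) _ z(2) nn] z(1) by auto
  ultimately have vz: "v z = 0" by simp
  have k: "(\<lambda>x. K * \<bar>a x\<bar>) absolutely_integrable_on {0..L}"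
    using absolutely_integrable_mult_continuous[OF set_integrable_abs[OF a] continuous_on_const[of _ K]]
    by (simp add: mult.commute)
  have "v 0 = 0"
  proof (rule second_order_no_double_zero(2)[OF so k])
    fix t
    have "\<bar>a t\<bar> * \<bar>f (u t)\<bar> \<le> \<bar>a t\<bar> * (K * \<bar>u t\<bar>)" using f by (intro mult_left_mono) auto
    then show "\<bar>a t * f (u t)\<bar> \<le> K * \<bar>a t\<bar> * \<bar>u t\<bar>" by (simp add: abs_mult mult_ac)
  qed (use K z vz L in auto)
  then show False using u0 by simp
qed

text \<open>
Green's identity with the first eigenfunction \<open>\<phi>\<close> bounds the integral of \<open>w \<phi> (f(u) - \<nu> u)\<close> by boundary terms of
the right sign, where \<open>\<nu>\<close> is the first eigenvalue. Since \<open>f s - \<nu> s \<ge> (q - \<nu>) s - C\<close>, the integral of \<open>w \<phi> u\<close> is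
bounded. On the other hand \<open>f \<ge> - C\<close> makes \<open>u\<close> nearly concave, so that \<open>u\<close> exceeds each of its values times
\<open>tent c d\<close>, up to a constant. The bound is the same for all admissible \<open>f\<close>, which allows \<open>f\<close> to be
regularized and truncated afterwards.
\<close>
lemma bound_on_positive_interval:
  fixes a w :: "real \<Rightarrow> real"
  assumes w: "w absolutely_integrable_on {c..d}" "\<And>x. x \<in> {c..d} \<Longrightarrow> w x \<ge> 0" "not_ae_zero_on w {c..d}"
    and E: "negligible E" "\<And>x. x \<in> {c..d} - E \<Longrightarrow> a x = w x"
    and q: "q > first_eigenvalue w c d" and C: "C \<ge> 0"
  obtains M where "\<And>f u v x. second_order c d (\<lambda>x. a x * f (u x)) u v \<Longrightarrow> (\<And>x. x \<in> {c..d} \<Longrightarrow> u x \<ge> 0) \<Longrightarrow>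
      (\<And>s. s \<ge> 0 \<Longrightarrow> f s \<ge> q * s - C) \<Longrightarrow> x \<in> {c..d} \<Longrightarrow> u x \<le> M"
proof -
  define \<nu> where "\<nu> = first_eigenvalue w c d"
  have cd: "c < d" using not_ae_zero_on_nondegenerate[OF w(3)] .
  have \<nu>: "\<nu> > 0" "q > \<nu>" using first_eigenvalue_properties(1)[OF w] q by (auto simp: \<nu>_def)
  obtain \<phi> \<psi> where \<phi>: "second_order c d (\<lambda>x. \<nu> * w x * \<phi> x) \<phi> \<psi>" "\<phi> c = 0" "\<phi> d = 0"
    "\<And>x. x \<in> {c<..<d} \<Longrightarrow> \<phi> x > 0"
    using first_eigenvalue_properties(2)[OF w] unfolding \<nu>_def by blast
  have phi_nn: "\<phi> t \<ge> 0" if "t \<in> {c..d}" for t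
    using \<phi>(2,3) \<phi>(4)[of t] that by (cases "t = c \<or> t = d") (auto intro: less_imp_le)
  note phc = second_order_continuous(1)[OF \<phi>(1)]
  have slopes: "\<psi> c \<ge> 0" "\<psi> d \<le> 0"
    using slope_at_left_zero[OF \<phi>(1) cd \<phi>(2) phi_nn] slope_at_right_zero[OF \<phi>(1) cd \<phi>(3) phi_nn] by auto
  define I0 where "I0 = integral {c..d} (\<lambda>x. w x * \<phi> x)"
  define I1 where "I1 = integral {c..d} (\<lambda>x. w x * (\<phi> x * tent c d x))"
  define W where "W = integral {c..d} w"
  define B where "B = 2 * (C * W) * (d - c)"
  have wI: "w integrable_on {c..d}" using w(1) by (simp add: absolutely_integrable_on_def)
  have W: "W \<ge> 0" unfolding W_def using wI w(2) by (intro integral_nonneg)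
  have i0: "(\<lambda>x. w x * \<phi> x) integrable_on {c..d}"
    using absolutely_integrable_mult_continuous[OF w(1) phc] by (simp add: absolutely_integrable_on_def)
  have i1: "(\<lambda>x. w x * (\<phi> x * tent c d x)) integrable_on {c..d}"
    using absolutely_integrable_mult_continuous[OF w(1) continuous_on_mult[OF phc continuous_on_tent[OF cd]]]
    by (simp add: absolutely_integrable_on_def)
  have I1: "I1 > 0" unfolding I1_def
    using phi_nn \<phi>(4) by (intro integral_weight_positive w continuous_on_mult phc continuous_on_tent cd) (auto simp: tent_def)
  define M where "M = ((q - \<nu>) * B + C) * I0 / ((q - \<nu>) * I1)"
  have "u y \<le> M"
    if so0: "second_order c d (\<lambda>x. a x * f (u x)) u v" and u: "\<And>x. x \<in> {c..d} \<Longrightarrow> u x \<ge> 0"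
      and f: "\<And>s. s \<ge> 0 \<Longrightarrow> f s \<ge> q * s - C" and y: "y \<in> {c..d}" for f u v y
  proof -
    have so: "second_order c d (\<lambda>x. w x * f (u x)) u v"
      by (rule second_order_spike[OF so0 E(1)]) (use E(2) in simp)
    have fC: "f s \<ge> - C" if "s \<ge> 0" for s
    proof -
      have "q * s \<ge> 0" using \<nu> that by simp
      then show ?thesis using f[OF that] by linarith
    qed
    have inc: "v t - v s \<le> C * W" if st: "c \<le> s" "s \<le> t" "t \<le> d" for s t
    proof -
      have sub: "{s..t} \<subseteq> {c..d}" using st by auto
      have "v t - v s = - integral {s..t} (\<lambda>x. w x * f (u x))" by (rule second_order_increment[OF so st])
      also have "\<dots> \<le> integral {s..t} (\<lambda>x. C * w x)"
      proof -
        have "integral {s..t} (\<lambda>x. - (w x * f (u x))) \<le> integral {s..t} (\<lambda>x. C * w x)"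
        proof (rule integral_le)
          show "(\<lambda>x. - (w x * f (u x))) integrable_on {s..t}"
            using second_orderD(3)[OF second_order_subinterval[OF so st]] by (rule integrable_neg)
          show "(\<lambda>x. C * w x) integrable_on {s..t}"
            using integrable_on_subinterval[OF wI sub] by (rule integrable_on_mult_right)
          fix x assume "x \<in> {s..t}"
          then have x: "x \<in> {c..d}" using sub by auto
          have "w x * (- f (u x)) \<le> w x * C" using fC[OF u[OF x]] w(2)[OF x] by (intro mult_left_mono) auto
          then show "- (w x * f (u x)) \<le> C * w x" by (simp add: mult.commute)
        qed
        then show ?thesis by simp
      qed
      also have "\<dots> = C * integral {s..t} w" by simp
      also have "\<dots> \<le> C * W" unfolding W_def
        using C sub wI w(2) integrable_on_subinterval[OF wI sub] by (intro mult_left_mono integral_subset_le) auto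
      finally show ?thesis .
    qed
    have tb: "u y * tent c d x - B \<le> u x" if "x \<in> {c..d}" for x
      using nearly_concave_above_tent[OF so u _ inc that y cd] C W by (simp add: tent_def B_def)
    have upper: "((\<lambda>t. w t * f (u t) * \<phi> t - u t * (\<nu> * w t * \<phi> t)) has_integral u d * \<psi> d - u c * \<psi> c) {c..d}"
      using green_identity[OF so \<phi>(1)] \<phi>(2,3) by simp
    have lower: "((\<lambda>t. ((q - \<nu>) * u y) * (w t * (\<phi> t * tent c d t)) - ((q - \<nu>) * B + C) * (w t * \<phi> t)) has_integral
        ((q - \<nu>) * u y) * I1 - ((q - \<nu>) * B + C) * I0) {c..d}"
      unfolding I0_def I1_def using i0 i1 by (intro has_integral_diff has_integral_mult_right integrable_integral)
    have "((q - \<nu>) * u y) * I1 - ((q - \<nu>) * B + C) * I0 \<le> u d * \<psi> d - u c * \<psi> c"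
    proof (rule has_integral_le[OF lower upper])
      fix t assume t: "t \<in> {c..d}"
      have "(q - \<nu>) * (u y * tent c d t - B) \<le> (q - \<nu>) * u t" using tb[OF t] \<nu> by (intro mult_left_mono) auto
      then have "(q - \<nu>) * (u y * tent c d t - B) - C \<le> f (u t) - \<nu> * u t"
        using f[OF u[OF t]] by (simp add: algebra_simps)
      then have "(w t * \<phi> t) * ((q - \<nu>) * (u y * tent c d t - B) - C) \<le> (w t * \<phi> t) * (f (u t) - \<nu> * u t)"
        using w(2)[OF t] phi_nn[OF t] by (intro mult_left_mono) auto
      then show "((q - \<nu>) * u y) * (w t * (\<phi> t * tent c d t)) - ((q - \<nu>) * B + C) * (w t * \<phi> t)
         \<le> w t * f (u t) * \<phi> t - u t * (\<nu> * w t * \<phi> t)"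
        by (simp add: algebra_simps)
    qed
    also have "\<dots> \<le> 0"
    proof -
      have "u d * \<psi> d \<le> 0" using slopes u[of d] cd by (intro mult_nonneg_nonpos) auto
      moreover have "u c * \<psi> c \<ge> 0" using slopes u[of c] cd by (intro mult_nonneg_nonneg) auto
      ultimately show ?thesis by linarith
    qed
    finally have "u y * ((q - \<nu>) * I1) \<le> ((q - \<nu>) * B + C) * I0" by (simp add: mult_ac)
    then show ?thesis unfolding M_def using \<nu> I1 by (simp add: pos_le_divide_eq)
  qed
  then show thesis using that by blast
qed

text \<open>
Shooting with the initial slope. The slope \<open>\<delta> / B\<close> keeps the solution below \<open>\<delta>\<close>, where comparison applies; a
nonnegative solution is bounded on \<open>{c..d}\<close>, together with its slope at some point, which bounds the initial
slope. The solution found exceeds \<open>\<delta>\<close> somewhere since otherwise comparison would make it positive at \<open>L\<close>.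
\<close>
theorem lipschitz_positive_solution:
  fixes a f w :: "real \<Rightarrow> real"
  assumes L: "L > 0" and a: "a absolutely_integrable_on {0..L}"
    and f: "\<And>x y. \<bar>f x - f y\<bar> \<le> K * \<bar>x - y\<bar>" "f 0 = 0"
    and \<delta>: "\<delta> > 0" and cmp: "\<And>x s. x \<in> {0..L} \<Longrightarrow> s \<in> {0..\<delta>} \<Longrightarrow> a x * f s \<le> \<kappa> * w x * s"
    and \<phi>: "second_order 0 L (\<lambda>x. \<kappa> * w x * \<phi> x) \<phi> \<psi>" "\<phi> 0 = 0" "\<And>x. x \<in> {0<..L} \<Longrightarrow> \<phi> x > 0"
    and cd: "0 \<le> c" "c < d" "d \<le> L"
    and M: "\<And>u v x. second_order 0 L (\<lambda>x. a x * f (u x)) u v \<Longrightarrow> (\<And>x. x \<in> {0..L} \<Longrightarrow> u x \<ge> 0) \<Longrightarrow>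
       x \<in> {c..d} \<Longrightarrow> u x \<le> M"
  obtains u v where "second_order 0 L (\<lambda>x. a x * f (u x)) u v" "u 0 = 0" "u L = 0"
    "\<And>x. x \<in> {0<..<L} \<Longrightarrow> u x > 0" "\<exists>x\<in>{0..L}. u x > \<delta>"
proof -
  have K: "K \<ge> 0" using order_trans[OF abs_ge_zero f(1)[of 0 1]] by simp
  have fK: "\<bar>f s\<bar> \<le> K * \<bar>s\<bar>" for s using f(1)[of s 0] f(2) by simp
  have L': "0 \<le> L" using L by simp
  have "\<exists>u v. second_order 0 L (\<lambda>x. a x * f (u x)) u v \<and> u 0 = 0 \<and> v 0 = s" for s
    using initial_value_problem[OF L' a f(1), of s] by metis
  then obtain U V where UV: "\<And>s. second_order 0 L (\<lambda>x. a x * f (U s x)) (U s) (V s)"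
    "\<And>s. U s 0 = 0" "\<And>s. V s 0 = s" by metis
  define k where "k x = K * \<bar>a x\<bar>" for x
  have k: "k absolutely_integrable_on {0..L}"
    using absolutely_integrable_mult_continuous[OF set_integrable_abs[OF a] continuous_on_const[of _ K]]
    by (simp add: mult.commute k_def[abs_def])
  have k0: "k x \<ge> 0" for x using K by (simp add: k_def)
  have ek: "\<bar>a x * f s\<bar> \<le> k x * \<bar>s\<bar>" for x s
  proof -
    have "\<bar>a x\<bar> * \<bar>f s\<bar> \<le> \<bar>a x\<bar> * (K * \<bar>s\<bar>)" using fK by (intro mult_left_mono) auto
    then show ?thesis by (simp add: abs_mult mult_ac k_def)
  qed
  define B where "B = 2 * exp (2 * (L - 0 + integral {0..L} k))"
  have B: "B > 0" by (simp add: B_def)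
  have lip: "\<bar>U p x - U q x\<bar> + \<bar>V p x - V q x\<bar> \<le> B * \<bar>p - q\<bar>" if x: "x \<in> {0..L}" for p q x
  proof -
    have "\<bar>U p x - U q x\<bar> + \<bar>V p x - V q x\<bar> \<le> B * (\<bar>U p 0 - U q 0\<bar> + \<bar>V p 0 - V q 0\<bar>)"
      unfolding B_def
    proof (rule second_order_growth_between[OF second_order_diff[OF UV(1) UV(1)] k k0 _ x])
      fix x
      have "\<bar>a x\<bar> * \<bar>f (U p x) - f (U q x)\<bar> \<le> \<bar>a x\<bar> * (K * \<bar>U p x - U q x\<bar>)"
        using f(1) by (intro mult_left_mono) auto
      then show "\<bar>a x * f (U p x) - a x * f (U q x)\<bar> \<le> k x * \<bar>U p x - U q x\<bar>"
        by (simp add: right_diff_distrib[symmetric] abs_mult mult_ac k_def)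
    qed (use L in auto)
    then show ?thesis using UV(2,3) by simp
  qed
  have size: "\<bar>U s x\<bar> + \<bar>V s x\<bar> \<le> B * (\<bar>U s y\<bar> + \<bar>V s y\<bar>)" if "x \<in> {0..L}" "y \<in> {0..L}" for s x y
    unfolding B_def using second_order_growth_between[OF UV(1) k k0 ek that] .
  define p0 where "p0 = \<delta> / B"
  have p0: "p0 > 0" using \<delta> B by (simp add: p0_def)
  have start: "U p0 x > 0" if x: "x \<in> {0<..L}" for x
  proof (rule small_solution_positive[OF L UV(1) UV(2) _ a fK K cmp \<phi> _ x])
    show "V p0 0 > 0" using UV(3) p0 by simp
    show "U p0 t \<le> \<delta>" if t: "t \<in> {0..L}" for t
    proof -
      have "\<bar>U p0 t\<bar> + \<bar>V p0 t\<bar> \<le> B * p0" using size[OF t, of 0 p0] L UV(2,3) p0 by simp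
      then show ?thesis using B by (simp add: p0_def)
    qed
  qed
  define S0 where "S0 = B * (\<bar>M\<bar> + \<bar>M\<bar> / (d - c))"
  define p1 where "p1 = max p0 (S0 + 1)"
  have stop: "\<exists>x\<in>{0<..L}. U p1 x \<le> 0"
  proof (rule ccontr)
    assume neg: "\<not> ?thesis"
    have nn: "U p1 x \<ge> 0" if x: "x \<in> {0..L}" for x
    proof (cases "x = 0")
      case False
      then have "x \<in> {0<..L}" using x by auto
      then have "\<not> U p1 x \<le> 0" using neg by blast
      then show ?thesis by simp
    qed (use UV(2) in simp)
    have ub: "U p1 x \<le> M" if "x \<in> {c..d}" for x using M[OF UV(1) nn that] .
    obtain z where z: "c < z" "z < d" "U p1 d - U p1 c = V p1 z * (d - c)"
      using second_order_mean_value[OF UV(1)[of p1] cd] by blast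
    have "\<bar>U p1 d - U p1 c\<bar> \<le> \<bar>M\<bar>" using ub[of c] ub[of d] nn[of c] nn[of d] cd by auto
    then have "\<bar>V p1 z\<bar> * (d - c) \<le> \<bar>M\<bar>" using z cd by (simp add: abs_mult)
    then have "\<bar>V p1 z\<bar> \<le> \<bar>M\<bar> / (d - c)" using cd by (simp add: pos_le_divide_eq)
    moreover have "\<bar>U p1 z\<bar> \<le> \<bar>M\<bar>" using ub[of z] nn[of z] z cd by auto
    ultimately have "B * (\<bar>U p1 z\<bar> + \<bar>V p1 z\<bar>) \<le> S0" unfolding S0_def using B by (intro mult_left_mono) auto
    then have "\<bar>V p1 0\<bar> \<le> S0" using size[of 0 z p1] z cd L by auto
    then show False using UV(3)[of p1] by (simp add: p1_def)
  qed
  have slope: "V p 0 > 0" if "p \<in> {p0..p1}" for p using that UV(3) p0 by simp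
  have simple: "V p x \<noteq> 0" if p: "p \<in> {p0..p1}" and x: "x \<in> {0<..<L}" "U p x = 0" for p x
  proof
    assume vx: "V p x = 0"
    have "V p 0 = 0"
      by (rule second_order_no_double_zero(2)[OF UV(1) k k0 ek, where x=x]) (use x vx L in auto)
    then show False using slope[OF p] by simp
  qed
  have p01: "p0 \<le> p1" by (simp add: p1_def)
  obtain p where p: "p0 < p" "p \<le> p1" "\<And>x. x \<in> {0<..<L} \<Longrightarrow> U p x > 0" "U p L = 0"
    by (rule shooting[where U=U and V=V and ?p0.0=p0 and ?p1.0=p1 and B=B
          and e="\<lambda>p x. a x * f (U p x)" and c=0 and d=L],
        rule L, rule UV(1), rule UV(2), rule slope, assumption, rule lip, assumption, rule simple, assumption+,
        rule p01, rule start, assumption, rule stop, rule that; blast)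
  have "\<exists>x\<in>{0..L}. U p x > \<delta>"
  proof (rule ccontr)
    assume neg: "\<not> ?thesis"
    have "U p L > 0"
    proof (rule small_solution_positive[OF L UV(1) UV(2) _ a fK K cmp \<phi>])
      show "V p 0 > 0" using p(1) p0 UV(3) by simp
      show "U p x \<le> \<delta>" if "x \<in> {0..L}" for x using neg that by (meson not_le)
    qed (use L in auto)
    then show False using p(4) by simp
  qed
  then show thesis using that[OF UV(1) UV(2) p(4,3)] by blast
qed

section \<open>Continuous nonlinearities as limits of Lipschitz ones\<close>

text \<open>
The average of \<open>G t / t\<close> over \<open>[s, s + s / (n + 1)]\<close>, times \<open>s\<close>; the factor \<open>s / (s / (n + 1))\<close> simplifies to
\<open>n + 1\<close>. The interval scales with \<open>s\<close>, so no linear bound for \<open>G\<close> near 0 is lost. Negative arguments are mapped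
to 0.
\<close>
definition slope_average :: "(real \<Rightarrow> real) \<Rightarrow> nat \<Rightarrow> real \<Rightarrow> real" where
  "slope_average G n s = real (Suc n) * integral {max s 0..max s 0 + max s 0 / real (Suc n)} (\<lambda>t. G t / t)"

context
  fixes G :: "real \<Rightarrow> real" and K :: real
  assumes G: "continuous_on {0..} G" and GK: "\<And>s. s \<ge> 0 \<Longrightarrow> \<bar>G s\<bar> \<le> K * s"
begin

lemma slope_bound: "t \<ge> 0 \<Longrightarrow> \<bar>G t / t\<bar> \<le> K"
  using GK[of t] GK[of 1] by (cases "t = 0") (auto simp: divide_le_eq abs_divide)

lemma slope_integrable:
  assumes "0 \<le> x"
  shows "(\<lambda>t. G t / t) integrable_on {x..y}"
proof (cases "x \<le> y")
  case True
  then have y: "0 \<le> y" using assms by simp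
  have "(\<lambda>t. G t / t) integrable_on {0<..y}"
  proof (rule measurable_bounded_by_integrable_imp_integrable)
    have "continuous_on {0<..y} (\<lambda>t. G t / t)"
      by (auto intro!: continuous_intros continuous_on_subset[OF G])
    then show "(\<lambda>t. G t / t) \<in> borel_measurable (lebesgue_on {0<..y})"
      by (rule continuous_imp_measurable_on_sets_lebesgue) auto
    have "(\<lambda>t. K) integrable_on {0..y}" by auto
    then show "(\<lambda>t. K) integrable_on {0<..y}"
      by (rule integrable_spike_set) (auto intro: negligible_subset[of "{0}"])
    show "norm (G t / t) \<le> K" if "t \<in> {0<..y}" for t using slope_bound[of t] that by simp
  qed auto
  moreover have "{0..y} = insert 0 {0<..y}" using y by auto
  ultimately have "(\<lambda>t. G t / t) integrable_on {0..y}" by (simp add: integrable_on_insert_iff)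
  then show ?thesis by (rule integrable_on_subinterval) (use assms in auto)
qed (simp add: integrable_on_empty)

lemma slope_average_zero: "s \<le> 0 \<Longrightarrow> slope_average G n s = 0"
  by (simp add: slope_average_def max_def)

text \<open>
An upper (\<open>p = 1\<close>) or lower (\<open>p = -1\<close>) linear bound for \<open>G\<close> on the averaging interval passes to the average;
\<open>p = a x\<close> does the same for the comparison hypothesis.
\<close>
lemma slope_average_line_bound:
  assumes s: "s \<ge> 0" and C: "C \<ge> 0"
    and le: "\<And>t. s \<le> t \<Longrightarrow> t \<le> s + s / real (Suc n) \<Longrightarrow> p * G t \<le> \<beta> * t + C"
  shows "p * slope_average G n s \<le> \<beta> * s + C"
proof (cases "s = 0")
  case True then show ?thesis using C by (simp add: slope_average_zero)
next
  case False
  with s have s: "s > 0" by simp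
  define b where "b = s + s / real (Suc n)"
  have sb: "s < b" using s by (simp add: b_def)
  have "p * integral {s..b} (\<lambda>t. G t / t) = integral {s..b} (\<lambda>t. p * (G t / t))"
    by (rule Henstock_Kurzweil_Integration.integral_mult_right[symmetric])
  also have "\<dots> \<le> integral {s..b} (\<lambda>t. \<beta> + C / s)"
  proof (rule integral_le)
    show "(\<lambda>t. p * (G t / t)) integrable_on {s..b}"
      by (rule integrable_on_mult_right[OF slope_integrable]) (use s in simp)
    fix t assume t: "t \<in> {s..b}"
    have "p * G t / t \<le> (\<beta> * t + C) / t" using le[of t] t s by (intro divide_right_mono) (auto simp: b_def)
    also have "\<dots> = \<beta> + C / t" using t s by (simp add: add_divide_distrib)
    also have "C / t \<le> C / s" using t s C by (intro divide_left_mono) auto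
    finally show "p * (G t / t) \<le> \<beta> + C / s" by simp
  qed auto
  also have "\<dots> = (b - s) * (\<beta> + C / s)" using sb by simp
  finally have "real (Suc n) * (p * integral {s..b} (\<lambda>t. G t / t)) \<le> real (Suc n) * ((b - s) * (\<beta> + C / s))"
    by (intro mult_left_mono) auto
  also have "\<dots> = \<beta> * s + C"
  proof -
    have "real (Suc n) * (b - s) = s" by (simp add: b_def)
    then have "real (Suc n) * ((b - s) * (\<beta> + C / s)) = s * (\<beta> + C / s)" by (metis mult.assoc)
    also have "\<dots> = \<beta> * s + C" using s by (simp add: distrib_left mult.commute)
    finally show ?thesis .
  qed
  finally show ?thesis using s by (simp add: slope_average_def b_def mult_ac max_def)
qed

lemma slope_average_abs_le:
  assumes "s \<ge> 0"
  shows "\<bar>slope_average G n s\<bar> \<le> K * s"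
proof -
  have "1 * slope_average G n s \<le> K * s + 0" "- 1 * slope_average G n s \<le> K * s + 0"
    by (rule slope_average_line_bound[OF assms order_refl], use assms GK in \<open>force simp: abs_le_iff\<close>)+
  then show ?thesis by simp
qed

text \<open>
The function is a difference of two values of the primitive of the bounded function \<open>G t / t\<close>.
\<close>
lemma slope_average_lipschitz:
  "\<bar>slope_average G n x - slope_average G n y\<bar> \<le> 3 * real (Suc n) * K * \<bar>x - y\<bar>"
proof -
  define N where "N = real (Suc n)"
  have N: "N \<ge> 1" by (simp add: N_def)
  have K: "K \<ge> 0" using GK[of 1] by simp
  define P where "P x = integral {0..x} (\<lambda>t. G t / t)" for x
  have Pd: "P y - P x = integral {x..y} (\<lambda>t. G t / t)" if "0 \<le> x" "x \<le> y" for x y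
    using Henstock_Kurzweil_Integration.integral_combine[OF that slope_integrable[OF order_refl]] by (simp add: P_def)
  have Pl: "\<bar>P y - P x\<bar> \<le> K * \<bar>y - x\<bar>" if "0 \<le> x" "0 \<le> y" for x y
  proof -
    have *: "\<bar>P y - P x\<bar> \<le> K * \<bar>y - x\<bar>" if xy: "0 \<le> x" "x \<le> y" for x y
    proof -
      have "norm (integral {x..y} (\<lambda>t. G t / t)) \<le> integral {x..y} (\<lambda>t. K)"
        using slope_bound xy by (intro integral_norm_bound_integral slope_integrable) auto
      then show ?thesis using Pd[OF xy] xy by (simp add: mult.commute)
    qed
    show ?thesis using *[of x y] *[of y x] that by (cases "x \<le> y") (auto simp: abs_minus_commute)
  qed
  have eq: "slope_average G n s = N * (P (max s 0 + max s 0 / N) - P (max s 0))" for s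
    using Pd[of "max s 0" "max s 0 + max s 0 / N"] N by (simp add: slope_average_def N_def)
  define x' y' where "x' = max x 0" and "y' = max y 0"
  have d: "\<bar>x' - y'\<bar> \<le> \<bar>x - y\<bar>" by (auto simp: x'_def y'_def)
  have e: "\<bar>(x' + x' / N) - (y' + y' / N)\<bar> \<le> 2 * \<bar>x - y\<bar>"
  proof -
    have "(x' + x' / N) - (y' + y' / N) = (x' - y') + (x' - y') / N" by (simp add: diff_divide_distrib)
    moreover have "\<bar>(x' - y') / N\<bar> \<le> \<bar>x' - y'\<bar>"
      using N by (simp add: abs_divide divide_le_eq mult_le_cancel_left1)
    moreover have "\<bar>p + q\<bar> \<le> 2 * t" if "\<bar>q\<bar> \<le> \<bar>p\<bar>" "\<bar>p\<bar> \<le> t" for p q t :: real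
      using that by linarith
    ultimately show ?thesis using d by metis
  qed
  have "\<bar>P (x' + x' / N) - P (y' + y' / N)\<bar> \<le> K * (2 * \<bar>x - y\<bar>)"
    using Pl[of "y' + y' / N" "x' + x' / N"] mult_left_mono[OF e K] N by (auto simp: x'_def y'_def)
  moreover have "\<bar>P x' - P y'\<bar> \<le> K * \<bar>x - y\<bar>"
    using Pl[of y' x'] mult_left_mono[OF d K] by (auto simp: x'_def y'_def)
  ultimately have "\<bar>(P (x' + x' / N) - P x') - (P (y' + y' / N) - P y')\<bar> \<le> 3 * K * \<bar>x - y\<bar>" by linarith
  then have "N * \<bar>(P (x' + x' / N) - P x') - (P (y' + y' / N) - P y')\<bar> \<le> N * (3 * K * \<bar>x - y\<bar>)"
    using N by (intro mult_left_mono) auto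
  moreover have "\<bar>slope_average G n x - slope_average G n y\<bar> = N * \<bar>(P (x' + x' / N) - P x') - (P (y' + y' / N) - P y')\<bar>"
    unfolding eq x'_def[symmetric] y'_def[symmetric] using N by (simp add: right_diff_distrib[symmetric] abs_mult)
  ultimately have "\<bar>slope_average G n x - slope_average G n y\<bar> \<le> N * (3 * K * \<bar>x - y\<bar>)" by linarith
  then show ?thesis by (simp only: N_def mult_ac)
qed

text \<open>
Continuous convergence along subsequences, as needed to pass to the limit inside \<open>g n (u n t)\<close>. At a positive
limit \<open>l\<close> the averaging intervals shrink to \<open>l\<close>, where \<open>G t / t\<close> is continuous; at 0 the linear bound is enough.
\<close>
lemma slope_average_tendsto:
  assumes k: "strict_mono k" and s: "\<And>n. s n \<ge> 0" "s \<longlonglongrightarrow> l"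
  shows "(\<lambda>n. slope_average G (k n) (s n)) \<longlonglongrightarrow> G l"
proof -
  have l: "l \<ge> 0" using LIMSEQ_le_const[OF s(2)] s(1) by blast
  show ?thesis
  proof (cases "l = 0")
    case True
    have "(\<lambda>n. slope_average G (k n) (s n)) \<longlonglongrightarrow> 0"
    proof (rule Lim_null_comparison)
      show "\<forall>\<^sub>F n in sequentially. norm (slope_average G (k n) (s n)) \<le> K * s n"
        using slope_average_abs_le[OF s(1)] by simp
      show "(\<lambda>n. K * s n) \<longlonglongrightarrow> 0" using tendsto_mult_left[OF s(2), of K] True by simp
    qed
    moreover have "G l = 0" using GK[of 0] True by simp
    ultimately show ?thesis by simp
  next
    case False
    with l have l: "l > 0" by simp
    define h where "h t = G t / t" for t
    have "(\<lambda>n. slope_average G (k n) (s n) - h l * s n) \<longlonglongrightarrow> 0"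
    proof (rule LIMSEQ_I)
      fix r :: real assume r: "r > 0"
      define \<epsilon> where "\<epsilon> = r / (2 * (l + 1))"
      have e: "\<epsilon> > 0" using r l by (simp add: \<epsilon>_def)
      have "continuous_on {0<..} h"
        unfolding h_def by (auto intro!: continuous_intros continuous_on_subset[OF G])
      then have "isCont h l" using l by (simp add: continuous_on_eq_continuous_at)
      then obtain \<eta> where \<eta>: "\<eta> > 0" "\<And>t. \<bar>t - l\<bar> < \<eta> \<Longrightarrow> \<bar>h t - h l\<bar> < \<epsilon>"
        using e unfolding continuous_at_eps_delta dist_real_def by metis
      define \<theta> where "\<theta> = min (\<eta> / 2) (min 1 (l / 2))"
      have th: "\<theta> > 0" using \<eta>(1) l by (simp add: \<theta>_def)
      obtain N1 where N1: "\<And>n. n \<ge> N1 \<Longrightarrow> \<bar>s n - l\<bar> < \<theta>"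
        using LIMSEQ_D[OF s(2) th] by auto
      obtain N2 :: nat where N2: "(l + 1) / \<theta> < real N2" using reals_Archimedean2 by blast
      have "\<bar>slope_average G (k n) (s n) - h l * s n\<bar> < r" if n: "n \<ge> max N1 N2" for n
      proof -
        have sn: "\<bar>s n - l\<bar> < \<theta>" using N1 n by simp
        then have sb: "0 < s n" "s n < l + 1" using l unfolding \<theta>_def by linarith+
        have "real N2 \<le> real (Suc (k n))" using n seq_suble[OF k, of n] by simp
        then have "(l + 1) / \<theta> < real (Suc (k n))" using N2 by linarith
        then have "(l + 1) / real (Suc (k n)) < \<theta>" using th by (simp add: field_simps)
        moreover have "s n / real (Suc (k n)) \<le> (l + 1) / real (Suc (k n))"
          using sb by (intro divide_right_mono) auto
        ultimately have w: "s n / real (Suc (k n)) < \<theta>" by linarith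
        have near: "\<bar>h t - h l\<bar> < \<epsilon>" if "s n \<le> t" "t \<le> s n + s n / real (Suc (k n))" for t
        proof -
          have "\<bar>t - l\<bar> < 2 * \<theta>" using that sn w by linarith
          also have "\<dots> \<le> \<eta>" by (simp add: \<theta>_def)
          finally show ?thesis by (rule \<eta>(2))
        qed
        have Gt: "G t = h t * t" if "s n \<le> t" for t using that sb by (simp add: h_def)
        have A: "1 * slope_average G (k n) (s n) \<le> (h l + \<epsilon>) * s n + 0"
        proof (rule slope_average_line_bound)
          fix t assume t: "s n \<le> t" "t \<le> s n + s n / real (Suc (k n))"
          have "h t * t \<le> (h l + \<epsilon>) * t" using near[OF t] t sb by (intro mult_right_mono) auto
          then show "1 * G t \<le> (h l + \<epsilon>) * t + 0" using Gt[OF t(1)] by simp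
        qed (use sb in auto)
        have B: "- 1 * slope_average G (k n) (s n) \<le> (\<epsilon> - h l) * s n + 0"
        proof (rule slope_average_line_bound)
          fix t assume t: "s n \<le> t" "t \<le> s n + s n / real (Suc (k n))"
          have "(- h t) * t \<le> (\<epsilon> - h l) * t" using near[OF t] t sb by (intro mult_right_mono) auto
          then show "- 1 * G t \<le> (\<epsilon> - h l) * t + 0" using Gt[OF t(1)] by simp
        qed (use sb in auto)
        have "\<bar>slope_average G (k n) (s n) - h l * s n\<bar> \<le> \<epsilon> * s n" using A B by (simp add: algebra_simps abs_le_iff)
        also have "\<dots> \<le> \<epsilon> * (l + 1)" using sb e by (intro mult_left_mono) auto
        also have "\<dots> = r / 2" using l by (simp add: \<epsilon>_def field_simps)
        finally show ?thesis using r by linarith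
      qed
      then show "\<exists>no. \<forall>n\<ge>no. norm (slope_average G (k n) (s n) - h l * s n - 0) < r"
        by (intro exI[of _ "max N1 N2"]) simp
    qed
    from tendsto_add[OF this tendsto_mult_left[OF s(2), of "h l"]] show ?thesis using l by (simp add: h_def)
  qed
qed

end

text \<open>
The derivatives vanish somewhere by Rolle's theorem and share the modulus of continuity of the integral of
\<open>K B \<bar>a\<bar>\<close>, so a subsequence of them converges uniformly. The equation passes to the limit by dominated
convergence.
\<close>
lemma limit_of_solutions:
  fixes a G :: "real \<Rightarrow> real" and g :: "nat \<Rightarrow> real \<Rightarrow> real"
  assumes L: "L > 0" and a: "a absolutely_integrable_on {0..L}"
    and so: "\<And>n. second_order 0 L (\<lambda>x. a x * g n (u n x)) (u n) (v n)"
    and u: "\<And>n. u n 0 = 0" "\<And>n. u n L = 0"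
    and ub: "\<And>n x. x \<in> {0..L} \<Longrightarrow> 0 \<le> u n x \<and> u n x \<le> B" and B: "B \<ge> 0"
    and gK: "\<And>n s. s \<ge> 0 \<Longrightarrow> \<bar>g n s\<bar> \<le> K * s" and K: "K \<ge> 0"
    and conv: "\<And>k s l. strict_mono k \<Longrightarrow> (\<And>n. s n \<ge> 0) \<Longrightarrow> s \<longlonglongrightarrow> l \<Longrightarrow> (\<lambda>n. g (k n) (s n)) \<longlonglongrightarrow> G l"
    and G: "continuous_on {0..} G"
    and big: "\<And>n. \<exists>x\<in>{0..L}. u n x > \<delta>"
  obtains U V where "second_order 0 L (\<lambda>x. a x * G (U x)) U V" "U 0 = 0" "U L = 0"
    "\<And>x. x \<in> {0..L} \<Longrightarrow> 0 \<le> U x \<and> U x \<le> B" "\<exists>x\<in>{0..L}. U x \<ge> \<delta>"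
proof -
  define m where "m x = K * B * \<bar>a x\<bar>" for x
  have m: "m absolutely_integrable_on {0..L}"
    using absolutely_integrable_mult_continuous[OF set_integrable_abs[OF a] continuous_on_const[of _ "K * B"]]
    by (simp add: mult.commute m_def[abs_def])
  have m0: "m x \<ge> 0" for x using K B by (simp add: m_def)
  have em: "\<bar>a x * g n (u n x)\<bar> \<le> m x" if x: "x \<in> {0..L}" for n x
  proof -
    have "\<bar>g n (u n x)\<bar> \<le> K * u n x" using gK ub[OF x] by simp
    also have "\<dots> \<le> K * B" using ub[OF x] K by (intro mult_left_mono) auto
    finally have "\<bar>a x\<bar> * \<bar>g n (u n x)\<bar> \<le> \<bar>a x\<bar> * (K * B)" by (intro mult_left_mono) auto
    then show ?thesis by (simp add: abs_mult m_def mult_ac)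
  qed
  define A where "A x = integral {0..x} m" for x
  have Ac: "continuous_on {0..L} A"
    unfolding A_def using m indefinite_integral_continuous_1 by (auto simp: absolutely_integrable_on_def)
  have vA: "\<bar>v n y - v n x\<bar> \<le> \<bar>A y - A x\<bar>" if "x \<in> {0..L}" "y \<in> {0..L}" for n x y
  proof -
    have *: "\<bar>v n y - v n x\<bar> \<le> \<bar>A y - A x\<bar>" if xy: "0 \<le> x" "x \<le> y" "y \<le> L" for x y
    proof -
      have "norm (integral {x..y} (\<lambda>t. a t * g n (u n t))) \<le> integral {x..y} m"
        using em xy second_orderD(3)[OF second_order_subinterval[OF so xy]] integrable_on_subinterval[of m "{0..L}" x y] m
        by (intro integral_norm_bound_integral) (auto simp: absolutely_integrable_on_def)
      then show ?thesis using second_order_increment[OF so xy] integral_difference[OF m xy] by (simp add: A_def)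
    qed
    show ?thesis using *[of x y] *[of y x] that by (cases "x \<le> y") (auto simp: abs_minus_commute)
  qed
  have Ab: "0 \<le> A x" "A x \<le> A L" if "x \<in> {0..L}" for x
  proof -
    have i: "m integrable_on {0..x}" "m integrable_on {0..L}"
      using integrable_on_subinterval[of m "{0..L}" 0 x] m that by (auto simp: absolutely_integrable_on_def)
    show "0 \<le> A x" unfolding A_def using i m0 by (intro integral_nonneg) auto
    show "A x \<le> A L" unfolding A_def using i m0 that by (intro integral_subset_le) auto
  qed
  have vb: "norm (v n x) \<le> A L" if x: "x \<in> {0..L}" for n x
  proof -
    obtain z where z: "0 < z" "z < L" "u n L - u n 0 = v n z * (L - 0)"
      using second_order_mean_value[OF so[of n] order_refl L order_refl] by blast
    then have "v n z = 0" using u L by simp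
    then show ?thesis using vA[of z x n] Ab[OF x] Ab[of z] z x by auto
  qed
  have equi: "\<exists>d. 0 < d \<and> (\<forall>n y. y \<in> {0..L} \<and> norm (x - y) < d \<longrightarrow> norm (v n x - v n y) < e)"
    if x: "x \<in> {0..L}" and e: "0 < e" for x e
  proof -
    obtain d where d: "d > 0" "\<And>y. y \<in> {0..L} \<Longrightarrow> \<bar>y - x\<bar> < d \<Longrightarrow> \<bar>A y - A x\<bar> < e"
      using Ac x e unfolding continuous_on_iff dist_real_def by metis
    have "norm (v n x - v n y) < e" if "y \<in> {0..L}" "norm (x - y) < d" for n y
      using vA[of y x n] d(2)[of y] that x by (simp add: abs_minus_commute)
    then show ?thesis using d(1) by blast
  qed
  obtain V k where V: "continuous_on {0..L} V" and k: "strict_mono (k :: nat \<Rightarrow> nat)"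
    and unif: "\<And>e. 0 < e \<Longrightarrow> \<exists>N. \<forall>n x. n \<ge> N \<and> x \<in> {0..L} \<longrightarrow> norm (v (k n) x - V x) < e"
    by (rule Arzela_Ascoli[OF compact_Icc vb equi]) (assumption | rule that)+
  define U where "U x = integral {0..x} V" for x
  have uI: "(v n has_integral u n x) {0..x}" if "x \<in> {0..L}" for n x
    using second_order_integral_derivative[OF so[of n], of 0 x] that u by auto
  have Uunif: "\<exists>N. \<forall>n\<ge>N. \<forall>x\<in>{0..L}. \<bar>u (k n) x - U x\<bar> \<le> e" if e: "e > 0" for e
  proof -
    obtain N where N: "\<And>n x. n \<ge> N \<Longrightarrow> x \<in> {0..L} \<Longrightarrow> norm (v (k n) x - V x) < e / L"
      using unif[of "e / L"] e L by auto
    have "\<bar>u (k n) x - U x\<bar> \<le> e" if n: "n \<ge> N" and x: "x \<in> {0..L}" for n x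
    proof -
      have VI: "V integrable_on {0..x}"
        by (rule integrable_continuous_real[OF continuous_on_subset[OF V]]) (use x in auto)
      have "u (k n) x - U x = integral {0..x} (\<lambda>t. v (k n) t - V t)"
        using uI[OF x, of "k n"] VI by (subst Henstock_Kurzweil_Integration.integral_diff) (auto simp: U_def integral_unique)
      also have "norm \<dots> \<le> integral {0..x} (\<lambda>t. e / L)"
        using uI[OF x, of "k n"] VI N[OF n] x
        by (intro integral_norm_bound_integral integrable_diff) (auto intro: less_imp_le)
      also have "\<dots> = x * (e / L)" using x by simp
      also have "\<dots> \<le> L * (e / L)" using x e L by (intro mult_right_mono) auto
      finally show ?thesis using L by simp
    qed
    then show ?thesis by blast
  qed
  have Ulim: "(\<lambda>n. u (k n) x) \<longlonglongrightarrow> U x" if x: "x \<in> {0..L}" for x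
  proof (rule LIMSEQ_I)
    fix r :: real assume "r > 0"
    then obtain N where "\<forall>n\<ge>N. \<forall>x\<in>{0..L}. \<bar>u (k n) x - U x\<bar> \<le> r / 2" using Uunif[of "r / 2"] by auto
    then show "\<exists>no. \<forall>n\<ge>no. norm (u (k n) x - U x) < r" using x \<open>r > 0\<close> by (intro exI[of _ N]) force
  qed
  have Ub: "0 \<le> U x \<and> U x \<le> B" if x: "x \<in> {0..L}" for x
    using LIMSEQ_le_const[OF Ulim[OF x]] LIMSEQ_le_const2[OF Ulim[OF x]] ub[OF x] by blast
  have U0: "U 0 = 0" by (simp add: U_def)
  have UL: "U L = 0" using Ulim[of L] u L by (auto simp: LIMSEQ_const_iff)
  have Vlim: "(\<lambda>n. v (k n) x) \<longlonglongrightarrow> V x" if x: "x \<in> {0..L}" for x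
    using unif x unfolding LIMSEQ_iff by blast
  have Ud: "(U has_real_derivative V x) (at x within {0..L})" if "x \<in> {0..L}" for x
    unfolding U_def using integral_has_real_derivative[OF V that] .
  have Uc: "continuous_on {0..L} U" using Ud DERIV_continuous_on by blast
  have GU: "continuous_on {0..L} (\<lambda>x. G (U x))"
    by (rule continuous_on_compose2[OF G Uc]) (use Ub in auto)
  have so': "second_order 0 L (\<lambda>x. a x * G (U x)) U V"
  proof (rule second_orderI)
    show "(\<lambda>x. a x * G (U x)) absolutely_integrable_on {0..L}"
      by (rule absolutely_integrable_mult_continuous[OF a GU])
    fix x assume x: "x \<in> {0..L}"
    have "(\<lambda>n. integral {0..x} (\<lambda>t. a t * g (k n) (u (k n) t))) \<longlonglongrightarrow> integral {0..x} (\<lambda>t. a t * G (U t))"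
    proof (rule dominated_convergence(2)[where h=m])
      show "(\<lambda>t. a t * g (k n) (u (k n) t)) integrable_on {0..x}" for n
        using second_orderD(3)[OF second_order_subinterval[OF so, of 0 x]] x by auto
      show "m integrable_on {0..x}"
        using integrable_on_subinterval[of m "{0..L}" 0 x] m x by (auto simp: absolutely_integrable_on_def)
      fix t assume "t \<in> {0..x}"
      then have t: "t \<in> {0..L}" using x by auto
      show "norm (a t * g (k n) (u (k n) t)) \<le> m t" for n using em[OF t] by simp
      show "(\<lambda>n. a t * g (k n) (u (k n) t)) \<longlonglongrightarrow> a t * G (U t)"
        using ub[OF t] by (intro tendsto_mult_left conv k Ulim[OF t]) auto
    qed
    then have "(\<lambda>n. v (k n) 0 - integral {0..x} (\<lambda>t. a t * g (k n) (u (k n) t))) \<longlonglongrightarrow> V 0 - integral {0..x} (\<lambda>t. a t * G (U t))"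
      using Vlim[of 0] L by (intro tendsto_diff) auto
    moreover have "v (k n) 0 - integral {0..x} (\<lambda>t. a t * g (k n) (u (k n) t)) = v (k n) x" for n
      using second_orderD(5)[OF so x, of "k n"] by simp
    ultimately show "V x = V 0 - integral {0..x} (\<lambda>t. a t * G (U t))"
      using Vlim[OF x] LIMSEQ_unique by simp
  qed (use L Ud in auto)
  have "\<exists>x\<in>{0..L}. U x \<ge> \<delta>"
  proof (rule ccontr)
    assume n: "\<not> ?thesis"
    obtain x0 where x0: "x0 \<in> {0..L}" "\<And>y. y \<in> {0..L} \<Longrightarrow> U y \<le> U x0"
      using continuous_attains_sup[OF compact_Icc _ Uc] L by fastforce
    have lt: "U x0 < \<delta>" using n x0(1) by force
    then obtain N where N: "\<forall>n\<ge>N. \<forall>x\<in>{0..L}. \<bar>u (k n) x - U x\<bar> \<le> \<delta> - U x0" using Uunif[of "\<delta> - U x0"] by auto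
    obtain x where x: "x \<in> {0..L}" "u (k N) x > \<delta>" using big by blast
    have "\<bar>u (k N) x - U x\<bar> \<le> \<delta> - U x0" using N x(1) by blast
    then show False using x0(2)[OF x(1)] x(2) by linarith
  qed
  then show thesis using that[OF so' U0 UL Ub] by blast
qed

text \<open>
Suppose \<open>u\<close> attains its maximum at an interior point \<open>X\<close> outside \<open>F\<close>, where \<open>v X = 0\<close>. Up to the next point \<open>r\<close> of
\<open>F \<union> {L}\<close> the weight is nonpositive, so \<open>f \<ge> - C\<close> keeps \<open>v\<close> above \<open>- C\<close> times the integral of \<open>\<bar>a\<bar>\<close>, and \<open>u\<close>
cannot have dropped much when it reaches \<open>r\<close>, where it is at most \<open>M\<close>.
\<close>
lemma bound_off_positive_intervals:
  fixes a :: "real \<Rightarrow> real"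
  assumes a: "a absolutely_integrable_on {0..L}" and so: "second_order 0 L (\<lambda>x. a x * f (u x)) u v"
    and u: "u 0 = 0" "u L = 0" "\<And>x. x \<in> {0..L} \<Longrightarrow> u x \<ge> 0"
    and f: "\<And>s. s \<ge> 0 \<Longrightarrow> f s \<ge> - C" and C: "C \<ge> 0"
    and F: "closed F" "\<And>x. x \<in> F \<inter> {0..L} \<Longrightarrow> u x \<le> M" and M: "M \<ge> 0"
    and E: "negligible E" "\<And>x. x \<in> {0..L} - F - E \<Longrightarrow> a x \<le> 0" and x: "x \<in> {0..L}"
  shows "u x \<le> M + C * integral {0..L} (\<lambda>x. \<bar>a x\<bar>) * L"
proof -
  define A where "A = integral {0..L} (\<lambda>x. \<bar>a x\<bar>)"
  have am: "(\<lambda>x. \<bar>a x\<bar>) absolutely_integrable_on {0..L}" using a by (rule set_integrable_abs)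
  have A: "A \<ge> 0" unfolding A_def using am by (intro integral_nonneg) (auto simp: absolutely_integrable_on_def)
  have L: "L \<ge> 0" using x by auto
  have CAL: "C * A * L \<ge> 0" using C A L by simp
  obtain X where X: "X \<in> {0..L}" "\<And>y. y \<in> {0..L} \<Longrightarrow> u y \<le> u X"
    using continuous_attains_sup[OF compact_Icc _ second_order_continuous(1)[OF so]] L by fastforce
  have "u X \<le> M + C * A * L"
  proof (cases "u X = 0 \<or> X \<in> F")
    case True then show ?thesis using F(2)[of X] X(1) M CAL by auto
  next
    case False
    then have XI: "X \<in> {0<..<L}" using X(1) u by force
    have "- 1 * v X = 0"
    proof (rule second_order_interior_minimum[OF second_order_cmult[OF so, of "-1"] XI])
      show "- 1 * u X \<le> - 1 * u y" if "y \<in> {0..L}" for y using X(2)[OF that] by simp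
    qed
    then have vX: "v X = 0" by simp
    define S where "S = (F \<union> {L}) \<inter> {X..L}"
    have "closed S" unfolding S_def using F(1) by (intro closed_Int closed_Un) auto
    then have S: "closed S" "L \<in> S" "bdd_below S" using XI by (auto simp: S_def)
    define r where "r = Inf S"
    have rS: "r \<in> S" unfolding r_def using S closed_contains_Inf by blast
    have r: "X < r" "r \<le> L" "u r \<le> M" using rS False XI F(2)[of r] u(2) M by (auto simp: S_def le_less)
    have gap: "y \<notin> F" if "y \<in> {X<..<r}" for y
    proof
      assume "y \<in> F"
      then have "y \<in> S" using that r by (auto simp: S_def)
      then have "r \<le> y" unfolding r_def by (rule cInf_lower[OF _ S(3)])
      then show False using that by simp
    qed
    obtain z where z: "X < z" "z < r" "u r - u X = v z * (r - X)"
      using second_order_mean_value[OF so, of X r] X(1) r by auto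
    have Xz: "0 \<le> X" "X \<le> z" "z \<le> L" using X(1) z r by auto
    have sub: "{X..z} \<subseteq> {0..L}" using Xz by auto
    have "integral {X..z} (\<lambda>t. a t * f (u t)) \<le> integral {X..z} (\<lambda>t. if t \<in> E then a t * f (u t) else C * \<bar>a t\<bar>)"
    proof (rule integral_le)
      show "(\<lambda>t. a t * f (u t)) integrable_on {X..z}"
        using second_orderD(3)[OF second_order_subinterval[OF so Xz]] .
      have "(\<lambda>t. C * \<bar>a t\<bar>) integrable_on {X..z}"
        using am sub by (intro integrable_on_mult_right integrable_on_subinterval[OF _ sub]) (simp add: absolutely_integrable_on_def)
      then show "(\<lambda>t. if t \<in> E then a t * f (u t) else C * \<bar>a t\<bar>) integrable_on {X..z}"
        by (rule integrable_spike[OF _ E(1)]) auto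
      fix t assume t: "t \<in> {X..z}"
      show "a t * f (u t) \<le> (if t \<in> E then a t * f (u t) else C * \<bar>a t\<bar>)"
      proof (cases "t \<in> E")
        case F: False
        have "t \<notin> F" using gap[of t] t z False by (cases "t = X") auto
        then have at: "a t \<le> 0" using E(2)[of t] F t sub by auto
        have "f (u t) \<ge> - C" using f u(3) t sub by blast
        then have "a t * f (u t) \<le> a t * (- C)" using at by (intro mult_left_mono_neg) auto
        then show ?thesis using F at by (simp add: mult.commute)
      qed simp
    qed
    also have "\<dots> = integral {X..z} (\<lambda>t. C * \<bar>a t\<bar>)"
      by (rule integral_spike[OF E(1)]) auto
    also have "\<dots> = C * integral {X..z} (\<lambda>t. \<bar>a t\<bar>)" by simp
    also have "\<dots> \<le> C * A"
      unfolding A_def using C integral_abs_mono_subinterval[OF a Xz] by (intro mult_left_mono)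
    finally have "v z \<ge> - (C * A)" using second_order_increment[OF so Xz] vX by simp
    then have "v z * (r - X) \<ge> - (C * A) * (r - X)" using r by (intro mult_right_mono) auto
    then have "- (C * A * (r - X)) \<le> v z * (r - X)" by (simp only: mult_minus_left)
    moreover have "(C * A) * (r - X) \<le> (C * A) * L" using C A r XI by (intro mult_left_mono) auto
    ultimately show ?thesis using z(3) r(3) by linarith
  qed
  then show ?thesis using X(2)[OF x] by (simp add: A_def)
qed

section \<open>Existence of a positive solution\<close>

text \<open>
Solve for the averaged nonlinearities and pass to the limit. The comparison hypothesis is inherited on
\<open>{0..\<delta> / 2}\<close>, because the averaging interval of \<open>s\<close> is contained in \<open>{s..2 * s}\<close>.
\<close>
theorem positive_solution_linear_growth:
  fixes a G w :: "real \<Rightarrow> real"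
  assumes L: "L > 0" and a: "a absolutely_integrable_on {0..L}"
    and G: "continuous_on {0..} G" "\<And>s. s \<ge> 0 \<Longrightarrow> \<bar>G s\<bar> \<le> K * s"
    and \<delta>: "\<delta> > 0" and cmp: "\<And>x s. x \<in> {0..L} \<Longrightarrow> s \<in> {0..\<delta>} \<Longrightarrow> a x * G s \<le> \<kappa> * w x * s"
    and \<phi>: "second_order 0 L (\<lambda>x. \<kappa> * w x * \<phi> x) \<phi> \<psi>" "\<phi> 0 = 0" "\<And>x. x \<in> {0<..L} \<Longrightarrow> \<phi> x > 0"
    and q: "\<And>s. s \<ge> 0 \<Longrightarrow> G s \<ge> q * s - C" and C: "C \<ge> 0"
    and cd: "0 \<le> c" "c < d" "d \<le> L"
    and M: "\<And>f u v x. second_order 0 L (\<lambda>x. a x * f (u x)) u v \<Longrightarrow> (\<And>x. x \<in> {0..L} \<Longrightarrow> u x \<ge> 0) \<Longrightarrow>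
       (\<And>s. s \<ge> 0 \<Longrightarrow> f s \<ge> q * s - C) \<Longrightarrow> x \<in> {c..d} \<Longrightarrow> u x \<le> M"
    and B: "\<And>f u v x. second_order 0 L (\<lambda>x. a x * f (u x)) u v \<Longrightarrow> (\<And>x. x \<in> {0..L} \<Longrightarrow> u x \<ge> 0) \<Longrightarrow>
       u 0 = 0 \<Longrightarrow> u L = 0 \<Longrightarrow> (\<And>s. s \<ge> 0 \<Longrightarrow> f s \<ge> q * s - C) \<Longrightarrow> x \<in> {0..L} \<Longrightarrow> u x \<le> B"
  obtains U V where "second_order 0 L (\<lambda>x. a x * G (U x)) U V" "U 0 = 0" "U L = 0"
    "\<And>x. x \<in> {0..L} \<Longrightarrow> 0 \<le> U x \<and> U x \<le> B" "\<exists>x\<in>{0..L}. U x \<ge> \<delta> / 2"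
proof -
  have K: "K \<ge> 0" using G(2)[of 1] by simp
  define g where "g n = slope_average G n" for n
  have gq: "g n s \<ge> q * s - C" if "s \<ge> 0" for n s
  proof -
    have "- 1 * slope_average G n s \<le> (- q) * s + C"
    proof (rule slope_average_line_bound[OF G that C])
      fix t assume "s \<le> t"
      then show "- 1 * G t \<le> - q * t + C" using q[of t] that by simp
    qed
    then show ?thesis by (simp add: g_def)
  qed
  have gcmp: "a x * g n s \<le> \<kappa> * w x * s" if x: "x \<in> {0..L}" and s: "s \<in> {0..\<delta>/2}" for n x s
  proof -
    have "a x * slope_average G n s \<le> \<kappa> * w x * s + 0"
    proof (rule slope_average_line_bound[OF G])
      fix t assume t: "s \<le> t" "t \<le> s + s / real (Suc n)"
      have "s / real (Suc n) \<le> s" using s by (simp add: divide_le_eq mult_le_cancel_left1)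
      then have "t \<in> {0..\<delta>}" using t s by auto
      then show "a x * G t \<le> \<kappa> * w x * t + 0" using cmp[OF x] by simp
    qed (use s in auto)
    then show ?thesis by (simp add: g_def)
  qed
  have glip: "\<bar>g n x - g n y\<bar> \<le> 3 * real (Suc n) * K * \<bar>x - y\<bar>" for n x y
    unfolding g_def by (rule slope_average_lipschitz[OF G])
  have g0: "g n 0 = 0" for n by (simp add: g_def slope_average_zero[OF G])
  have "\<exists>u v. second_order 0 L (\<lambda>x. a x * g n (u x)) u v \<and> u 0 = 0 \<and> u L = 0 \<and>
      (\<forall>x\<in>{0<..<L}. u x > 0) \<and> (\<exists>x\<in>{0..L}. u x > \<delta> / 2)" for n
  proof -
    have M': "u x \<le> M" if "second_order 0 L (\<lambda>x. a x * g n (u x)) u v" "\<And>x. x \<in> {0..L} \<Longrightarrow> u x \<ge> 0" "x \<in> {c..d}" for u v x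
      using M[OF that(1,2) gq that(3)] .
    obtain u v where "second_order 0 L (\<lambda>x. a x * g n (u x)) u v" "u 0 = 0" "u L = 0"
      "\<And>x. x \<in> {0<..<L} \<Longrightarrow> u x > 0" "\<exists>x\<in>{0..L}. u x > \<delta> / 2"
    proof (rule lipschitz_positive_solution[OF L a glip g0 half_gt_zero[OF \<delta>] _ \<phi> cd, where M=M])
      note found = that
      show "a x * g n s \<le> \<kappa> * w x * s" if "x \<in> {0..L}" "s \<in> {0..\<delta> / 2}" for x s by (rule gcmp[OF that])
      show "u x \<le> M" if "second_order 0 L (\<lambda>x. a x * g n (u x)) u v" "\<And>x. x \<in> {0..L} \<Longrightarrow> u x \<ge> 0" "x \<in> {c..d}" for u v x
        by (rule M'[OF that])
      show thesis if "second_order 0 L (\<lambda>x. a x * g n (u x)) u v" "u 0 = 0" "u L = 0"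
        "\<And>x. x \<in> {0<..<L} \<Longrightarrow> u x > 0" "\<exists>x\<in>{0..L}. u x > \<delta> / 2" for u v
        by (rule found[OF that])
    qed
    then show ?thesis by blast
  qed
  then obtain u v where u: "\<And>n. second_order 0 L (\<lambda>x. a x * g n (u n x)) (u n) (v n)" "\<And>n. u n 0 = 0" "\<And>n. u n L = 0"
    "\<And>n x. x \<in> {0<..<L} \<Longrightarrow> u n x > 0" "\<And>n. \<exists>x\<in>{0..L}. u n x > \<delta> / 2" by metis
  have nn: "u n x \<ge> 0" if "x \<in> {0..L}" for n x
    using that u(2,3)[of n] u(4)[of x n] by (cases "x = 0 \<or> x = L") (auto intro: less_imp_le)
  have ub: "0 \<le> u n x \<and> u n x \<le> B" if "x \<in> {0..L}" for n x
    using nn[OF that] B[OF u(1) nn u(2,3) gq that] by simp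
  have B0: "B \<ge> 0" using ub[of 0 0] L by auto
  have gK: "\<bar>g n s\<bar> \<le> K * s" if "s \<ge> 0" for n s unfolding g_def by (rule slope_average_abs_le[OF G that])
  have conv: "(\<lambda>n. g (k n) (s n)) \<longlonglongrightarrow> G l" if "strict_mono k" "\<And>n. s n \<ge> 0" "s \<longlonglongrightarrow> l" for k s l
    unfolding g_def by (rule slope_average_tendsto[OF G that])
  show thesis
    by (rule limit_of_solutions[OF L a u(1,2,3) ub B0 gK K conv G(1) u(5)]) (assumption | rule that)+
qed

text \<open>
The chain is built from its largest point downwards, so that the next point can be taken as close to 0 as
necessary; the sign \<open>\<sigma>\<close> of the first point is prescribed to make the induction work.
\<close>
lemma alternating_chain:
  fixes g :: "real \<Rightarrow> real"
  assumes pos: "\<And>\<delta>. \<delta> > 0 \<Longrightarrow> \<exists>s. 0 < s \<and> s < \<delta> \<and> g s > 0" and neg: "\<And>\<delta>. \<delta> > 0 \<Longrightarrow> \<exists>s. 0 < s \<and> s < \<delta> \<and> g s < 0"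
    and \<sigma>: "\<sigma> = 1 \<or> \<sigma> = (-1::real)" and \<delta>: "\<delta> > 0"
  shows "\<exists>s::nat \<Rightarrow> real. strict_mono_on {..n} s \<and> s ` {..n} \<subseteq> {0<..<\<delta>} \<and>
     (\<forall>k<n. g (s k) * g (s (Suc k)) < 0) \<and> \<sigma> * g (s 0) > 0"
  using \<sigma>
proof (induction n arbitrary: \<sigma>)
  have sgn: "\<exists>p. 0 < p \<and> p < r \<and> \<sigma> * g p > 0" if "r > 0" "\<sigma> = 1 \<or> \<sigma> = (-1::real)" for r \<sigma>
    using pos[OF that(1)] neg[OF that(1)] that(2) by auto
  {
    case 0
    obtain p where "0 < p" "p < \<delta>" "\<sigma> * g p > 0" using sgn[OF \<delta> 0] by blast
    then show ?case by (intro exI[of _ "\<lambda>_. p"]) (auto simp: strict_mono_on_def)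
  next
    case (Suc n)
    have "- \<sigma> = 1 \<or> - \<sigma> = -1" using Suc.prems by auto
    from Suc.IH[OF this] obtain s where s: "strict_mono_on {..n} s" "s ` {..n} \<subseteq> {0<..<\<delta>}"
      "\<forall>k<n. g (s k) * g (s (Suc k)) < 0" "- \<sigma> * g (s 0) > 0" by blast
    have s0: "s 0 > 0" "s 0 < \<delta>" using s(2) by auto
    obtain p where p: "0 < p" "p < s 0" "\<sigma> * g p > 0" using sgn[OF s0(1) Suc.prems] by blast
    define t where "t = case_nat p s"
    have t: "t 0 = p" "t (Suc k) = s k" for k by (simp_all add: t_def)
    have "t j < t k" if jk: "j < k" "k \<le> Suc n" for j k
    proof -
      obtain k' where k': "k = Suc k'" using jk by (cases k) auto
      have s0k: "s 0 \<le> s k'" using s(1) k' jk by (cases "k' = 0") (auto simp: strict_mono_on_def intro!: less_imp_le)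
      show ?thesis
      proof (cases j)
        case 0 then show ?thesis using p s0k k' t by simp
      next
        case (Suc j') then show ?thesis using s(1) k' jk t by (auto simp: strict_mono_on_def)
      qed
    qed
    then have "strict_mono_on {..Suc n} t" by (auto simp: strict_mono_on_def)
    moreover have "t ` {..Suc n} \<subseteq> {0<..<\<delta>}"
    proof
      fix y assume "y \<in> t ` {..Suc n}"
      then obtain k where "k \<le> Suc n" "y = t k" by auto
      then show "y \<in> {0<..<\<delta>}" using s(2) p s0 t by (cases k) auto
    qed
    moreover have "g (t k) * g (t (Suc k)) < 0" if "k < Suc n" for k
    proof (cases k)
      case 0
      have "\<sigma> * g p * (- \<sigma> * g (s 0)) > 0" using p(3) s(4) by (rule mult_pos_pos)
      moreover have "\<sigma> * \<sigma> = 1" using Suc.prems by auto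
      ultimately have "- (g p * g (s 0)) > 0" by (metis (no_types, opaque_lifting) mult.assoc mult.commute mult_1 mult_minus_left)
      then show ?thesis using 0 t by simp
    next
      case (Suc k') then show ?thesis using s(3) that t by simp
    qed
    moreover have "\<sigma> * g (t 0) > 0" using p t by simp
    ultimately show ?case by blast
  }
qed

lemma changes_sign_if_no_sign_near_zero:
  assumes g0: "g 0 = 0" and np: "\<not> (\<exists>\<delta>>0. \<forall>s\<in>{0..\<delta>}. g s \<ge> 0)" and nn: "\<not> (\<exists>\<delta>>0. \<forall>s\<in>{0..\<delta>}. g s \<le> 0)"
  shows "changes_sign_infinitely_at_zero g"
proof -
  have neg: "\<exists>s. 0 < s \<and> s < \<delta> \<and> g s < 0" if d: "\<delta> > 0" for \<delta>
  proof -
    obtain s where "s \<in> {0..\<delta>/2}" "\<not> g s \<ge> 0" using np d half_gt_zero by blast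
    then show ?thesis using g0 d by (intro exI[of _ s]) (cases "s = 0"; auto)
  qed
  have pos: "\<exists>s. 0 < s \<and> s < \<delta> \<and> g s > 0" if d: "\<delta> > 0" for \<delta>
  proof -
    obtain s where "s \<in> {0..\<delta>/2}" "\<not> g s \<le> 0" using nn d half_gt_zero by blast
    then show ?thesis using g0 d by (intro exI[of _ s]) (cases "s = 0"; auto)
  qed
  show ?thesis
    unfolding changes_sign_infinitely_at_zero_def
  proof (intro allI impI)
    fix \<delta> :: real and n :: nat assume "\<delta> > 0"
    then show "\<exists>s::nat \<Rightarrow> real. strict_mono_on {..n} s \<and> s ` {..n} \<subseteq> {0<..<\<delta>} \<and> (\<forall>k<n. g (s k) * g (s (Suc k)) < 0)"
      using alternating_chain[of g 1 \<delta> n] pos neg by blast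
  qed
qed

lemma above_line_near_zero:
  assumes "g_zero_inf g > ereal \<alpha>"
  obtains \<delta> where "\<delta> > 0" "\<And>s. 0 < s \<Longrightarrow> s < \<delta> \<Longrightarrow> \<alpha> * s \<le> g s"
proof -
  have "eventually (\<lambda>s. ereal \<alpha> < ereal (g s / s)) (at_right 0)"
    using assms unfolding g_zero_inf_def by (rule less_LiminfD)
  then obtain \<delta> where "\<delta> > 0" "\<And>s. 0 < s \<Longrightarrow> s < \<delta> \<Longrightarrow> \<alpha> < g s / s"
    unfolding eventually_at_right_field by auto
  then show thesis using that[of \<delta>] by (simp add: pos_less_divide_eq less_imp_le)
qed

lemma below_line_near_zero:
  assumes "g_zero_sup g < ereal \<beta>"
  obtains \<delta> where "\<delta> > 0" "\<And>s. 0 < s \<Longrightarrow> s < \<delta> \<Longrightarrow> g s \<le> \<beta> * s"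
proof -
  have "eventually (\<lambda>s. ereal (g s / s) < ereal \<beta>) (at_right 0)"
    using assms unfolding g_zero_sup_def by (rule Limsup_lessD)
  then obtain \<delta> where "\<delta> > 0" "\<And>s. 0 < s \<Longrightarrow> s < \<delta> \<Longrightarrow> g s / s < \<beta>"
    unfolding eventually_at_right_field by auto
  then show thesis using that[of \<delta>] by (simp add: pos_divide_less_eq less_imp_le)
qed

lemma above_line_near_infinity:
  assumes "g_infty g > ereal q"
  obtains R where "R > 0" "\<And>s. s \<ge> R \<Longrightarrow> q * s \<le> g s"
proof -
  have "eventually (\<lambda>s. ereal q < ereal (g s / s)) at_top"
    using assms unfolding g_infty_def by (rule less_LiminfD)
  then obtain R where R: "\<And>s. s \<ge> R \<Longrightarrow> q < g s / s"
    unfolding eventually_at_top_linorder by auto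
  have "q * s \<le> g s" if "s \<ge> max R 1" for s
    using that R[of s] by (simp add: pos_less_divide_eq less_imp_le)
  then show thesis using that[of "max R 1"] by simp
qed

lemma pos_part_absolutely_integrable:
  assumes "a absolutely_integrable_on S" shows "pos_part a absolutely_integrable_on S"
  unfolding pos_part_def[abs_def] using assms by (intro absolutely_integrable_max_1) auto

text \<open>
The three cases differ only in the weight \<open>w\<close>: if \<open>g \<ge> 0\<close> near 0 then \<open>a g \<le> pos_part a g\<close>, if \<open>g \<le> 0\<close>
then \<open>a g \<le> neg_part a (- g)\<close>, and in general \<open>a g \<le> \<bar>a\<bar> \<bar>g\<bar>\<close>. These cases are exhaustive. The number \<open>\<kappa>\<close> is
replaced by 0 if the bound for \<open>g s / s\<close> is negative.
\<close>
lemma comparison_near_zero: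
  fixes a g :: "real \<Rightarrow> real"
  assumes a: "a absolutely_integrable_on {0..L}" and g0: "g 0 = 0"
    and H3_nonneg: "(\<exists>\<delta>>0. \<forall>s\<in>{0..\<delta>}. g s \<ge> 0) \<longrightarrow>
          not_ae_zero_on (pos_part a) {0..L} \<and>
          g_zero_sup g < ereal (first_eigenvalue (pos_part a) 0 L)"
    and H3_nonpos: "(\<exists>\<delta>>0. \<forall>s\<in>{0..\<delta>}. g s \<le> 0) \<longrightarrow>
          not_ae_zero_on (neg_part a) {0..L} \<and>
          g_zero_inf g > - ereal (first_eigenvalue (neg_part a) 0 L)"
    and H3_osc: "changes_sign_infinitely_at_zero g \<longrightarrow>
          not_ae_zero_on a {0..L} \<and>
          - ereal (first_eigenvalue (\<lambda>x. \<bar>a x\<bar>) 0 L) < g_zero_inf g \<and>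
          g_zero_inf g \<le> g_zero_sup g \<and>
          g_zero_sup g < ereal (first_eigenvalue (\<lambda>x. \<bar>a x\<bar>) 0 L)"
  obtains w \<kappa> \<delta> \<phi> \<psi> where "\<delta> > 0" "\<And>x s. x \<in> {0..L} \<Longrightarrow> s \<in> {0..\<delta>} \<Longrightarrow> a x * g s \<le> \<kappa> * w x * s"
    "second_order 0 L (\<lambda>x. \<kappa> * w x * \<phi> x) \<phi> \<psi>" "\<phi> 0 = 0" "\<And>x. x \<in> {0<..L} \<Longrightarrow> \<phi> x > 0"
proof -
  note found = that
  have finish: thesis if w: "w absolutely_integrable_on {0..L}" "\<And>x. w x \<ge> 0" "not_ae_zero_on w {0..L}"
    and \<kappa>: "0 \<le> \<kappa>" "\<kappa> < first_eigenvalue w 0 L" and \<delta>: "\<delta> > 0"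
    and c: "\<And>x s. x \<in> {0..L} \<Longrightarrow> 0 < s \<Longrightarrow> s < \<delta> \<Longrightarrow> a x * g s \<le> \<kappa> * w x * s" for w \<kappa> \<delta>
  proof -
    obtain \<phi> \<psi> where \<phi>: "second_order 0 L (\<lambda>x. \<kappa> * w x * \<phi> x) \<phi> \<psi>" "\<phi> 0 = 0" "\<forall>x\<in>{0<..L}. \<phi> x > 0"
      using first_eigenvalue_properties(3)[OF w(1) w(2) w(3) \<kappa>] by blast
    show thesis
    proof (rule found[of "\<delta> / 2" \<kappa> w \<phi> \<psi>])
      show "a x * g s \<le> \<kappa> * w x * s" if "x \<in> {0..L}" "s \<in> {0..\<delta> / 2}" for x s
        using c[of x s] that g0 \<delta> by (cases "s = 0") auto
    qed (use \<phi> \<delta> in auto)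
  qed
  have pp: "pos_part a absolutely_integrable_on {0..L}" by (rule pos_part_absolutely_integrable[OF a])
  have np: "neg_part a absolutely_integrable_on {0..L}"
    using pos_part_absolutely_integrable[OF absolutely_integrable_uminus[OF a]]
    by (simp add: pos_part_def[abs_def] neg_part_def[abs_def])
  have aa: "(\<lambda>x. \<bar>a x\<bar>) absolutely_integrable_on {0..L}" using a by (rule set_integrable_abs)
  consider (A) "\<exists>\<delta>>0. \<forall>s\<in>{0..\<delta>}. g s \<ge> 0" | (B) "\<exists>\<delta>>0. \<forall>s\<in>{0..\<delta>}. g s \<le> 0" | (C) "changes_sign_infinitely_at_zero g"
    using changes_sign_if_no_sign_near_zero[of g, OF g0] by blast
  then show thesis
  proof cases
    case A
    then obtain \<delta>1 where d1: "\<delta>1 > 0" "\<forall>s\<in>{0..\<delta>1}. g s \<ge> 0" by blast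
    have H: "not_ae_zero_on (pos_part a) {0..L}" "g_zero_sup g < ereal (first_eigenvalue (pos_part a) 0 L)"
      using H3_nonneg A by blast+
    obtain \<beta> where b: "g_zero_sup g < ereal \<beta>" "ereal \<beta> < ereal (first_eigenvalue (pos_part a) 0 L)"
      using ereal_dense2[OF H(2)] by blast
    obtain \<delta>2 where d2: "\<delta>2 > 0" "\<And>s. 0 < s \<Longrightarrow> s < \<delta>2 \<Longrightarrow> g s \<le> \<beta> * s" using below_line_near_zero[OF b(1)] by blast
    have wn: "pos_part a x \<ge> 0" for x by (simp add: pos_part_def)
    have lp: "first_eigenvalue (pos_part a) 0 L > 0" using first_eigenvalue_properties(1)[OF pp wn H(1)] .
    show thesis
    proof (rule finish[OF pp wn H(1), of "max \<beta> 0" "min \<delta>1 \<delta>2"])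
      fix x s assume s: "0 < s" "s < min \<delta>1 \<delta>2"
      have "a x * g s \<le> pos_part a x * g s" using d1 s by (intro mult_right_mono) (auto simp: pos_part_def)
      also have "g s \<le> max \<beta> 0 * s"
      proof -
        have "\<beta> * s \<le> max \<beta> 0 * s" using s by (intro mult_right_mono) auto
        moreover have "g s \<le> \<beta> * s" using d2(2)[of s] s by simp
        ultimately show ?thesis by linarith
      qed
      then have "pos_part a x * g s \<le> pos_part a x * (max \<beta> 0 * s)" using wn by (intro mult_left_mono)
      finally show "a x * g s \<le> max \<beta> 0 * pos_part a x * s" by (simp add: mult_ac)
    qed (use d1 d2 b lp in auto)
  next
    case B
    then obtain \<delta>1 where d1: "\<delta>1 > 0" "\<forall>s\<in>{0..\<delta>1}. g s \<le> 0" by blast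
    have H: "not_ae_zero_on (neg_part a) {0..L}" "- ereal (first_eigenvalue (neg_part a) 0 L) < g_zero_inf g"
      using H3_nonpos B by blast+
    obtain \<alpha> where b: "- ereal (first_eigenvalue (neg_part a) 0 L) < ereal \<alpha>" "ereal \<alpha> < g_zero_inf g"
      using ereal_dense2[OF H(2)] by blast
    obtain \<delta>2 where d2: "\<delta>2 > 0" "\<And>s. 0 < s \<Longrightarrow> s < \<delta>2 \<Longrightarrow> \<alpha> * s \<le> g s" using above_line_near_zero[OF b(2)] by blast
    have wn: "neg_part a x \<ge> 0" for x by (simp add: neg_part_def)
    have lp: "first_eigenvalue (neg_part a) 0 L > 0" using first_eigenvalue_properties(1)[OF np wn H(1)] .
    show thesis
    proof (rule finish[OF np wn H(1), of "max (- \<alpha>) 0" "min \<delta>1 \<delta>2"])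
      fix x s assume s: "0 < s" "s < min \<delta>1 \<delta>2"
      have "(- a x) * (- g s) \<le> neg_part a x * (- g s)" using d1 s by (intro mult_right_mono) (auto simp: neg_part_def)
      also have "- g s \<le> max (- \<alpha>) 0 * s"
      proof -
        have "(- \<alpha>) * s \<le> max (- \<alpha>) 0 * s" using s by (intro mult_right_mono) auto
        moreover have "\<alpha> * s \<le> g s" using d2(2)[of s] s by simp
        ultimately show ?thesis by linarith
      qed
      then have "neg_part a x * (- g s) \<le> neg_part a x * (max (- \<alpha>) 0 * s)" using wn by (intro mult_left_mono)
      finally show "a x * g s \<le> max (- \<alpha>) 0 * neg_part a x * s" by (simp add: mult_ac)
    qed (use d1 d2 b lp in auto)
  next
    case C
    define \<Lambda> where "\<Lambda> = first_eigenvalue (\<lambda>x. \<bar>a x\<bar>) 0 L"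
    have H: "not_ae_zero_on a {0..L}" "- ereal \<Lambda> < g_zero_inf g" "g_zero_sup g < ereal \<Lambda>"
      using H3_osc C unfolding \<Lambda>_def by blast+
    have H': "not_ae_zero_on (\<lambda>x. \<bar>a x\<bar>) {0..L}" using H(1) by (simp add: not_ae_zero_on_def)
    obtain \<alpha> where b: "- ereal \<Lambda> < ereal \<alpha>" "ereal \<alpha> < g_zero_inf g" using ereal_dense2[OF H(2)] by blast
    obtain \<beta> where b': "g_zero_sup g < ereal \<beta>" "ereal \<beta> < ereal \<Lambda>" using ereal_dense2[OF H(3)] by blast
    obtain \<delta>1 where d1: "\<delta>1 > 0" "\<And>s. 0 < s \<Longrightarrow> s < \<delta>1 \<Longrightarrow> \<alpha> * s \<le> g s" using above_line_near_zero[OF b(2)] by blast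
    obtain \<delta>2 where d2: "\<delta>2 > 0" "\<And>s. 0 < s \<Longrightarrow> s < \<delta>2 \<Longrightarrow> g s \<le> \<beta> * s" using below_line_near_zero[OF b'(1)] by blast
    define \<kappa> where "\<kappa> = max 0 (max (- \<alpha>) \<beta>)"
    have lp: "\<Lambda> > 0" unfolding \<Lambda>_def using first_eigenvalue_properties(1)[OF aa _ H'] by simp
    show thesis
    proof (rule finish[OF aa _ H', of \<kappa> "min \<delta>1 \<delta>2"])
      fix x s assume s: "0 < s" "s < min \<delta>1 \<delta>2"
      have "\<beta> * s \<le> \<kappa> * s" using s by (intro mult_right_mono) (auto simp: \<kappa>_def)
      moreover have "(- \<alpha>) * s \<le> \<kappa> * s" using s by (intro mult_right_mono) (auto simp: \<kappa>_def)
      moreover have "\<alpha> * s \<le> g s" "g s \<le> \<beta> * s" using d1(2)[of s] d2(2)[of s] s by simp_all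
      ultimately have "g s \<le> \<kappa> * s" "- g s \<le> \<kappa> * s" by linarith+
      then have "\<bar>g s\<bar> \<le> \<kappa> * s" by simp
      then have "\<bar>a x\<bar> * \<bar>g s\<bar> \<le> \<bar>a x\<bar> * (\<kappa> * s)" by (intro mult_left_mono) auto
      moreover have "a x * g s \<le> \<bar>a x\<bar> * \<bar>g s\<bar>" by (metis abs_ge_self abs_mult)
      ultimately show "a x * g s \<le> \<kappa> * \<bar>a x\<bar> * s" by (simp add: mult_ac)
    qed (use d1 d2 b b' lp in \<open>auto simp: \<kappa>_def \<Lambda>_def[symmetric]\<close>)
  qed
qed

theorem theorem3p1:
  fixes L :: real and a g :: "real \<Rightarrow> real"
    and m :: nat and c d :: "nat \<Rightarrow> real"
  assumes L_pos: "L > 0"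
    and a_int: "a absolutely_integrable_on {0..L}"
    and g_cont: "continuous_on {0..} g"
    and g0inf: "g_zero_inf g > -\<infinity>"
    and g0sup: "g_zero_sup g < \<infinity>"
    and ginf: "g_infty g > 0"
    and H1_m: "m \<ge> 1"
    and H1_intervals: "\<forall>i\<in>{1..m}. 0 \<le> c i \<and> c i \<le> d i \<and> d i \<le> L"
    and H1_disjoint: "disjoint_family_on (\<lambda>i. {c i..d i}) {1..m}"
    and H1_nonneg: "AE x in lebesgue_on (\<Union>i\<in>{1..m}. {c i..d i}). a x \<ge> 0"
    and H1_nonpos: "AE x in lebesgue_on ({0..L} - (\<Union>i\<in>{1..m}. {c i..d i})). a x \<le> 0"
    and H2: "g 0 = 0" "\<exists>s\<ge>0. g s \<noteq> 0"
    and H3_nonneg: "(\<exists>\<delta>>0. \<forall>s\<in>{0..\<delta>}. g s \<ge> 0) \<longrightarrow>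
          not_ae_zero_on (pos_part a) {0..L} \<and>
          g_zero_sup g < ereal (first_eigenvalue (pos_part a) 0 L)"
    and H3_nonpos: "(\<exists>\<delta>>0. \<forall>s\<in>{0..\<delta>}. g s \<le> 0) \<longrightarrow>
          not_ae_zero_on (neg_part a) {0..L} \<and>
          g_zero_inf g > - ereal (first_eigenvalue (neg_part a) 0 L)"
    and H3_osc: "changes_sign_infinitely_at_zero g \<longrightarrow>
          not_ae_zero_on a {0..L} \<and>
          - ereal (first_eigenvalue (\<lambda>x. \<bar>a x\<bar>) 0 L) < g_zero_inf g \<and>
          g_zero_inf g \<le> g_zero_sup g \<and>
          g_zero_sup g < ereal (first_eigenvalue (\<lambda>x. \<bar>a x\<bar>) 0 L)"
    and H4: "\<forall>i\<in>{1..m}. not_ae_zero_on a {c i..d i} \<and>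
          g_infty g > ereal (first_eigenvalue (pos_part a) (c i) (d i))"
  shows "\<exists>u. positive_solution a g L u"
proof -
  obtain w \<kappa> \<delta> \<phi> \<psi> where \<delta>: "\<delta> > 0" and cmp: "\<And>x s. x \<in> {0..L} \<Longrightarrow> s \<in> {0..\<delta>} \<Longrightarrow> a x * g s \<le> \<kappa> * w x * s"
    and \<phi>: "second_order 0 L (\<lambda>x. \<kappa> * w x * \<phi> x) \<phi> \<psi>" "\<phi> 0 = 0" "\<And>x. x \<in> {0<..L} \<Longrightarrow> \<phi> x > 0"
    by (rule comparison_near_zero[OF a_int H2(1) H3_nonneg H3_nonpos H3_osc]) (assumption | rule that)+
  define F where "F = (\<Union>i\<in>{1..m}. {c i..d i})"
  have F: "closed F" "F \<in> sets lebesgue" by (auto simp: F_def intro!: sets.finite_UN)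
  obtain E1 where E1: "negligible E1" "\<forall>x\<in>F - E1. a x \<ge> 0"
    using H1_nonneg AE_lebesgue_on_iff_negligible[OF F(2)] unfolding F_def by blast
  obtain E2 where E2: "negligible E2" "\<forall>x\<in>{0..L} - F - E2. a x \<le> 0"
    using H1_nonpos AE_lebesgue_on_iff_negligible[of "{0..L} - F"] F(2) unfolding F_def by auto
  \<comment> \<open>one number \<open>q\<close> serves all intervals; inserting 0 makes it positive\<close>
  define X where "X = Max (insert 0 ((\<lambda>i. first_eigenvalue (pos_part a) (c i) (d i)) ` {1..m}))"
  have "X \<in> insert 0 ((\<lambda>i. first_eigenvalue (pos_part a) (c i) (d i)) ` {1..m})"
    unfolding X_def by (rule Max_in) auto
  then have "ereal X < g_infty g" using ginf H4 by (auto simp: zero_ereal_def)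
  then obtain q where q: "ereal X < ereal q" "ereal q < g_infty g" using ereal_dense2 by blast
  have Xq: "first_eigenvalue (pos_part a) (c i) (d i) < q" if "i \<in> {1..m}" for i
    using q(1) Max_ge[of "insert 0 ((\<lambda>i. first_eigenvalue (pos_part a) (c i) (d i)) ` {1..m})" "first_eigenvalue (pos_part a) (c i) (d i)"] that
    by (auto simp: X_def)
  have q0: "q > 0"
    using q(1) Max_ge[of "insert 0 ((\<lambda>i. first_eigenvalue (pos_part a) (c i) (d i)) ` {1..m})" 0] by (auto simp: X_def)
  obtain R where R: "R > 0" "\<And>s. s \<ge> R \<Longrightarrow> q * s \<le> g s" using above_line_near_infinity[OF q(2)] by blast
  obtain C where C: "C \<ge> 0" "\<And>s. s \<ge> 0 \<Longrightarrow> g s \<ge> q * s - C"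
  proof -
    have "continuous_on {0..R} (\<lambda>s. q * s - g s)"
      by (intro continuous_intros continuous_on_subset[OF g_cont]) auto
    then have "bounded ((\<lambda>s. q * s - g s) ` {0..R})"
      using compact_continuous_image compact_imp_bounded compact_Icc by blast
    then obtain C where C: "\<forall>s\<in>{0..R}. \<bar>q * s - g s\<bar> \<le> C" unfolding bounded_iff by auto
    have "C \<ge> 0" using C[rule_format, of 0] R by auto
    moreover have "g s \<ge> q * s - C" if "s \<ge> 0" for s
      using C[rule_format, of s] R(2)[of s] that \<open>C \<ge> 0\<close> by (cases "s \<le> R") auto
    ultimately show thesis by (rule that)
  qed
  \<comment> \<open>the bounds hold for every \<open>f\<close> above the line \<open>q s - C\<close>, hence for the truncation defined later\<close>
  define bounds where "bounds i M \<longleftrightarrow> (\<forall>f u v x. second_order (c i) (d i) (\<lambda>x. a x * f (u x)) u v \<longrightarrow>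
      (\<forall>x\<in>{c i..d i}. u x \<ge> 0) \<longrightarrow> (\<forall>s\<ge>0. f s \<ge> q * s - C) \<longrightarrow> x \<in> {c i..d i} \<longrightarrow> u x \<le> M)" for i M
  have "\<exists>M. bounds i M" if i: "i \<in> {1..m}" for i
  proof -
    have sub: "{c i..d i} \<subseteq> {0..L}" using H1_intervals i by auto
    have ai: "pos_part a absolutely_integrable_on {c i..d i}"
      using absolutely_integrable_on_subinterval[OF pos_part_absolutely_integrable[OF a_int] sub] .
    have eq: "a x = pos_part a x" if "x \<in> {c i..d i} - E1" for x
    proof -
      have "x \<in> F - E1" using that i unfolding F_def by blast
      then have "a x \<ge> 0" using E1(2) by blast
      then show ?thesis by (simp add: pos_part_def)
    qed
    have nz: "not_ae_zero_on (pos_part a) {c i..d i}"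
    proof -
      have "\<exists>E. negligible E \<and> (\<forall>x\<in>{c i..d i} - E. a x = 0)"
        if "negligible E" "\<forall>x\<in>{c i..d i} - E. pos_part a x = 0" for E
        using that eq E1(1) by (intro exI[of _ "E \<union> E1"]) auto
      moreover have "not_ae_zero_on a {c i..d i}" using H4 i by blast
      ultimately show ?thesis
        unfolding not_ae_zero_on_def AE_lebesgue_on_iff_negligible[OF fmeasurableD[OF lmeasurable_interval(1)]] by blast
    qed
    obtain M where M: "\<And>f u v x. second_order (c i) (d i) (\<lambda>x. a x * f (u x)) u v \<Longrightarrow> (\<And>x. x \<in> {c i..d i} \<Longrightarrow> u x \<ge> 0) \<Longrightarrow>
      (\<And>s. s \<ge> 0 \<Longrightarrow> f s \<ge> q * s - C) \<Longrightarrow> x \<in> {c i..d i} \<Longrightarrow> u x \<le> M"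
      by (rule bound_on_positive_interval[OF ai _ nz E1(1) eq Xq[OF i] C(1)],
          simp add: pos_part_def, assumption, rule that; blast)
    have "bounds i M"
      unfolding bounds_def
    proof (intro allI impI)
      fix f u v x
      assume A: "second_order (c i) (d i) (\<lambda>x. a x * f (u x)) u v" "\<forall>x\<in>{c i..d i}. u x \<ge> 0"
        "\<forall>s\<ge>0. f s \<ge> q * s - C" "x \<in> {c i..d i}"
      show "u x \<le> M" by (rule M[OF A(1)]) (use A in auto)
    qed
    then show ?thesis ..
  qed
  then obtain Mi where Mi: "\<And>i. i \<in> {1..m} \<Longrightarrow> bounds i (Mi i)" by metis
  define M where "M = Max (insert 0 (Mi ` {1..m}))"
  have M0: "M \<ge> 0" unfolding M_def by (rule Max_ge) auto
  have MM: "Mi i \<le> M" if "i \<in> {1..m}" for i unfolding M_def using that by (intro Max_ge) auto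
  have bM: "u x \<le> M" if so: "second_order 0 L (\<lambda>x. a x * f (u x)) u v" and u: "\<And>x. x \<in> {0..L} \<Longrightarrow> u x \<ge> 0"
    and f: "\<And>s. s \<ge> 0 \<Longrightarrow> f s \<ge> q * s - C" and x: "x \<in> F" for f u v x
  proof -
    obtain i where i: "i \<in> {1..m}" "x \<in> {c i..d i}" using x by (auto simp: F_def)
    have "u x \<le> Mi i"
    proof (rule Mi[OF i(1), unfolded bounds_def, rule_format, OF _ _ _ i(2)])
      show "second_order (c i) (d i) (\<lambda>x. a x * f (u x)) u v"
        using second_order_subinterval[OF so] H1_intervals i(1) by blast
      show "0 \<le> u x" if "x \<in> {c i..d i}" for x
      proof (rule u)
        have "0 \<le> c i" "d i \<le> L" using H1_intervals i(1) by auto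
        then show "x \<in> {0..L}" using that by auto
      qed
    qed (rule f)
    then show ?thesis using MM[OF i(1)] by simp
  qed
  define B where "B = M + C * integral {0..L} (\<lambda>x. \<bar>a x\<bar>) * L"
  have bB: "u x \<le> B" if so: "second_order 0 L (\<lambda>x. a x * f (u x)) u v" and u: "\<And>x. x \<in> {0..L} \<Longrightarrow> u x \<ge> 0"
    "u 0 = 0" "u L = 0" and f: "\<And>s. s \<ge> 0 \<Longrightarrow> f s \<ge> q * s - C" and x: "x \<in> {0..L}" for f u v x
    unfolding B_def
  proof (rule bound_off_positive_intervals[OF a_int so u(2,3,1) _ C(1) F(1) _ M0 E2(1) _ x])
    show "- C \<le> f s" if s: "s \<ge> 0" for s
    proof -
      have "q * s \<ge> 0" using q0 s by simp
      then show ?thesis using f[OF s] by linarith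
    qed
    show "u x \<le> M" if "x \<in> F \<inter> {0..L}" for x using bM[OF so u(1) f] that by auto
    show "a x \<le> 0" if "x \<in> {0..L} - F - E2" for x using E2(2) that by blast
  qed
  \<comment> \<open>\<open>K\<close> exceeds \<open>B\<close>, so solutions do not notice the truncation, and \<open>R\<close>, so that \<open>g K / K \<ge> q\<close>\<close>
  define K where "K = max (max R B) \<delta> + 1"
  have K: "K > 0" "R < K" "B < K" "\<delta> < K" using R(1) by (auto simp: K_def)
  define G where "G s = (if s \<le> K then g s else g K / K * s)" for s
  have Gc: "continuous_on {0..} G"
  proof -
    have "continuous_on ({0..K} \<union> {K..}) (\<lambda>s. if s \<le> K then g s else g K / K * s)"
      using K by (intro continuous_on_cases continuous_intros continuous_on_subset[OF g_cont]) auto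
    moreover have "{0..K} \<union> {K..} = {0..}" using K(1) by auto
    ultimately show ?thesis by (simp add: G_def[abs_def])
  qed
  obtain \<Lambda> where \<Lambda>: "\<And>s. s \<ge> 0 \<Longrightarrow> \<bar>G s\<bar> \<le> \<Lambda> * s"
  proof -
    obtain \<alpha> where al: "ereal \<alpha> < g_zero_inf g" using ereal_dense2[OF g0inf] by blast
    obtain \<beta> where be: "g_zero_sup g < ereal \<beta>" using ereal_dense2[OF g0sup] by blast
    obtain \<delta>1 where d1: "\<delta>1 > 0" "\<And>s. 0 < s \<Longrightarrow> s < \<delta>1 \<Longrightarrow> \<alpha> * s \<le> g s" using above_line_near_zero[OF al] by blast
    obtain \<delta>2 where d2: "\<delta>2 > 0" "\<And>s. 0 < s \<Longrightarrow> s < \<delta>2 \<Longrightarrow> g s \<le> \<beta> * s" using below_line_near_zero[OF be] by blast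
    define \<eta> where "\<eta> = min (min \<delta>1 \<delta>2) K / 2"
    have eta: "\<eta> > 0" "\<eta> < \<delta>1" "\<eta> < \<delta>2" "\<eta> < K" using d1(1) d2(1) K(1) by (auto simp: \<eta>_def)
    have "bounded (g ` {\<eta>..K})"
      using eta by (intro compact_imp_bounded compact_continuous_image continuous_on_subset[OF g_cont]) auto
    then obtain D where "\<forall>s\<in>{\<eta>..K}. \<bar>g s\<bar> \<le> D" unfolding bounded_iff by auto
    then have D: "\<bar>g s\<bar> \<le> D" if "s \<in> {\<eta>..K}" for s using that by blast
    have D0: "D \<ge> 0" using D[of K] eta by force
    define \<Lambda> where "\<Lambda> = \<bar>\<alpha>\<bar> + \<bar>\<beta>\<bar> + D / \<eta>"
    have Deta: "D / \<eta> \<ge> 0" using D0 eta by simp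
    have mid: "\<bar>g s\<bar> \<le> \<Lambda> * s" if s: "0 \<le> s" "s \<le> K" for s
    proof -
      consider "s = 0" | "0 < s" "s < \<eta>" | "\<eta> \<le> s" using s by linarith
      then show ?thesis
      proof cases
        case 1 then show ?thesis using H2(1) by simp
      next
        case 2
        have "\<bar>g s\<bar> \<le> \<bar>\<alpha>\<bar> * s + \<bar>\<beta>\<bar> * s"
        proof -
          have "\<alpha> * s \<le> g s" "g s \<le> \<beta> * s" using d1(2)[of s] d2(2)[of s] 2 eta by auto
          moreover have "- (\<bar>\<alpha>\<bar> * s) \<le> \<alpha> * s" "\<beta> * s \<le> \<bar>\<beta>\<bar> * s"
            using 2 mult_right_mono[of "- \<bar>\<alpha>\<bar>" \<alpha> s] mult_right_mono[of \<beta> "\<bar>\<beta>\<bar>" s] by simp_all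
          moreover have "0 \<le> \<bar>\<alpha>\<bar> * s" "0 \<le> \<bar>\<beta>\<bar> * s" using 2 by simp_all
          ultimately show ?thesis by linarith
        qed
        also have "\<dots> \<le> \<Lambda> * s" using mult_nonneg_nonneg[OF Deta s(1)] by (simp add: \<Lambda>_def distrib_right)
        finally show ?thesis .
      next
        case 3
        have "\<bar>g s\<bar> \<le> D" using D[of s] 3 s by simp
        also have "\<dots> \<le> D / \<eta> * s" using 3 eta D0 by (simp add: field_simps mult_left_mono)
        also have "\<dots> \<le> \<Lambda> * s" using s by (intro mult_right_mono) (auto simp: \<Lambda>_def)
        finally show ?thesis .
      qed
    qed
    have "\<bar>G s\<bar> \<le> \<Lambda> * s" if s: "s \<ge> 0" for s
    proof (cases "s \<le> K")
      case True then show ?thesis using mid s by (simp add: G_def)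
    next
      case False
      have "\<bar>g K\<bar> / K \<le> \<Lambda>" using mid[of K] K(1) by (simp add: pos_divide_le_eq)
      then have "\<bar>g K\<bar> / K * s \<le> \<Lambda> * s" using s by (intro mult_right_mono)
      then show ?thesis using False K(1) s by (simp add: G_def abs_mult)
    qed
    then show thesis by (rule that)
  qed
  have Gq: "G s \<ge> q * s - C" if s: "s \<ge> 0" for s
  proof (cases "s \<le> K")
    case False
    have "q \<le> g K / K" using R(2)[of K] K by (simp add: pos_le_divide_eq)
    then have "q * s \<le> g K / K * s" using s by (intro mult_right_mono)
    then show ?thesis using False C(1) by (simp add: G_def)
  qed (use C(2) s in \<open>simp add: G_def\<close>)
  have Gcmp: "a x * G s \<le> \<kappa> * w x * s" if "x \<in> {0..L}" "s \<in> {0..\<delta>}" for x s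
    using cmp[OF that] that K by (simp add: G_def)
  have one: "1 \<in> {1..m}" using H1_m by simp
  have cd1: "0 \<le> c 1" "c 1 < d 1" "d 1 \<le> L"
    using H1_intervals one H4 not_ae_zero_on_nondegenerate by blast+
  have bM1: "u x \<le> M" if "second_order 0 L (\<lambda>x. a x * f (u x)) u v" "\<And>x. x \<in> {0..L} \<Longrightarrow> u x \<ge> 0"
    "\<And>s. s \<ge> 0 \<Longrightarrow> f s \<ge> q * s - C" "x \<in> {c 1..d 1}" for f u v x
  proof (rule bM[OF that(1-3)])
    show "x \<in> F" unfolding F_def using that(4) one by blast
  qed
  obtain U V where so: "second_order 0 L (\<lambda>x. a x * G (U x)) U V" and U0: "U 0 = 0" "U L = 0"
    and Ub: "\<And>x. x \<in> {0..L} \<Longrightarrow> 0 \<le> U x \<and> U x \<le> B" and big: "\<exists>x\<in>{0..L}. U x \<ge> \<delta> / 2"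
  proof (rule positive_solution_linear_growth[where G=G and K=\<Lambda> and L=L and a=a and w=w and \<kappa>=\<kappa> and \<delta>=\<delta>
        and q=q and C=C and c="c 1" and d="d 1" and M=M and B=B and \<phi>=\<phi> and \<psi>=\<psi>])
    note found = that
    show "\<bar>G s\<bar> \<le> \<Lambda> * s" if "s \<ge> 0" for s by (rule \<Lambda>[OF that])
    show "a x * G s \<le> \<kappa> * w x * s" if "x \<in> {0..L}" "s \<in> {0..\<delta>}" for x s by (rule Gcmp[OF that])
    show "\<phi> x > 0" if "x \<in> {0<..L}" for x by (rule \<phi>(3)[OF that])
    show "G s \<ge> q * s - C" if "s \<ge> 0" for s by (rule Gq[OF that])
    show "u x \<le> M" if "second_order 0 L (\<lambda>x. a x * f (u x)) u v" "\<And>x. x \<in> {0..L} \<Longrightarrow> u x \<ge> 0"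
      "\<And>s. s \<ge> 0 \<Longrightarrow> f s \<ge> q * s - C" "x \<in> {c 1..d 1}" for f u v x by (rule bM1[OF that])
    show "u x \<le> B" if "second_order 0 L (\<lambda>x. a x * f (u x)) u v" "\<And>x. x \<in> {0..L} \<Longrightarrow> u x \<ge> 0"
      "u 0 = 0" "u L = 0" "\<And>s. s \<ge> 0 \<Longrightarrow> f s \<ge> q * s - C" "x \<in> {0..L}" for f u v x by (rule bB[OF that])
    show thesis if "second_order 0 L (\<lambda>x. a x * G (U x)) U V" "U 0 = 0" "U L = 0"
      "\<And>x. x \<in> {0..L} \<Longrightarrow> 0 \<le> U x \<and> U x \<le> B" "\<exists>x\<in>{0..L}. U x \<ge> \<delta> / 2" for U V
      by (rule found[OF that])
  qed (rule L_pos a_int Gc \<delta> \<phi>(1) \<phi>(2) C(1) cd1)+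
  have GU: "G (U x) = g (U x)" if "x \<in> {0..L}" for x using Ub[OF that] K by (simp add: G_def)
  have so': "second_order 0 L (\<lambda>x. a x * g (U x)) U V"
    by (rule second_order_spike[OF so negligible_empty]) (use GU in auto)
  have pos: "U x > 0" if x: "x \<in> {0<..<L}" for x
  proof (rule ccontr)
    assume "\<not> U x > 0"
    then have Ux: "U x = 0" using Ub[of x] x by auto
    have Vx: "V x = 0"
      using second_order_interior_minimum[OF so x] Ux Ub by auto
    have k: "(\<lambda>x. \<Lambda> * \<bar>a x\<bar>) absolutely_integrable_on {0..L}"
      using absolutely_integrable_mult_continuous[OF set_integrable_abs[OF a_int] continuous_on_const[of _ \<Lambda>]]
      by (simp add: mult.commute)
    have \<Lambda>0: "\<Lambda> \<ge> 0" using \<Lambda>[of 1] by simp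
    obtain y where y: "y \<in> {0..L}" "U y \<ge> \<delta> / 2" using big by blast
    have "U y = 0"
    proof (rule second_order_no_double_zero(1)[OF so k _ _ _ Ux Vx y(1)])
      fix t assume t: "t \<in> {0..L}"
      have "\<bar>a t\<bar> * \<bar>G (U t)\<bar> \<le> \<bar>a t\<bar> * (\<Lambda> * U t)" using \<Lambda> Ub[OF t] by (intro mult_left_mono) auto
      then show "\<bar>a t * G (U t)\<bar> \<le> \<Lambda> * \<bar>a t\<bar> * \<bar>U t\<bar>" using Ub[OF t] by (simp add: abs_mult mult_ac)
    qed (use \<Lambda>0 x in auto)
    then show False using y \<delta> by simp
  qed
  have "dirichlet_solution (\<lambda>x s. a x * g s) 0 L U"
    using so' U0 by (intro dirichlet_solution_if_second_order)
  then show ?thesis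
    unfolding positive_solution_def using Ub pos by blast
qed

end
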